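(* Let $k$ be a commutative ring, let $L=k[t_i \mid i\in\mathcal I]$ be a polynomial ring over $k$ in an arbitrary (possibly infinite) set of variables, and let $A$ be a commutative finitely generated $k$-algebra. Put $A_L=L\otimes_k A$. Then for every integer $m\ge 1$ the base change map $$\Phi^{L,A}_m: L\otimes_k \mathrm{IDer}_k(A;m)\longrightarrow \mathrm{IDer}_L(A_L;m),\qquad c\otimes\delta\longmapsto c\,\widetilde\delta,$$ is an isomorphism of $A_L$-modules. Moreover, $\mathrm{Leaps}_k(A)=\mathrm{Leaps}_L(A_L)$.
   Context: All rings are commutative. For a ring $k$, a $k$-algebra $A$ and an integer $m\ge 1$, a Hasse-Schmidt derivation of $A$ over $k$ of length $m$ is a sequence $D=(D_0,D_1,\dots,D_m)$ of $k$-linear maps $D_i:A\to A$ with $D_0=\mathrm{Id}_A$ and $D_n(xy)=\sum_{i+j=n}D_i(x)D_j(y)$ for all $x,y\in A$ and all $n\le m$. In particular $D_1\in\mathrm{Der}_k(A)$. A derivation $\delta\in\mathrm{Der}_k(A)$ is $m$-integrable if there is a Hasse-Schmidt derivation $D$ of $A$ over $k$ of length $m$ with $D_1=\delta$; the set $\mathrm{IDer}_k(A;m)$ of $m$-integrable derivations is an $A$-submodule of $\mathrm{Der}_k(A)$. The $k$-algebra $A$ has a leap at an integer $s>1$ if the inclusion $\mathrm{IDer}_k(A;s)\subseteq\mathrm{IDer}_k(A;s-1)$ is proper; $\mathrm{Leaps}_k(A)$ is the set of leaps of $A$ over $k$ (and similarly for the $L$-algebra $A_L$ over $L$). For $\delta\in\mathrm{Der}_k(A)$,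 $\widetilde\delta\in\mathrm{Der}_L(A_L)$ is its $L$-linear extension $\widetilde\delta(c\otimes a)=c\otimes\delta(a)$; if $\delta$ is $m$-integrable then so is $\widetilde\delta$, so $\Phi^{L,A}_m$ is well defined. *)

theory Defs
  imports "HOL-Algebra.Algebra" "HOL-Algebra.Indexed_Polynomials"
    "HOL-Algebra.Free_Abelian_Groups"
begin

section \<open>Tensor products of modules over a commutative ring\<close>

text \<open>The tensor product of two modules over \<open>R\<close> is the free abelian group on the pairs of
  elements, modulo the subgroup generated by the usual bilinearity relations. Its elements are
  cosets, i.e. sets of formal integer combinations of pairs.\<close>

definition tensor_relators ::
  "('r, 'x) ring_scheme \<Rightarrow> ('r, 'm, 'y) module_scheme \<Rightarrow> ('r, 'n, 'z) module_scheme
    \<Rightarrow> ('m \<times> 'n \<Rightarrow>\<^sub>0 int) set" where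
  "tensor_relators R M N =
     {frag_of (x \<oplus>\<^bsub>M\<^esub> x', y) - frag_of (x, y) - frag_of (x', y) | x x' y.
        x \<in> carrier M \<and> x' \<in> carrier M \<and> y \<in> carrier N}
   \<union> {frag_of (x, y \<oplus>\<^bsub>N\<^esub> y') - frag_of (x, y) - frag_of (x, y') | x y y'.
        x \<in> carrier M \<and> y \<in> carrier N \<and> y' \<in> carrier N}
   \<union> {frag_of (r \<odot>\<^bsub>M\<^esub> x, y) - frag_of (x, r \<odot>\<^bsub>N\<^esub> y) | r x y.
        r \<in> carrier R \<and> x \<in> carrier M \<and> y \<in> carrier N}"

definition tensor_kernel ::
  "('r, 'x) ring_scheme \<Rightarrow> ('r, 'm, 'y) module_scheme \<Rightarrow> ('r, 'n, 'z) module_scheme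
    \<Rightarrow> ('m \<times> 'n \<Rightarrow>\<^sub>0 int) set" where
  "tensor_kernel R M N =
     generate (free_Abelian_group (carrier M \<times> carrier N)) (tensor_relators R M N)"

definition tensor_group ::
  "('r, 'x) ring_scheme \<Rightarrow> ('r, 'm, 'y) module_scheme \<Rightarrow> ('r, 'n, 'z) module_scheme
    \<Rightarrow> ('m \<times> 'n \<Rightarrow>\<^sub>0 int) set monoid" where
  "tensor_group R M N = free_Abelian_group (carrier M \<times> carrier N) Mod tensor_kernel R M N"

definition tensor_class ::
  "('r, 'x) ring_scheme \<Rightarrow> ('r, 'm, 'y) module_scheme \<Rightarrow> ('r, 'n, 'z) module_scheme
    \<Rightarrow> ('m \<times> 'n \<Rightarrow>\<^sub>0 int) \<Rightarrow> ('m \<times> 'n \<Rightarrow>\<^sub>0 int) set" where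
  "tensor_class R M N x =
     tensor_kernel R M N #>\<^bsub>free_Abelian_group (carrier M \<times> carrier N)\<^esub> x"

definition pure_tensor ::
  "('r, 'x) ring_scheme \<Rightarrow> ('r, 'm, 'y) module_scheme \<Rightarrow> ('r, 'n, 'z) module_scheme
    \<Rightarrow> 'm \<Rightarrow> 'n \<Rightarrow> ('m \<times> 'n \<Rightarrow>\<^sub>0 int) set" where
  "pure_tensor R M N a b = tensor_class R M N (frag_of (a, b))"

text \<open>The additive map out of a tensor product that sends the pure tensor of \<open>a\<close> and \<open>b\<close> to
  \<open>f a b\<close>. All representatives of a coset have the same image when \<open>f\<close> is biadditive and
  balanced, so that the image of the coset is then a singleton.\<close>

definition tensor_lift ::
  "('p, 'w) ring_scheme \<Rightarrow> ('m \<Rightarrow> 'n \<Rightarrow> 'p) \<Rightarrow> ('m \<times> 'n \<Rightarrow>\<^sub>0 int) set \<Rightarrow> 'p" where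
  "tensor_lift P f U =
     the_elem ((\<lambda>x. \<Oplus>\<^bsub>P\<^esub>p \<in> Poly_Mapping.keys x.
                      add_pow P (Poly_Mapping.lookup x p) (f (fst p) (snd p))) ` U)"

text \<open>The biadditive operation on cosets induced by a binary operation \<open>u\<close> on pairs. As above,
  the image is a singleton for the operations to which this is applied below.\<close>

definition tensor_action ::
  "('r, 'x) ring_scheme \<Rightarrow> ('r, 'm, 'y) module_scheme \<Rightarrow> ('r, 'n, 'z) module_scheme
    \<Rightarrow> ('s \<Rightarrow> 'm \<times> 'n \<Rightarrow> 'm \<times> 'n) \<Rightarrow> ('s \<Rightarrow>\<^sub>0 int) set \<Rightarrow> ('m \<times> 'n \<Rightarrow>\<^sub>0 int) set
    \<Rightarrow> ('m \<times> 'n \<Rightarrow>\<^sub>0 int) set" where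
  "tensor_action R M N u U V =
     the_elem ((\<lambda>(x, y). tensor_class R M N
                 (frag_extend (\<lambda>p. frag_extend (\<lambda>q. frag_of (u p q)) y) x)) ` (U \<times> V))"


section \<open>Base change\<close>

text \<open>The algebra \<open>L \<otimes>\<^sub>R A\<close> over \<open>L\<close>, for algebras \<open>L\<close> and \<open>A\<close> over \<open>R\<close>: the product is
  \<open>(c \<otimes> a) (d \<otimes> b) = c d \<otimes> a b\<close>, and \<open>c \<in> L\<close> acts as multiplication by \<open>c \<otimes> 1\<close>.\<close>

definition base_change_mult ::
  "('r, 'x) ring_scheme \<Rightarrow> ('r, 'l, 'y) module_scheme \<Rightarrow> ('r, 'a, 'z) module_scheme
    \<Rightarrow> ('l \<times> 'a \<Rightarrow>\<^sub>0 int) set \<Rightarrow> ('l \<times> 'a \<Rightarrow>\<^sub>0 int) set \<Rightarrow> ('l \<times> 'a \<Rightarrow>\<^sub>0 int) set" where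
  "base_change_mult R L A =
     tensor_action R L A (\<lambda>(c, a) (d, b). (c \<otimes>\<^bsub>L\<^esub> d, a \<otimes>\<^bsub>A\<^esub> b))"

definition base_change ::
  "('r, 'x) ring_scheme \<Rightarrow> ('r, 'l, 'y) module_scheme \<Rightarrow> ('r, 'a, 'z) module_scheme
    \<Rightarrow> ('l, ('l \<times> 'a \<Rightarrow>\<^sub>0 int) set) module" where
  "base_change R L A =
     \<lparr>carrier = carrier (tensor_group R L A),
      monoid.mult = base_change_mult R L A,
      one = pure_tensor R L A \<one>\<^bsub>L\<^esub> \<one>\<^bsub>A\<^esub>,
      ring.zero = \<one>\<^bsub>tensor_group R L A\<^esub>,
      add = (\<otimes>\<^bsub>tensor_group R L A\<^esub>),
      smult = (\<lambda>c. base_change_mult R L A (pure_tensor R L A c \<one>\<^bsub>A\<^esub>))\<rparr>"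

text \<open>A module over the \<open>R\<close>-algebra \<open>A\<close>, regarded as a module over \<open>R\<close>.\<close>

definition restrict_scalars ::
  "('r, 'a, 'y) module_scheme \<Rightarrow> ('a, 'm, 'z) module_scheme \<Rightarrow> ('r, 'm) module" where
  "restrict_scalars A M =
     \<lparr>carrier = carrier M, monoid.mult = monoid.mult M, one = monoid.one M,
      ring.zero = ring.zero M, add = ring.add M,
      smult = (\<lambda>r x. (r \<odot>\<^bsub>A\<^esub> \<one>\<^bsub>A\<^esub>) \<odot>\<^bsub>M\<^esub> x)\<rparr>"

text \<open>For a module \<open>M\<close> over \<open>A\<close>, the module \<open>L \<otimes>\<^sub>R M\<close> over \<open>L \<otimes>\<^sub>R A\<close>, with action
  \<open>(c \<otimes> a) (d \<otimes> x) = c d \<otimes> a x\<close>. Modules are records extending rings; the multiplicative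
  fields of a mere module carry no information.\<close>

definition base_change_module ::
  "('r, 'x) ring_scheme \<Rightarrow> ('r, 'l, 'y) module_scheme \<Rightarrow> ('r, 'a, 'z) module_scheme
    \<Rightarrow> ('a, 'm, 'w) module_scheme
    \<Rightarrow> (('l \<times> 'a \<Rightarrow>\<^sub>0 int) set, ('l \<times> 'm \<Rightarrow>\<^sub>0 int) set) module" where
  "base_change_module R L A M =
     \<lparr>carrier = carrier (tensor_group R L (restrict_scalars A M)),
      monoid.mult = undefined,
      one = undefined,
      ring.zero = \<one>\<^bsub>tensor_group R L (restrict_scalars A M)\<^esub>,
      add = (\<otimes>\<^bsub>tensor_group R L (restrict_scalars A M)\<^esub>),
      smult = tensor_action R L (restrict_scalars A M)
                (\<lambda>(c, a) (d, x). (c \<otimes>\<^bsub>L\<^esub> d, a \<odot>\<^bsub>M\<^esub> x))\<rparr>"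

definition module_iso ::
  "('r, 'x) ring_scheme \<Rightarrow> ('r, 'm, 'y) module_scheme \<Rightarrow> ('r, 'n, 'z) module_scheme
    \<Rightarrow> ('m \<Rightarrow> 'n) \<Rightarrow> bool" where
  "module_iso R M N f \<longleftrightarrow>
     module R M \<and> module R N \<and> bij_betw f (carrier M) (carrier N) \<and>
     (\<forall>x\<in>carrier M. \<forall>y\<in>carrier M. f (x \<oplus>\<^bsub>M\<^esub> y) = f x \<oplus>\<^bsub>N\<^esub> f y) \<and>
     (\<forall>r\<in>carrier R. \<forall>x\<in>carrier M. f (r \<odot>\<^bsub>M\<^esub> x) = r \<odot>\<^bsub>N\<^esub> f x)"


section \<open>Polynomial rings and finitely generated algebras\<close>

text \<open>The polynomial ring over \<open>R\<close> in the variables indexed by the set \<open>I\<close>, as an algebra over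
  \<open>R\<close>. Monomials are multisets of indices.\<close>

definition indexed_poly_ring :: "('r, 'x) ring_scheme \<Rightarrow> 'i set \<Rightarrow> ('r, 'i multiset \<Rightarrow> 'r) module" where
  "indexed_poly_ring R I =
     \<lparr>carrier = ring.indexed_pset R I (carrier R),
      monoid.mult = (\<lambda>p q m. \<Oplus>\<^bsub>R\<^esub>n \<in> {n. n \<subseteq># m}. p n \<otimes>\<^bsub>R\<^esub> q (m - n)),
      one = ring.indexed_const R \<one>\<^bsub>R\<^esub>,
      ring.zero = ring.indexed_const R \<zero>\<^bsub>R\<^esub>,
      add = ring.indexed_padd R,
      smult = (\<lambda>c p m. c \<otimes>\<^bsub>R\<^esub> p m)\<rparr>"

text \<open>The subalgebra generated by \<open>S\<close> is the subring generated by \<open>S\<close> and the image of the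
  base ring.\<close>

definition finitely_generated_algebra ::
  "('r, 'x) ring_scheme \<Rightarrow> ('r, 'a, 'y) module_scheme \<Rightarrow> bool" where
  "finitely_generated_algebra R A \<longleftrightarrow>
     (\<exists>S. finite S \<and> S \<subseteq> carrier A \<and>
        generate_ring A (S \<union> (\<lambda>r. r \<odot>\<^bsub>A\<^esub> \<one>\<^bsub>A\<^esub>) ` carrier R) = carrier A)"


section \<open>Integrable derivations and leaps\<close>

definition linear_endo ::
  "('k, 'x) ring_scheme \<Rightarrow> ('k, 'a, 'y) module_scheme \<Rightarrow> ('a \<Rightarrow> 'a) \<Rightarrow> bool" where
  "linear_endo k A f \<longleftrightarrow>
     f \<in> carrier A \<rightarrow> carrier A \<and>
     (\<forall>x\<in>carrier A. \<forall>y\<in>carrier A. f (x \<oplus>\<^bsub>A\<^esub> y) = f x \<oplus>\<^bsub>A\<^esub> f y) \<and>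
     (\<forall>c\<in>carrier k. \<forall>x\<in>carrier A. f (c \<odot>\<^bsub>A\<^esub> x) = c \<odot>\<^bsub>A\<^esub> f x)"

text \<open>Derivations are taken to be extensional, so that they are determined by their values on
  the carrier of \<open>A\<close>.\<close>

definition Der :: "('k, 'x) ring_scheme \<Rightarrow> ('k, 'a, 'y) module_scheme \<Rightarrow> ('a \<Rightarrow> 'a) set" where
  "Der k A = {\<delta> \<in> extensional (carrier A). linear_endo k A \<delta> \<and>
     (\<forall>x\<in>carrier A. \<forall>y\<in>carrier A. \<delta> (x \<otimes>\<^bsub>A\<^esub> y) = x \<otimes>\<^bsub>A\<^esub> \<delta> y \<oplus>\<^bsub>A\<^esub> y \<otimes>\<^bsub>A\<^esub> \<delta> x)}"

text \<open>Only the components \<open>D 0, \<dots>, D m\<close> of the sequence \<open>D\<close> are relevant.\<close>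

definition hasse_schmidt ::
  "('k, 'x) ring_scheme \<Rightarrow> ('k, 'a, 'y) module_scheme \<Rightarrow> nat \<Rightarrow> (nat \<Rightarrow> 'a \<Rightarrow> 'a) \<Rightarrow> bool" where
  "hasse_schmidt k A m D \<longleftrightarrow>
     (\<forall>n\<le>m. linear_endo k A (D n)) \<and>
     (\<forall>x\<in>carrier A. D 0 x = x) \<and>
     (\<forall>n\<le>m. \<forall>x\<in>carrier A. \<forall>y\<in>carrier A.
        D n (x \<otimes>\<^bsub>A\<^esub> y) = (\<Oplus>\<^bsub>A\<^esub>i \<in> {..n}. D i x \<otimes>\<^bsub>A\<^esub> D (n - i) y))"

definition IDer :: "('k, 'x) ring_scheme \<Rightarrow> ('k, 'a, 'y) module_scheme \<Rightarrow> nat \<Rightarrow> ('a \<Rightarrow> 'a) set" where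
  "IDer k A m = {\<delta> \<in> Der k A. \<exists>D. hasse_schmidt k A m D \<and> (\<forall>x\<in>carrier A. D 1 x = \<delta> x)}"

definition IDer_module ::
  "('k, 'x) ring_scheme \<Rightarrow> ('k, 'a, 'y) module_scheme \<Rightarrow> nat \<Rightarrow> ('a, 'a \<Rightarrow> 'a) module" where
  "IDer_module k A m =
     \<lparr>carrier = IDer k A m,
      monoid.mult = undefined,
      one = undefined,
      ring.zero = (\<lambda>x\<in>carrier A. \<zero>\<^bsub>A\<^esub>),
      add = (\<lambda>\<delta> \<epsilon>. \<lambda>x\<in>carrier A. \<delta> x \<oplus>\<^bsub>A\<^esub> \<epsilon> x),
      smult = (\<lambda>a \<delta>. \<lambda>x\<in>carrier A. a \<otimes>\<^bsub>A\<^esub> \<delta> x)\<rparr>"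

definition Leaps :: "('k, 'x) ring_scheme \<Rightarrow> ('k, 'a, 'y) module_scheme \<Rightarrow> nat set" where
  "Leaps k A = {s. s > 1 \<and> IDer k A s \<subset> IDer k A (s - 1)}"

text \<open>The \<open>L\<close>-linear extension \<open>c \<otimes> a \<mapsto> c \<otimes> \<delta> a\<close> of a derivation \<open>\<delta>\<close> of \<open>A\<close>.\<close>

definition extend_derivation ::
  "('k, 'x) ring_scheme \<Rightarrow> ('k, 'l, 'y) module_scheme \<Rightarrow> ('k, 'a, 'z) module_scheme
    \<Rightarrow> ('a \<Rightarrow> 'a) \<Rightarrow> ('l \<times> 'a \<Rightarrow>\<^sub>0 int) set \<Rightarrow> ('l \<times> 'a \<Rightarrow>\<^sub>0 int) set" where
  "extend_derivation k L A \<delta> =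
     (\<lambda>U\<in>carrier (base_change k L A).
        tensor_lift (base_change k L A) (\<lambda>c a. pure_tensor k L A c (\<delta> a)) U)"

definition scaled_extension ::
  "('k, 'x) ring_scheme \<Rightarrow> ('k, 'l, 'y) module_scheme \<Rightarrow> ('k, 'a, 'z) module_scheme
    \<Rightarrow> 'l \<Rightarrow> ('a \<Rightarrow> 'a) \<Rightarrow> ('l \<times> 'a \<Rightarrow>\<^sub>0 int) set \<Rightarrow> ('l \<times> 'a \<Rightarrow>\<^sub>0 int) set" where
  "scaled_extension k L A c \<delta> =
     (\<lambda>U\<in>carrier (base_change k L A). c \<odot>\<^bsub>base_change k L A\<^esub> extend_derivation k L A \<delta> U)"

text \<open>The base change map \<open>\<Phi>\<close>, the additive map with \<open>\<Phi> (c \<otimes> \<delta>) = scaled_extension k L A c \<delta>\<close>.\<close>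

definition base_change_map ::
  "('k, 'x) ring_scheme \<Rightarrow> ('k, 'l, 'y) module_scheme \<Rightarrow> ('k, 'a, 'z) module_scheme \<Rightarrow> nat
    \<Rightarrow> ('l \<times> ('a \<Rightarrow> 'a) \<Rightarrow>\<^sub>0 int) set
    \<Rightarrow> ('l \<times> 'a \<Rightarrow>\<^sub>0 int) set \<Rightarrow> ('l \<times> 'a \<Rightarrow>\<^sub>0 int) set" where
  "base_change_map k L A m =
     tensor_lift (IDer_module L (base_change k L A) m) (scaled_extension k L A)"

end

theory Submission
  imports Defs "HOL-Library.Product_Plus"
begin

text \<open>
  Since \<open>L\<close> is free over \<open>k\<close> on the monomials \<open>t\<^sup>\<alpha>\<close>, every element of \<open>L \<otimes> N\<close> has coefficients
  in \<open>N\<close>, and injectivity of \<open>\<Phi>\<close> as well as finiteness of the support of a derivation of the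
  finitely generated algebra \<open>A\<^sub>L\<close> are immediate. The point is that the coefficients of an
  integrable derivation of \<open>A\<^sub>L\<close> are integrable. Let \<open>D\<close> be a Hasse--Schmidt derivation of \<open>A\<^sub>L\<close>
  over \<open>L\<close>. The maps \<open>E (i, \<beta>) a =\<close> coefficient of \<open>t\<^sup>\<beta>\<close> in \<open>D i (1 \<otimes> a)\<close> form a
  Hasse--Schmidt derivation of \<open>A\<close> indexed by the monoid of pairs \<open>(i, \<beta>)\<close>. If the support of such
  an \<open>E\<close> is split into two disjoint subsemigroups \<open>S\<close> and \<open>T\<close>, then \<open>E = F \<circ> G\<close> for unique \<open>F\<close>
  and \<open>G\<close> supported on \<open>S\<close> and \<open>T\<close> (up to the index 0), and both factors are again
  Hasse--Schmidt derivations. Fix \<open>\<alpha>\<close> and a total order on monomials that is compatible with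
  multiplication. Comparing \<open>\<beta>\<close> with \<open>i \<alpha>\<close> splits the indices into the part below the ray
  \<open>(i, i \<alpha>)\<close>, the ray, and the part above it; factoring twice isolates a factor supported on the ray,
  which is an ordinary Hasse--Schmidt derivation of \<open>A\<close> that integrates \<open>E (1, \<alpha>)\<close>.
\<close>

section \<open>Convolution over a monoid with finitely many splittings\<close>

text \<open>Simply restricting \<open>E\<close> to the ray fails: an index below the ray and one
  above it can add up to a point of the ray, so the Leibniz rule at that point has mixed terms.
  Composition removes them. Once the part below is split off, the rest lives on the ray and above
  it, and there a sum of two indices lies on the ray only if both summands do. The Leibniz rule
  passes to the factors by cancellation: in the expansion of \<open>E w\<close> on a product, all
  terms but one are known by induction on the index, and two equal sums in an abelian group that
  agree in all terms but one agree in that one too. The coefficient at \<open>(1, \<alpha>)\<close>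
  survives both factorizations unchanged: every index in the three regions has a positive first
  component, so \<open>(1, \<alpha>)\<close> is not a sum of two of them. Truncation at length m is
  compatible with all this, because the indices with first component at most m are closed under
  taking summands.\<close>

definition splits :: "'m::comm_monoid_add \<Rightarrow> ('m \<times> 'm) set" where
  "splits w = {p. fst p + snd p = w}"

text \<open>Finiteness makes every Leibniz sum a finite sum, and \<open>zero_sum_free\<close> makes
  \<open>(0, 0)\<close> the only splitting of 0. Together with cancellation they make the number of
  splittings drop strictly from an index to a proper summand, which gives a measure for recursion
  and induction.\<close>

class finite_splits = cancel_comm_monoid_add +
  assumes finite_splits: "finite {p. fst p + snd p = w}"
    and zero_sum_free: "a + b = 0 \<Longrightarrow> a = 0"

lemma finite_splits_iff [simp]: "finite (splits (w :: 'm::finite_splits))"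
  unfolding splits_def by (rule finite_splits)

instance nat :: finite_splits
proof
  fix w :: nat
  have "{p. fst p + snd p = w} \<subseteq> {..w} \<times> {..w}"
    by auto
  then show "finite {p. fst p + snd p = w}"
    by (rule finite_subset) simp
qed simp

lemma finite_submultisets: "finite {n. n \<subseteq># w}"
proof (induction w)
  case empty
  then show ?case by simp
next
  case (add x w)
  have "n \<in> {n. n \<subseteq># w} \<union> add_mset x ` {n. n \<subseteq># w}" if "n \<subseteq># add_mset x w" for n
  proof -
    have "n - {#x#} \<subseteq># w"
      using that by (simp add: subset_eq_diff_conv)
    moreover have "n = n - {#x#} \<or> n = add_mset x (n - {#x#})"
      by (cases "x \<in># n") (auto simp: diff_single_trivial)
    ultimately show ?thesis
      by auto
  qed
  then have "{n. n \<subseteq># add_mset x w} \<subseteq> {n. n \<subseteq># w} \<union> add_mset x ` {n. n \<subseteq># w}"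
    by blast
  then show ?case
    by (rule finite_subset) (simp add: add)
qed

instance multiset :: (type) finite_splits
proof
  fix w :: "'a multiset"
  have "{p. fst p + snd p = w} \<subseteq> {n. n \<subseteq># w} \<times> {n. n \<subseteq># w}"
    by auto
  then show "finite {p. fst p + snd p = w}"
    by (rule finite_subset) (simp add: finite_submultisets)
qed simp

instance prod :: (finite_splits, finite_splits) finite_splits
proof
  fix w :: "'a \<times> 'b"
  have "{p. fst p + snd p = w}
      \<subseteq> (\<lambda>((a, b), (c, d)). ((a, c), (b, d))) ` (splits (fst w) \<times> splits (snd w))"
    by (force simp: splits_def image_iff)
  then show "finite {p. fst p + snd p = w}"
    by (rule finite_subset) simp
qed (auto simp: prod_eq_iff dest: zero_sum_free)

lemma mem_splits [simp]: "p \<in> splits w \<longleftrightarrow> fst p + snd p = w"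
  by (simp add: splits_def)

lemma splits_zero [simp]: "splits (0 :: 'm::finite_splits) = {(0, 0)}"
proof -
  have "p = (0, 0)" if "p \<in> splits 0" for p :: "'m \<times> 'm"
    using that zero_sum_free[of "fst p" "snd p"] zero_sum_free[of "snd p" "fst p"]
    by (simp add: prod_eq_iff add.commute)
  then have "splits (0 :: 'm) \<subseteq> {(0, 0)}"
    by blast
  then show ?thesis
    by (auto simp del: mem_splits simp add: splits_def)
qed

text \<open>Adding \<open>b\<close> to the second component embeds the splittings of
  \<open>a\<close> into those of \<open>w\<close>. The splitting \<open>(w, 0)\<close> is missed,
  since \<open>b\<close> is nonzero and nothing cancels it.\<close>

lemma card_splits_less:
  fixes a b w :: "'m::finite_splits"
  assumes "a + b = w" "b \<noteq> 0"
  shows "card (splits a) < card (splits w)"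
proof -
  let ?h = "\<lambda>(c, d). (c, d + b)"
  have "inj_on ?h (splits a)"
    by (auto simp: inj_on_def)
  then have "card (splits a) = card (?h ` splits a)"
    by (simp add: card_image)
  also have "(w, 0) \<notin> ?h ` splits a"
    using assms zero_sum_free[of b] by (auto simp: add.commute)
  then have "?h ` splits a \<subset> splits w"
    using assms by (auto simp: add.assoc)
  then have "card (?h ` splits a) < card (splits w)"
    by (simp add: psubset_card_mono)
  finally show ?thesis .
qed

section \<open>Reindexing finite sums over splittings\<close>

context abelian_monoid
begin

lemma finsum_Sigma:
  assumes "finite A" and "\<And>x. x \<in> A \<Longrightarrow> finite (B x)"
    and "\<And>x y. x \<in> A \<Longrightarrow> y \<in> B x \<Longrightarrow> f x y \<in> carrier G"
  shows "(\<Oplus>x\<in>A. \<Oplus>y\<in>B x. f x y) = (\<Oplus>p\<in>Sigma A B. f (fst p) (snd p))"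
  using assms
proof (induction A rule: finite_induct)
  case empty
  then show ?case by simp
next
  case (insert a A)
  have eq: "Sigma (insert a A) B = Pair a ` B a \<union> Sigma A B"
    by auto
  have "(\<Oplus>p\<in>Sigma (insert a A) B. f (fst p) (snd p))
      = (\<Oplus>p\<in>Pair a ` B a. f (fst p) (snd p)) \<oplus> (\<Oplus>p\<in>Sigma A B. f (fst p) (snd p))"
    unfolding eq using insert by (intro finsum_Un_disjoint) auto
  also have "(\<Oplus>p\<in>Pair a ` B a. f (fst p) (snd p)) = (\<Oplus>y\<in>B a. f a y)"
    by (subst finsum_reindex) (use insert in \<open>auto simp: inj_on_def\<close>)
  finally show ?case
    using insert by (simp add: Pi_def)
qed

lemma finsum_swap:
  assumes "finite A" "finite B" "\<And>x y. x \<in> A \<Longrightarrow> y \<in> B \<Longrightarrow> f x y \<in> carrier G"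
  shows "(\<Oplus>x\<in>A. \<Oplus>y\<in>B. f x y) = (\<Oplus>y\<in>B. \<Oplus>x\<in>A. f x y)"
proof -
  have eq: "A \<times> B = prod.swap ` (B \<times> A)"
    by auto
  have "(\<Oplus>x\<in>A. \<Oplus>y\<in>B. f x y) = (\<Oplus>p\<in>A \<times> B. f (fst p) (snd p))"
    using assms by (subst finsum_Sigma) auto
  also have "\<dots> = (\<Oplus>p\<in>B \<times> A. f (snd p) (fst p))"
    unfolding eq by (subst finsum_reindex) (use assms in auto)
  also have "\<dots> = (\<Oplus>y\<in>B. \<Oplus>x\<in>A. f x y)"
    using assms by (subst finsum_Sigma) auto
  finally show ?thesis .
qed

lemma finsum_single:
  assumes "finite A" "s \<in> A" "f \<in> A \<rightarrow> carrier G" "\<And>x. x \<in> A \<Longrightarrow> x \<noteq> s \<Longrightarrow> f x = \<zero>"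
  shows "finsum G f A = f s"
proof -
  have "finsum G f A = finsum G f {s}"
    using assms by (intro add.finprod_mono_neutral_cong_right) auto
  also have "\<dots> = f s"
    using assms by (subst finsum_insert[where F="{}", simplified]) (auto simp: Pi_def)
  finally show ?thesis .
qed

lemma finsum_splits_swap:
  fixes w :: "'m::finite_splits"
  assumes "\<And>a b. a + b = w \<Longrightarrow> f a b \<in> carrier G"
  shows "(\<Oplus>p\<in>splits w. f (fst p) (snd p)) = (\<Oplus>p\<in>splits w. f (snd p) (fst p))"
proof -
  have "p \<in> prod.swap ` splits w" if "p \<in> splits w" for p
    using that by (intro image_eqI[where x="prod.swap p"]) (auto simp: add.commute)
  then have "splits w \<subseteq> prod.swap ` splits w"
    by blast
  then have eq: "splits w = prod.swap ` splits w"
    by (intro equalityI) (auto simp: add.commute)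
  show ?thesis
    by (subst eq, subst finsum_reindex) (use assms in \<open>auto simp: add.commute\<close>)
qed

text \<open>Both sides run over the triples with sum \<open>w\<close>, grouped from the left or from
  the right. This is what makes multiplication of polynomials associative.\<close>

lemma finsum_splits_assoc:
  fixes w :: "'m::finite_splits"
  assumes "\<And>a b c. a + b + c = w \<Longrightarrow> f a b c \<in> carrier G"
  shows "(\<Oplus>p\<in>splits w. \<Oplus>q\<in>splits (fst p). f (fst q) (snd q) (snd p))
       = (\<Oplus>p\<in>splits w. \<Oplus>q\<in>splits (snd p). f (fst p) (fst q) (snd q))"
proof -
  have "((a, b), (c, d)) \<in> (\<lambda>(p, q). ((fst q, snd q + snd p), (snd q, snd p))) `
      Sigma (splits w) (\<lambda>p. splits (fst p))" if "a + b = w" "c + d = b" for a b c d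
    using that by (intro image_eqI[where x="((a + c, d), (a, c))"]) (auto simp: add.assoc)
  then have eq: "Sigma (splits w) (\<lambda>p. splits (snd p))
      = (\<lambda>(p, q). ((fst q, snd q + snd p), (snd q, snd p))) ` Sigma (splits w) (\<lambda>p. splits (fst p))"
    by (auto simp: add.assoc)
  have "(\<Oplus>p\<in>splits w. \<Oplus>q\<in>splits (snd p). f (fst p) (fst q) (snd q))
      = (\<Oplus>p\<in>Sigma (splits w) (\<lambda>p. splits (snd p)). f (fst (fst p)) (fst (snd p)) (snd (snd p)))"
    by (subst finsum_Sigma) (use assms in \<open>auto simp: add.assoc\<close>)
  also have "\<dots> = (\<Oplus>p\<in>Sigma (splits w) (\<lambda>p. splits (fst p)). f (fst (snd p)) (snd (snd p)) (snd (fst p)))"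
    unfolding eq
    by (subst finsum_reindex)
      (use assms in \<open>auto simp: inj_on_def case_prod_unfold intro!: finsum_cong\<close>)
  also have "\<dots> = (\<Oplus>p\<in>splits w. \<Oplus>q\<in>splits (fst p). f (fst q) (snd q) (snd p))"
    by (subst finsum_Sigma) (use assms in auto)
  finally show ?thesis by simp
qed

text \<open>Both sides run over the 2x2 arrays with total \<open>w\<close>, once grouped by rows and
  once by columns.\<close>

lemma finsum_splits_interchange:
  fixes w :: "'m::finite_splits"
  assumes "\<And>a b c d. a + b + (c + d) = w \<Longrightarrow> f a b c d \<in> carrier G"
  shows "(\<Oplus>p\<in>splits w. \<Oplus>q\<in>splits (fst p). \<Oplus>r\<in>splits (snd p). f (fst q) (snd q) (fst r) (snd r))
       = (\<Oplus>p\<in>splits w. \<Oplus>q\<in>splits (fst p). \<Oplus>r\<in>splits (snd p). f (fst q) (fst r) (snd q) (snd r))"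
proof -
  define Q where "Q = Sigma (splits w) (\<lambda>p. splits (fst p) \<times> splits (snd p))"
  have fin: "finite Q"
    by (simp add: Q_def)
  have *: "(\<Oplus>p\<in>splits w. \<Oplus>q\<in>splits (fst p). \<Oplus>r\<in>splits (snd p). g (fst q) (snd q) (fst r) (snd r))
      = (\<Oplus>p\<in>Q. g (fst (fst (snd p))) (snd (fst (snd p))) (fst (snd (snd p))) (snd (snd (snd p))))"
    if g: "\<And>a b c d. a + b + (c + d) = w \<Longrightarrow> g a b c d \<in> carrier G" for g
  proof -
    have "(\<Oplus>p\<in>splits w. \<Oplus>q\<in>splits (fst p). \<Oplus>r\<in>splits (snd p). g (fst q) (snd q) (fst r) (snd r))
      = (\<Oplus>p\<in>splits w. \<Oplus>q\<in>splits (fst p) \<times> splits (snd p).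
            g (fst (fst q)) (snd (fst q)) (fst (snd q)) (snd (snd q)))"
      by (intro finsum_cong' finsum_Sigma) (use g in \<open>auto intro!: finsum_closed\<close>)
    also have "\<dots> = (\<Oplus>p\<in>Q. g (fst (fst (snd p))) (snd (fst (snd p))) (fst (snd (snd p))) (snd (snd (snd p))))"
      unfolding Q_def by (subst finsum_Sigma) (use g in \<open>auto\<close>)
    finally show ?thesis .
  qed
  \<comment> \<open>Transposition of the array. The leading component records the two row sums and
    has to be recomputed; with that, \<open>h\<close> is its own inverse on
    \<open>Q\<close>.\<close>
  define h :: "('m \<times> 'm) \<times> ('m \<times> 'm) \<times> ('m \<times> 'm) \<Rightarrow> ('m \<times> 'm) \<times> ('m \<times> 'm) \<times> ('m \<times> 'm)"
    where "h = (\<lambda>(_, (a, b), (c, d)). ((a + c, b + d), (a, c), (b, d)))"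
  have hh: "h (h x) = x" if "x \<in> Q" for x
    using that by (auto simp: h_def Q_def)
  have hQ: "h x \<in> Q" if "x \<in> Q" for x
    using that by (auto simp: h_def Q_def ac_simps)
  have "x \<in> h ` Q" if "x \<in> Q" for x
    using hh[OF that] hQ[OF that] by (metis image_eqI)
  with hQ have eq: "Q = h ` Q"
    by blast
  have inj: "inj_on h Q"
    by (metis hh inj_onI)
  have "(\<Oplus>p\<in>Q. f (fst (fst (snd p))) (snd (fst (snd p))) (fst (snd (snd p))) (snd (snd (snd p))))
     = (\<Oplus>p\<in>h ` Q. f (fst (fst (snd p))) (snd (fst (snd p))) (fst (snd (snd p))) (snd (snd (snd p))))"
    by (rule arg_cong[OF eq])
  also have "\<dots> = (\<Oplus>x\<in>Q. f (fst (fst (snd (h x)))) (snd (fst (snd (h x))))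
      (fst (snd (snd (h x)))) (snd (snd (snd (h x)))))"
    by (rule finsum_reindex[OF _ inj], unfold eq[symmetric]) (use assms in \<open>auto simp: Q_def\<close>)
  also have "\<dots> = (\<Oplus>p\<in>Q. f (fst (fst (snd p))) (fst (snd (snd p))) (snd (fst (snd p))) (snd (snd (snd p))))"
  proof (rule finsum_cong')
    show "(\<lambda>p. f (fst (fst (snd p))) (fst (snd (snd p))) (snd (fst (snd p))) (snd (snd (snd p)))) \<in> Q \<rightarrow> carrier G"
      using assms by (auto simp: Q_def add.assoc add.left_commute)
  qed (auto simp: h_def Q_def)
  finally have mid: "(\<Oplus>p\<in>Q. f (fst (fst (snd p))) (snd (fst (snd p))) (fst (snd (snd p))) (snd (snd (snd p))))
    = (\<Oplus>p\<in>Q. f (fst (fst (snd p))) (fst (snd (snd p))) (snd (fst (snd p))) (snd (snd (snd p))))" .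
  have "f a c b d \<in> carrier G" if "a + b + (c + d) = w" for a b c d
    using assms[of a c b d] that by (simp add: add.assoc add.left_commute)
  then show ?thesis
    using mid *[of f] *[of "\<lambda>a b c d. f a c b d"] assms by simp
qed

lemma finsum_splits_left:
  fixes w :: "'m::finite_splits"
  assumes "\<And>a b. a + b = w \<Longrightarrow> f a b \<in> carrier G"
    and "\<And>a b. a + b = w \<Longrightarrow> a \<noteq> 0 \<Longrightarrow> f a b = \<zero>"
  shows "(\<Oplus>p\<in>splits w. f (fst p) (snd p)) = f 0 w"
proof -
  have "f (fst p) (snd p) = \<zero>" if "p \<in> splits w" "p \<noteq> (0, w)" for p
    using that assms(2)[of "fst p" "snd p"] by (cases p) auto
  then show ?thesis
    by (subst finsum_single[where s="(0, w)"]) (use assms(1) in auto)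
qed

end

text \<open>Both sums are separated into the summand at \<open>s\<close> and a common remainder,
  which cancels. This is how a Leibniz rule for a composite yields one for a factor.\<close>

lemma (in abelian_group) finsum_cancel:
  assumes "finite A" "s \<in> A" "f \<in> A \<rightarrow> carrier G" "g \<in> A \<rightarrow> carrier G"
    and "\<And>x. x \<in> A \<Longrightarrow> x \<noteq> s \<Longrightarrow> f x = g x" and "finsum G f A = finsum G g A"
  shows "f s = g s"
proof -
  have *: "finsum G h A = h s \<oplus> finsum G h (A - {s})" if "h \<in> A \<rightarrow> carrier G" for h
    using assms that finsum_insert[of "A - {s}" s h] by (auto simp: insert_absorb)
  have "finsum G f (A - {s}) = finsum G g (A - {s})"
    using assms by (intro finsum_cong') auto
  moreover have "finsum G g (A - {s}) \<in> carrier G" "f s \<in> carrier G" "g s \<in> carrier G"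
    using assms by (auto intro: finsum_closed)
  ultimately show ?thesis
    using assms(6) *[OF assms(3)] *[OF assms(4)] by simp
qed

section \<open>Hasse--Schmidt derivations indexed by a monoid\<close>

locale calg =
  fixes k :: "('k, 'x) ring_scheme" and A :: "('k, 'a, 'y) module_scheme" (structure)
  assumes algebra: "algebra k A"

sublocale calg \<subseteq> K: cring k
  using algebra by (rule algebra.R_cring)

sublocale calg \<subseteq> A: cring A
  using algebra by (rule algebra.M_cring)

sublocale calg \<subseteq> A: module k A
  using algebra by (rule algebra.module)

context calg
begin

lemma smult_mult_left:
  "\<lbrakk>c \<in> carrier k; x \<in> carrier A; y \<in> carrier A\<rbrakk> \<Longrightarrow> (c \<odot> x) \<otimes> y = c \<odot> (x \<otimes> y)"
  using algebra by (rule algebra.smult_assoc2)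

lemma smult_mult_right:
  assumes "c \<in> carrier k" "x \<in> carrier A" "y \<in> carrier A"
  shows "x \<otimes> (c \<odot> y) = c \<odot> (x \<otimes> y)"
  using smult_mult_left[OF assms(1,3,2)] assms by (simp add: A.m_comm)

lemma linear_endo_closed: "linear_endo k A f \<Longrightarrow> x \<in> carrier A \<Longrightarrow> f x \<in> carrier A"
  by (auto simp: linear_endo_def)

lemma linear_endo_add:
  "\<lbrakk>linear_endo k A f; x \<in> carrier A; y \<in> carrier A\<rbrakk> \<Longrightarrow> f (x \<oplus> y) = f x \<oplus> f y"
  by (auto simp: linear_endo_def)

lemma linear_endo_smult:
  "\<lbrakk>linear_endo k A f; c \<in> carrier k; x \<in> carrier A\<rbrakk> \<Longrightarrow> f (c \<odot> x) = c \<odot> f x"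
  by (auto simp: linear_endo_def)

lemma linear_endo_zero: "linear_endo k A f \<Longrightarrow> f \<zero> = \<zero>"
  using linear_endo_smult[of f "\<zero>\<^bsub>k\<^esub>" \<zero>] linear_endo_closed[of f \<zero>] by simp

lemma linear_endo_minus:
  assumes "linear_endo k A f" "x \<in> carrier A"
  shows "f (\<ominus> x) = \<ominus> f x"
proof -
  have "f (\<ominus> x) \<oplus> f x = \<zero>"
    using assms linear_endo_add[of f "\<ominus> x" x] by (simp add: A.l_neg linear_endo_zero)
  then show ?thesis
    using assms by (simp add: A.minus_equality linear_endo_closed)
qed

lemma linear_endo_finsum:
  assumes "linear_endo k A f" "g \<in> B \<rightarrow> carrier A"
  shows "f (\<Oplus>i\<in>B. g i) = (\<Oplus>i\<in>B. f (g i))"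
  using assms(2)
proof (induction B rule: infinite_finite_induct)
  case (insert b B)
  then have "f (\<Oplus>i\<in>insert b B. g i) = f (g b) \<oplus> f (\<Oplus>i\<in>B. g i)"
    using assms(1) by (simp add: linear_endo_add A.finsum_closed Pi_def)
  then show ?case
    using insert linear_endo_closed[OF assms(1)] by (simp add: Pi_def)
qed (use assms(1) in \<open>simp_all add: linear_endo_zero\<close>)

lemma linear_endo_id: "linear_endo k A (\<lambda>x. x)"
  by (simp add: linear_endo_def)

lemma linear_endo_zero_map: "linear_endo k A (\<lambda>x. \<zero>)"
  by (simp add: linear_endo_def)

lemma linear_endo_comp: "linear_endo k A f \<Longrightarrow> linear_endo k A g \<Longrightarrow> linear_endo k A (\<lambda>x. f (g x))"
  by (auto simp: linear_endo_def Pi_def)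

lemma linear_endo_add_map:
  assumes "linear_endo k A f" "linear_endo k A g"
  shows "linear_endo k A (\<lambda>x. f x \<oplus> g x)"
  using assms by (auto simp: linear_endo_def A.smult_r_distr A.a_ac Pi_def)

lemma linear_endo_minus_map:
  assumes "linear_endo k A f"
  shows "linear_endo k A (\<lambda>x. \<ominus> f x)"
  using assms by (auto simp: linear_endo_def A.smult_r_minus A.minus_add Pi_def)

lemma linear_endo_mult_map:
  assumes "linear_endo k A f" "a \<in> carrier A"
  shows "linear_endo k A (\<lambda>x. a \<otimes> f x)"
  using assms by (auto simp: linear_endo_def A.r_distr smult_mult_right Pi_def)

lemma linear_endo_finsum_map:
  assumes "\<And>i. i \<in> B \<Longrightarrow> linear_endo k A (f i)"
  shows "linear_endo k A (\<lambda>x. \<Oplus>i\<in>B. f i x)"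
  using assms
proof (induction B rule: infinite_finite_induct)
  case (insert b B)
  then have "linear_endo k A (\<lambda>x. f b x \<oplus> (\<Oplus>i\<in>B. f i x))"
    by (intro linear_endo_add_map) auto
  then show ?case
    using insert by (simp add: linear_endo_def Pi_def)
qed (simp_all add: linear_endo_zero_map)

lemma linear_endo_cong:
  assumes "\<And>x. x \<in> carrier A \<Longrightarrow> f x = g x"
  shows "linear_endo k A f \<longleftrightarrow> linear_endo k A g"
  using assms by (auto simp: linear_endo_def Pi_def)

text \<open>Stated at a single index, so that truncated derivations and inductions over the index
  can be expressed.\<close>

definition leibniz :: "('m::finite_splits \<Rightarrow> 'a \<Rightarrow> 'a) \<Rightarrow> 'm \<Rightarrow> bool" where
  "leibniz D w \<longleftrightarrow> (\<forall>x\<in>carrier A. \<forall>y\<in>carrier A.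
     D w (x \<otimes> y) = (\<Oplus>p\<in>splits w. D (fst p) x \<otimes> D (snd p) y))"

text \<open>Composition of Hasse-Schmidt derivations: if \<open>F\<close> and \<open>G\<close> are
  read as formal series of operators, this is the coefficient at \<open>w\<close> of their
  product.\<close>

definition convolve :: "('m::finite_splits \<Rightarrow> 'a \<Rightarrow> 'a) \<Rightarrow> ('m \<Rightarrow> 'a \<Rightarrow> 'a) \<Rightarrow> 'm \<Rightarrow> 'a \<Rightarrow> 'a" where
  "convolve F G w x = (\<Oplus>p\<in>splits w. F (fst p) (G (snd p) x))"

lemma linear_endo_convolve:
  assumes "\<And>w. linear_endo k A (F w)" "\<And>w. linear_endo k A (G w)"
  shows "linear_endo k A (convolve F G w)"
  unfolding convolve_def[abs_def]
  by (rule linear_endo_finsum_map, rule linear_endo_comp[OF assms])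

context
  fixes F G :: "'m::finite_splits \<Rightarrow> 'a \<Rightarrow> 'a"
  assumes F: "\<And>w. linear_endo k A (F w)" and G: "\<And>w. linear_endo k A (G w)"
begin

lemma FG_closed [simp]: "x \<in> carrier A \<Longrightarrow> F w x \<in> carrier A" "x \<in> carrier A \<Longrightarrow> G w x \<in> carrier A"
  by (rule linear_endo_closed[OF F], assumption) (rule linear_endo_closed[OF G])

text \<open>For \<open>p = (a, b)\<close>, the expansion that \<open>F a (G b (x y))\<close> has as
  soon as \<open>F\<close> satisfies the Leibniz rule at \<open>a\<close> and \<open>G\<close> at
  \<open>b\<close>.\<close>

definition pair_term :: "'a \<Rightarrow> 'a \<Rightarrow> 'm \<times> 'm \<Rightarrow> 'a" where
  "pair_term x y p = (\<Oplus>q\<in>splits (fst p). \<Oplus>r\<in>splits (snd p).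
      F (fst q) (G (fst r) x) \<otimes> F (snd q) (G (snd r) y))"

lemma pair_term_closed [simp]:
  "x \<in> carrier A \<Longrightarrow> y \<in> carrier A \<Longrightarrow> pair_term x y p \<in> carrier A"
  unfolding pair_term_def by (auto intro!: A.finsum_closed)

lemma convolve_closed [simp]: "x \<in> carrier A \<Longrightarrow> convolve F G w x \<in> carrier A"
  using linear_endo_closed[OF linear_endo_convolve[OF F G]] .

text \<open>The left side groups the four indices by the argument they act on, the right side by the
  operator they belong to. Transposing the 2x2 array of indices passes from one to the other, with
  no Leibniz rule involved.\<close>

lemma convolve_products:
  assumes x: "x \<in> carrier A" and y: "y \<in> carrier A"
  shows "(\<Oplus>p\<in>splits w. convolve F G (fst p) x \<otimes> convolve F G (snd p) y)
       = (\<Oplus>p\<in>splits w. pair_term x y p)"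
proof -
  have "convolve F G (fst p) x \<otimes> convolve F G (snd p) y
      = (\<Oplus>q\<in>splits (fst p). \<Oplus>r\<in>splits (snd p).
          F (fst q) (G (snd q) x) \<otimes> F (fst r) (G (snd r) y))" for p
  proof -
    have "convolve F G (fst p) x \<otimes> convolve F G (snd p) y
       = (\<Oplus>q\<in>splits (fst p). F (fst q) (G (snd q) x) \<otimes> convolve F G (snd p) y)"
      using assms
      by (subst convolve_def, subst A.finsum_ldistr) (auto simp: convolve_def intro!: A.finsum_closed)
    also have "\<dots> = (\<Oplus>q\<in>splits (fst p). \<Oplus>r\<in>splits (snd p).
          F (fst q) (G (snd q) x) \<otimes> F (fst r) (G (snd r) y))"
      using assms unfolding convolve_def
      by (intro A.finsum_cong' refl A.finsum_rdistr) (auto intro!: A.finsum_closed)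
    finally show ?thesis .
  qed
  then show ?thesis
    unfolding pair_term_def
    using A.finsum_splits_interchange[of w "\<lambda>a b c d. F a (G b x) \<otimes> F c (G d y)"] assms
    by simp
qed

text \<open>The rule for \<open>G\<close> is applied inside, then the rule for \<open>F\<close> to
  each summand; exchanging the two sums gives \<open>pair_term\<close>.\<close>

lemma comp_product:
  assumes x: "x \<in> carrier A" and y: "y \<in> carrier A"
    and "leibniz F (fst p)" "leibniz G (snd p)"
  shows "F (fst p) (G (snd p) (x \<otimes> y)) = pair_term x y p"
proof -
  have "F (fst p) (G (snd p) (x \<otimes> y)) = F (fst p) (\<Oplus>r\<in>splits (snd p). G (fst r) x \<otimes> G (snd r) y)"
    using assms(1,2,4) by (simp add: leibniz_def)
  also have "\<dots> = (\<Oplus>r\<in>splits (snd p). F (fst p) (G (fst r) x \<otimes> G (snd r) y))"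
    using assms(1,2) by (intro linear_endo_finsum[OF F]) auto
  also have "\<dots> = (\<Oplus>r\<in>splits (snd p). \<Oplus>q\<in>splits (fst p).
      F (fst q) (G (fst r) x) \<otimes> F (snd q) (G (snd r) y))"
    using assms(1,2,3) by (intro A.finsum_cong' refl) (auto simp: leibniz_def intro!: A.finsum_closed)
  also have "\<dots> = pair_term x y p"
    unfolding pair_term_def using assms(1,2) by (intro A.finsum_swap) auto
  finally show ?thesis .
qed

lemma leibniz_convolve:
  assumes "\<And>a b. a + b = w \<Longrightarrow> leibniz F a" "\<And>a b. a + b = w \<Longrightarrow> leibniz G b"
  shows "leibniz (convolve F G) w"
  unfolding leibniz_def
proof (intro ballI)
  fix x y assume xy: "x \<in> carrier A" "y \<in> carrier A"
  have "convolve F G w (x \<otimes> y) = (\<Oplus>p\<in>splits w. pair_term x y p)"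
    unfolding convolve_def using xy assms
    by (intro A.finsum_cong' refl comp_product) (auto simp: pair_term_closed)
  then show "convolve F G w (x \<otimes> y) = (\<Oplus>p\<in>splits w. convolve F G (fst p) x \<otimes> convolve F G (snd p) y)"
    using convolve_products[OF xy] by simp
qed

text \<open>
  The Leibniz rule for \<open>F \<circ> G\<close> equates two sums over the splittings of \<open>w\<close>; if they agree termwise
  at all splittings but one, then they also agree there.
\<close>

lemma convolve_cancel:
  assumes "leibniz (convolve F G) w" "p \<in> splits w" "x \<in> carrier A" "y \<in> carrier A"
    and "\<And>q. q \<in> splits w \<Longrightarrow> q \<noteq> p \<Longrightarrow> leibniz F (fst q) \<and> leibniz G (snd q)"
  shows "F (fst p) (G (snd p) (x \<otimes> y)) = pair_term x y p"
proof (rule A.finsum_cancel[where A="splits w" and f="\<lambda>p. F (fst p) (G (snd p) (x \<otimes> y))"])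
  have "convolve F G w (x \<otimes> y) = (\<Oplus>p\<in>splits w. convolve F G (fst p) x \<otimes> convolve F G (snd p) y)"
    using assms(1,3,4) by (simp add: leibniz_def)
  then show "(\<Oplus>p\<in>splits w. F (fst p) (G (snd p) (x \<otimes> y))) = finsum A (pair_term x y) (splits w)"
    using convolve_products[OF assms(3,4)] by (simp add: convolve_def)
qed (use assms in \<open>auto intro!: comp_product\<close>)

text \<open>At the splitting \<open>(w, 0)\<close> the inner operator is the identity, so
  \<open>convolve_cancel\<close> leaves exactly the Leibniz rule of \<open>F\<close> at
  \<open>w\<close>. Every other splitting has a nonzero second part and needs \<open>F\<close> only
  at proper summands of \<open>w\<close>.\<close>

lemma leibniz_left_factor:
  assumes G0: "\<And>x. x \<in> carrier A \<Longrightarrow> G 0 x = x" and "leibniz (convolve F G) w"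
    and "\<And>a b. a + b = w \<Longrightarrow> b \<noteq> 0 \<Longrightarrow> leibniz F a" "\<And>a b. a + b = w \<Longrightarrow> leibniz G b"
  shows "leibniz F w"
  unfolding leibniz_def
proof (intro ballI)
  fix x y assume xy: "x \<in> carrier A" "y \<in> carrier A"
  have ne: "snd q \<noteq> 0" if "q \<in> splits w" "q \<noteq> (w, 0)" for q
    using that by (cases q) auto
  have "F w (G 0 (x \<otimes> y)) = pair_term x y (w, 0)"
    using convolve_cancel[OF assms(2), of "(w, 0)" x y] xy assms(3,4) ne by auto
  also have "\<dots> = (\<Oplus>q\<in>splits w. F (fst q) x \<otimes> F (snd q) y)"
    unfolding pair_term_def using xy G0 by (auto intro!: A.finsum_cong')
  finally show "F w (x \<otimes> y) = (\<Oplus>q\<in>splits w. F (fst q) x \<otimes> F (snd q) y)"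
    using xy G0 by simp
qed

text \<open>The mirror image, at the splitting \<open>(0, w)\<close> with \<open>F 0\<close> the
  identity.\<close>

lemma leibniz_right_factor:
  assumes F0: "\<And>x. x \<in> carrier A \<Longrightarrow> F 0 x = x" and "leibniz (convolve F G) w"
    and "\<And>a b. a + b = w \<Longrightarrow> leibniz F a" "\<And>a b. a + b = w \<Longrightarrow> a \<noteq> 0 \<Longrightarrow> leibniz G b"
  shows "leibniz G w"
  unfolding leibniz_def
proof (intro ballI)
  fix x y assume xy: "x \<in> carrier A" "y \<in> carrier A"
  have ne: "fst q \<noteq> 0" if "q \<in> splits w" "q \<noteq> (0, w)" for q
    using that by (cases q) auto
  have "F 0 (G w (x \<otimes> y)) = pair_term x y (0, w)"
    using convolve_cancel[OF assms(2), of "(0, w)" x y] xy assms(3,4) ne by auto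
  also have "\<dots> = (\<Oplus>q\<in>splits w. G (fst q) x \<otimes> G (snd q) y)"
    unfolding pair_term_def using xy F0 by (auto intro!: A.finsum_cong' A.finsum_closed)
  finally show "G w (x \<otimes> y) = (\<Oplus>q\<in>splits w. G (fst q) x \<otimes> G (snd q) y)"
    using xy F0 by simp
qed

end

text \<open>If both parts of a splitting were 0 or in the semigroup \<open>S\<close>, then so would
  be their sum \<open>w\<close>. Hence each product on the right contains a vanishing factor, and
  the left side vanishes as well.\<close>

lemma leibniz_off_support:
  assumes "\<And>a. a \<noteq> 0 \<Longrightarrow> a \<notin> S \<Longrightarrow> \<forall>x\<in>carrier A. D a x = \<zero>"
    and "\<And>a. linear_endo k A (D a)"
    and "\<And>a b. a \<in> S \<Longrightarrow> b \<in> S \<Longrightarrow> a + b \<in> S" and w: "w \<noteq> 0" "w \<notin> S"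
  shows "leibniz D w"
  unfolding leibniz_def
proof (intro ballI)
  fix x y assume xy: "x \<in> carrier A" "y \<in> carrier A"
  have "D (fst p) x \<otimes> D (snd p) y = \<zero>" if "p \<in> splits w" for p
  proof -
    have "(fst p \<noteq> 0 \<and> fst p \<notin> S) \<or> (snd p \<noteq> 0 \<and> snd p \<notin> S)"
      using that w assms(3)[of "fst p" "snd p"] by (cases "fst p = 0"; cases "snd p = 0") auto
    then show ?thesis
      using assms(1) linear_endo_closed[OF assms(2)] xy by fastforce
  qed
  then show "D w (x \<otimes> y) = (\<Oplus>p\<in>splits w. D (fst p) x \<otimes> D (snd p) y)"
    using A.add.finprod_one_eqI[of "splits w" "\<lambda>p. D (fst p) x \<otimes> D (snd p) y"] w assms(1) xy by simp
qed

end

section \<open>Factorization along complementary subsemigroups\<close>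

text \<open>
  If \<open>E = F \<circ> G\<close> with \<open>F\<close> and \<open>G\<close> supported on disjoint sets \<open>S\<close> and \<open>T\<close> (and the identity
  at 0), then the terms of \<open>E w\<close> other than \<open>F w + G w\<close> involve strictly smaller indices only, so
  \<open>F w + G w\<close> is given by the following recursion; it is \<open>F w\<close> for \<open>w \<in> S\<close> and \<open>G w\<close> for \<open>w \<in> T\<close>.
\<close>

function factor_seq :: "('k, 'a, 'y) module_scheme \<Rightarrow> ('m::finite_splits \<Rightarrow> 'a \<Rightarrow> 'a)
    \<Rightarrow> 'm set \<Rightarrow> 'm set \<Rightarrow> 'm \<Rightarrow> 'a \<Rightarrow> 'a" where
  "factor_seq A E S T w = (\<lambda>x. E w x \<ominus>\<^bsub>A\<^esub> (\<Oplus>\<^bsub>A\<^esub>p\<in>splits w.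
     if fst p + snd p = w \<and> fst p \<in> S - {0} \<and> snd p \<in> T - {0}
     then factor_seq A E S T (fst p) (factor_seq A E S T (snd p) x) else \<zero>\<^bsub>A\<^esub>))"
  by pat_completeness auto
termination
\<comment> \<open>The guard in the recursive equation repeats that \<open>p\<close> splits
  \<open>w\<close> into two nonzero parts. This puts the facts required by
  \<open>card_splits_less\<close> into the context of the recursive calls.\<close>
proof (relation "Wellfounded.measure (\<lambda>(A, E, S, T, w). card (splits w))", goal_cases)
  case 1
  then show ?case by simp
next
  case (2 A E S T w x p)
  then show ?case
    using card_splits_less[of "fst p" "snd p" w] card_splits_less[of "snd p" "fst p" w]
    by (auto simp: add.commute)
next
  case (3 A E S T w x p)
  then show ?case
    using card_splits_less[of "fst p" "snd p" w] card_splits_less[of "snd p" "fst p" w]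
    by (auto simp: add.commute)
qed

declare factor_seq.simps [simp del]

text \<open>\<Delta> is the range of indices where \<open>E\<close> obeys the Leibniz rule, closed
  under summands so that induction stays inside it. \<open>S_add\<close> and \<open>T_add\<close>
  make the Leibniz rule of each factor trivial off its own support, and \<open>ST_add\<close>
  ensures that cross terms never land where \<open>E\<close> has to vanish.\<close>

locale hs_factorization = calg k A
  for k :: "('k, 'x) ring_scheme" and A :: "('k, 'a, 'y) module_scheme" (structure) +
  fixes E :: "'m::finite_splits \<Rightarrow> 'a \<Rightarrow> 'a" and S T \<Delta> :: "'m set"
  assumes E: "\<And>w. linear_endo k A (E w)"
    and E0: "\<And>x. x \<in> carrier A \<Longrightarrow> E 0 x = x"
    and E_supp: "\<And>w x. w \<noteq> 0 \<Longrightarrow> w \<notin> S \<union> T \<Longrightarrow> x \<in> carrier A \<Longrightarrow> E w x = \<zero>"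
    and E_leibniz: "\<And>w. w \<in> \<Delta> \<Longrightarrow> leibniz E w"
    and \<Delta>: "\<And>a b. a + b \<in> \<Delta> \<Longrightarrow> a \<in> \<Delta>"
    and zero: "0 \<notin> S" "0 \<notin> T" and disj: "S \<inter> T = {}"
    and S_add: "\<And>a b. a \<in> S \<Longrightarrow> b \<in> S \<Longrightarrow> a + b \<in> S"
    and T_add: "\<And>a b. a \<in> T \<Longrightarrow> b \<in> T \<Longrightarrow> a + b \<in> T"
    and ST_add: "\<And>a b. a \<in> S \<Longrightarrow> b \<in> T \<Longrightarrow> a + b \<in> S \<union> T"
begin

definition left_factor :: "'m \<Rightarrow> 'a \<Rightarrow> 'a" where
  "left_factor w = (if w = 0 then (\<lambda>x. x) else if w \<in> S then factor_seq A E S T w else (\<lambda>x. \<zero>))"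

definition right_factor :: "'m \<Rightarrow> 'a \<Rightarrow> 'a" where
  "right_factor w = (if w = 0 then (\<lambda>x. x) else if w \<in> T then factor_seq A E S T w else (\<lambda>x. \<zero>))"

lemma linear_endo_factor_seq: "linear_endo k A (factor_seq A E S T w)"
proof (induction w rule: measure_induct_rule[where f="\<lambda>w. card (splits w)"])
  case (less w)
  have "linear_endo k A (\<lambda>x. if fst p + snd p = w \<and> fst p \<in> S - {0} \<and> snd p \<in> T - {0}
     then factor_seq A E S T (fst p) (factor_seq A E S T (snd p) x) else \<zero>)" for p
  proof (cases "fst p + snd p = w \<and> fst p \<in> S - {0} \<and> snd p \<in> T - {0}")
    case True
    then have "card (splits (fst p)) < card (splits w)" "card (splits (snd p)) < card (splits w)"
      using card_splits_less[of "fst p" "snd p" w] card_splits_less[of "snd p" "fst p" w]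
      by (auto simp: add.commute)
    then show ?thesis
      using less True by (simp add: linear_endo_comp)
  next
    case False
    then show ?thesis
      by (simp only: if_False linear_endo_zero_map)
  qed
  then show ?case
    by (subst factor_seq.simps, unfold a_minus_def)
      (intro linear_endo_add_map linear_endo_minus_map linear_endo_finsum_map E)
qed

lemma linear_endo_left_factor: "linear_endo k A (left_factor w)"
  by (simp add: left_factor_def linear_endo_factor_seq linear_endo_id linear_endo_zero_map)

lemma linear_endo_right_factor: "linear_endo k A (right_factor w)"
  by (simp add: right_factor_def linear_endo_factor_seq linear_endo_id linear_endo_zero_map)

lemma factor_closed [simp]: "x \<in> carrier A \<Longrightarrow> left_factor w x \<in> carrier A"
    "x \<in> carrier A \<Longrightarrow> right_factor w x \<in> carrier A"
    "x \<in> carrier A \<Longrightarrow> factor_seq A E S T w x \<in> carrier A"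
    "x \<in> carrier A \<Longrightarrow> E w x \<in> carrier A"
  by (rule linear_endo_closed[OF linear_endo_left_factor], assumption,
      rule linear_endo_closed[OF linear_endo_right_factor], assumption,
      rule linear_endo_closed[OF linear_endo_factor_seq], assumption)
    (rule linear_endo_closed[OF E])

lemma left_factor_off: "w \<noteq> 0 \<Longrightarrow> w \<notin> S \<Longrightarrow> left_factor w x = \<zero>"
  by (simp add: left_factor_def)

lemma right_factor_off: "w \<noteq> 0 \<Longrightarrow> w \<notin> T \<Longrightarrow> right_factor w x = \<zero>"
  by (simp add: right_factor_def)

lemma left_factor_zero: "left_factor 0 x = x"
  by (simp add: left_factor_def)

lemma right_factor_zero: "right_factor 0 x = x"
  by (simp add: right_factor_def)

lemma factor_zero [simp]: "left_factor w \<zero> = \<zero>"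
  by (rule linear_endo_zero[OF linear_endo_left_factor])

text \<open>For nonzero \<open>w\<close> only three kinds of splittings contribute:
  \<open>(w, 0)\<close>, \<open>(0, w)\<close> and pairs in \<open>S\<close> x \<open>T\<close>. If
  \<open>w\<close> lies in \<open>S\<close> or \<open>T\<close>, exactly one factor is nontrivial at
  \<open>w\<close>, and by the recursion it is \<open>E w\<close> minus the cross terms. If
  \<open>w\<close> lies in neither, \<open>ST_add\<close> excludes cross terms and everything is
  zero.\<close>

lemma convolve_factors:
  assumes x: "x \<in> carrier A"
  shows "convolve left_factor right_factor w x = E w x"
proof (cases "w = 0")
  case True
  then show ?thesis
    using x E0 by (simp add: convolve_def left_factor_zero right_factor_zero)
next
  case False
  let ?X = "factor_seq A E S T"
  let ?t = "\<lambda>p. left_factor (fst p) (right_factor (snd p) x)"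
  let ?I = "splits w \<inter> S \<times> T"
  have fin: "finite ?I"
    by simp
  have I: "(\<Oplus>p\<in>splits w. if fst p + snd p = w \<and> fst p \<in> S - {0} \<and> snd p \<in> T - {0}
     then ?X (fst p) (?X (snd p) x) else \<zero>) = finsum A ?t ?I"
    using x zero
    by (intro A.add.finprod_mono_neutral_cong_right)
      (auto simp: left_factor_def right_factor_def mem_Times_iff)
  have off: "?t p = \<zero>" if "p \<in> splits w - insert (w, 0) (insert (0, w) ?I)" for p
    using that by (cases p) (auto simp: left_factor_def right_factor_def linear_endo_zero[OF linear_endo_factor_seq])
  have "convolve left_factor right_factor w x = finsum A ?t (insert (w, 0) (insert (0, w) ?I))"
    unfolding convolve_def using x off
    by (intro A.add.finprod_mono_neutral_cong_right) auto
  also have "\<dots> = left_factor w x \<oplus> (right_factor w x \<oplus> finsum A ?t ?I)"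
    using x zero False
    by (subst A.finsum_insert, (auto simp: Pi_def left_factor_zero right_factor_zero)[4],
        subst A.finsum_insert) (auto simp: Pi_def left_factor_zero right_factor_zero)
  also have "\<dots> = E w x"
  proof -
    have Isum: "finsum A ?t ?I \<in> carrier A"
      using x by (intro A.finsum_closed) auto
    consider "w \<in> S" "w \<notin> T" | "w \<in> T" "w \<notin> S" | "w \<notin> S" "w \<notin> T"
      using disj by blast
    then show ?thesis
    proof cases
      case 1
      then have "left_factor w x = E w x \<ominus> finsum A ?t ?I" "right_factor w x = \<zero>"
        using False x I by (auto simp: left_factor_def right_factor_def factor_seq.simps[of A E S T w])
      then show ?thesis
        using Isum x by (simp add: a_minus_def A.a_assoc A.l_neg)
    next
      case 2
      then have "right_factor w x = E w x \<ominus> finsum A ?t ?I" "left_factor w x = \<zero>"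
        using False x I by (auto simp: left_factor_def right_factor_def factor_seq.simps[of A E S T w])
      then show ?thesis
        using Isum x by (simp add: a_minus_def A.a_assoc A.l_neg)
    next
      case 3
      then have "?I = {}"
        using ST_add by fastforce
      then show ?thesis
        using 3 False x E_supp by (simp add: left_factor_off right_factor_off)
    qed
  qed
  finally show ?thesis .
qed

lemma leibniz_convolve_factors: "w \<in> \<Delta> \<Longrightarrow> leibniz (convolve left_factor right_factor) w"
  using E_leibniz unfolding leibniz_def by (simp add: convolve_factors)

lemma leibniz_left_off: "w \<noteq> 0 \<Longrightarrow> w \<notin> S \<Longrightarrow> leibniz left_factor w"
  by (rule leibniz_off_support[where S=S]) (auto simp: left_factor_off linear_endo_left_factor S_add)

lemma leibniz_right_off: "w \<noteq> 0 \<Longrightarrow> w \<notin> T \<Longrightarrow> leibniz right_factor w"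
  by (rule leibniz_off_support[where S=T]) (auto simp: right_factor_off linear_endo_right_factor T_add)

text \<open>Since \<open>S\<close> and \<open>T\<close> are disjoint, a nonzero \<open>w\<close> is
  outside at least one of them. The corresponding factor obeys the rule at \<open>w\<close> for
  support reasons, and the other one then obtains it from the composite by cancellation.\<close>

lemma leibniz_factors:
  assumes "w \<in> \<Delta>"
  shows "leibniz left_factor w \<and> leibniz right_factor w"
  using assms
proof (induction w rule: measure_induct_rule[where f="\<lambda>w. card (splits w)"])
  case (less w)
  have IH: "leibniz left_factor a \<and> leibniz right_factor a" if "a + b = w" "b \<noteq> 0" for a b
    using that less card_splits_less[of a b w] \<Delta>[of a b] by auto
  show ?case
  proof (cases "w = 0")
    case True
    then show ?thesis
      by (simp add: leibniz_def left_factor_zero right_factor_zero)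
  next
    case False
    consider "w \<notin> T" | "w \<notin> S"
      using disj by blast
    then show ?thesis
    proof cases
      case 1
      have R: "leibniz right_factor w"
        using 1 False by (rule leibniz_right_off[rotated])
      have "leibniz left_factor w"
      proof (rule leibniz_left_factor[OF linear_endo_left_factor linear_endo_right_factor])
        \<comment> \<open>For \<open>a = 0\<close> the summand \<open>b\<close> is \<open>w\<close>
          itself, which the induction hypothesis does not reach; \<open>R\<close> covers it.\<close>
        show "leibniz right_factor b" if "a + b = w" for a b
          using IH[of b a] that R by (cases "a = 0") (auto simp: add.commute)
      qed (use IH right_factor_zero less leibniz_convolve_factors in auto)
      with R show ?thesis by simp
    next
      case 2
      have L: "leibniz left_factor w"
        using 2 False by (rule leibniz_left_off[rotated])
      have "leibniz right_factor w"
      proof (rule leibniz_right_factor[OF linear_endo_left_factor linear_endo_right_factor])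
        show "leibniz left_factor a" if "a + b = w" for a b
          using IH[of a b] that L by (cases "b = 0") auto
        show "leibniz right_factor b" if "a + b = w" "a \<noteq> 0" for a b
          using IH[of b a] that by (auto simp: add.commute)
      qed (use left_factor_zero less leibniz_convolve_factors in auto)
      with L show ?thesis by simp
    qed
  qed
qed

text \<open>The correction sum of the recursion is empty at such an index, so factoring leaves the
  value of \<open>E\<close> untouched.\<close>

lemma factor_seq_indecomposable:
  assumes "x \<in> carrier A" "\<And>a b. a \<in> S \<Longrightarrow> b \<in> T \<Longrightarrow> a + b \<noteq> w"
  shows "factor_seq A E S T w x = E w x"
proof -
  have "(\<Oplus>p\<in>splits w. if fst p + snd p = w \<and> fst p \<in> S - {0} \<and> snd p \<in> T - {0}
     then factor_seq A E S T (fst p) (factor_seq A E S T (snd p) x) else \<zero>) = \<zero>"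
    using assms(2) by (intro A.add.finprod_one_eqI) auto
  then show ?thesis
    using assms(1) by (subst factor_seq.simps) (simp add: a_minus_def)
qed

end

section \<open>Separating the indices by a ray\<close>

definition strict_additive_order :: "('m::comm_monoid_add \<Rightarrow> 'm \<Rightarrow> bool) \<Rightarrow> bool" where
  "strict_additive_order lt \<longleftrightarrow> (\<forall>a. \<not> lt a a) \<and> (\<forall>a b c. lt a b \<longrightarrow> lt b c \<longrightarrow> lt a c) \<and>
     (\<forall>a b. lt a b \<or> a = b \<or> lt b a) \<and> (\<forall>a b c. lt a b \<longrightarrow> lt (a + c) (b + c))"

text \<open>A linear order on the variables, taken from the well-ordering theorem, is extended to
  multisets. The extension inherits transitivity, irreflexivity and totality, and cancellation of
  common elements makes it compatible with addition.\<close>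

lemma ex_strict_additive_order_multiset: "\<exists>lt :: 'i multiset \<Rightarrow> 'i multiset \<Rightarrow> bool. strict_additive_order lt"
proof -
  obtain r :: "'i rel" where r: "Well_order r" "Field r = UNIV"
    using well_ordering[where 'a='i] by (elim exE conjE)
  \<comment> \<open>The strict part, since irreflexivity is required for the multiset order to be
    irreflexive and to allow cancellation.\<close>
  define s where "s = r - Id"
  have lin: "linear_order_on UNIV r"
    using r by (simp add: well_order_on_def)
  then have s: "trans s" "irrefl s" "total s"
    unfolding s_def linear_order_on_def partial_order_on_def preorder_on_def
    by (auto simp: trans_diff_Id irrefl_diff_Id total_on_diff_Id)
  show ?thesis
    unfolding strict_additive_order_def
  proof (intro exI[of _ "\<lambda>a b. (a, b) \<in> mult s"] conjI allI impI)
    show "(a, a) \<notin> mult s" for a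
      using irrefl_mult[OF s(1,2)] by (auto simp: irrefl_def)
    show "(a, c) \<in> mult s" if "(a, b) \<in> mult s" "(b, c) \<in> mult s" for a b c
      using trans_mult[OF s(1)] that by (meson transD)
    show "(a, b) \<in> mult s \<or> a = b \<or> (b, a) \<in> mult s" for a b
      using total_mult[OF s(3,1)] by (auto simp: total_on_def)
    show "(a + c, b + c) \<in> mult s" if "(a, b) \<in> mult s" for a b c
      using that mult_cancel[OF s(1), of c a b] s(2) by (auto simp: irrefl_on_def irrefl_def)
  qed
qed

text \<open>\<open>E\<close> becomes the composite of a factor on \<open>below\<close>, one on
  \<open>ray\<close> and one on \<open>above\<close>. The ray is a copy of the natural numbers via n
  \<mapsto> (n, n \<alpha>), so the middle factor is an ordinary Hasse-Schmidt derivation.\<close>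

theorem (in calg) hs_coefficient_integrable:
  fixes E :: "nat \<times> 'i multiset \<Rightarrow> 'a \<Rightarrow> 'a"
  assumes E: "\<And>w. linear_endo k A (E w)"
    and E0: "\<And>x. x \<in> carrier A \<Longrightarrow> E (0, {#}) x = x"
    and E_supp: "\<And>\<beta> x. \<beta> \<noteq> {#} \<Longrightarrow> x \<in> carrier A \<Longrightarrow> E (0, \<beta>) x = \<zero>"
    and E_leibniz: "\<And>i \<beta>. i \<le> m \<Longrightarrow> leibniz E (i, \<beta>)"
  shows "\<exists>D. hasse_schmidt k A m D \<and> (\<forall>x\<in>carrier A. D 1 x = E (1, \<alpha>) x)"
proof -
  obtain lt :: "'i multiset \<Rightarrow> 'i multiset \<Rightarrow> bool" where "strict_additive_order lt"
    using ex_strict_additive_order_multiset by blast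
  then have lt: "\<And>a. \<not> lt a a" "\<And>a b c. lt a b \<Longrightarrow> lt b c \<Longrightarrow> lt a c" "\<And>a b. lt a b \<or> a = b \<or> lt b a"
      "\<And>a b c. lt a b \<Longrightarrow> lt (a + c) (b + c)"
    unfolding strict_additive_order_def by blast+
  have lt_add: "lt (a + c) (b + d)" if "lt a b" "lt c d \<or> c = d" for a b c d
    using lt(4)[OF that(1), of c] lt(4)[of c d b] that(2) lt(2) by (metis add.commute)
  \<comment> \<open>A positive first component is demanded in all three regions. It keeps 0 out of
    them, and the indices \<open>(0, \<beta>)\<close> with nonempty \<beta> that are thereby left
    out are those where \<open>E\<close> vanishes by \<open>E_supp\<close>.\<close>
  define below where "below = {w. fst w \<noteq> 0 \<and> lt (snd w) (repeat_mset (fst w) \<alpha>)}"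
  define ray where "ray = {w. fst w \<noteq> 0 \<and> snd w = repeat_mset (fst w) \<alpha>}"
  define above where "above = {w. fst w \<noteq> 0 \<and> lt (repeat_mset (fst w) \<alpha>) (snd w)}"
  define \<Delta> where "\<Delta> = {w :: nat \<times> 'i multiset. fst w \<le> m}"
  have un: "w \<in> below \<union> (ray \<union> above)" if "fst w \<noteq> 0" for w
    using that lt(3)[of "snd w"] by (auto simp: below_def ray_def above_def)
  have below_add: "a + b \<in> below" if "a \<in> below" "b \<in> below" for a b
    using that lt_add by (auto simp: below_def repeat_mset_distrib)
  have ray_add: "a + b \<in> ray" if "a \<in> ray" "b \<in> ray" for a b
    using that by (auto simp: ray_def repeat_mset_distrib)
  have above_add: "a + b \<in> above" if "a \<in> above" "b \<in> ray \<union> above" for a b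
    using that lt_add by (auto simp: above_def ray_def repeat_mset_distrib)
  have upper_add: "a + b \<in> ray \<union> above" if "a \<in> ray \<union> above" "b \<in> ray \<union> above" for a b
    using that above_add[of a b] above_add[of b a] ray_add[of a b] by (auto simp: add.commute)
  interpret one: hs_factorization k A E below "ray \<union> above" \<Delta>
  proof
    show "E 0 x = x" if "x \<in> carrier A" for x
      using E0 that by (simp add: zero_prod_def)
    show "E w x = \<zero>" if "w \<noteq> 0" "w \<notin> below \<union> (ray \<union> above)" "x \<in> carrier A" for w x
      using that un[of w] E_supp[of "snd w" x] by (cases w) (auto simp: zero_prod_def)
    show "leibniz E w" if "w \<in> \<Delta>" for w
      using that E_leibniz[of "fst w" "snd w"] by (simp add: \<Delta>_def)
    show "below \<inter> (ray \<union> above) = {}"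
      using lt by (auto simp: below_def ray_def above_def)
    show "a + b \<in> below \<union> (ray \<union> above)" if "a \<in> below" "b \<in> ray \<union> above" for a b
      using that by (intro un) (auto simp: below_def)
  qed (use E below_add upper_add in \<open>auto simp: \<Delta>_def below_def ray_def above_def\<close>)
  \<comment> \<open>The right factor of the first step is supported on \<open>ray\<close> and
    \<open>above\<close> and obeys the Leibniz rule on \<Delta>, so it can be factored in
    turn.\<close>
  interpret two: hs_factorization k A one.right_factor ray above \<Delta>
  proof
    show "ray \<inter> above = {}"
      using lt by (auto simp: ray_def above_def)
    show "a + b \<in> ray \<union> above" if "a \<in> ray" "b \<in> above" for a b
      using that by (intro upper_add) auto
  qed (use one.linear_endo_right_factor one.right_factor_zero one.right_factor_off one.leibniz_factors ray_add above_add
      in \<open>auto simp: \<Delta>_def ray_def above_def\<close>)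
  define D where "D n = two.left_factor (n, repeat_mset n \<alpha>)" for n
  have lin: "linear_endo k A (D n)" for n
    by (simp add: D_def two.linear_endo_left_factor)
  have "hasse_schmidt k A m D"
    unfolding hasse_schmidt_def
  proof (intro conjI allI impI ballI)
    show "linear_endo k A (D n)" for n by (rule lin)
    show "D 0 x = x" if "x \<in> carrier A" for x
      using two.left_factor_zero by (simp add: D_def zero_prod_def)
    fix n x y assume n: "n \<le> m" and xy: "x \<in> carrier A" "y \<in> carrier A"
    let ?w = "(n, repeat_mset n \<alpha>)" and ?h = "\<lambda>i. ((i, repeat_mset i \<alpha>), (n - i, repeat_mset (n - i) \<alpha>))"
    let ?f = "\<lambda>p. two.left_factor (fst p) x \<otimes> two.left_factor (snd p) y"
    have "D n (x \<otimes> y) = (\<Oplus>p\<in>splits ?w. ?f p)"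
      using two.leibniz_factors[of ?w] n xy by (simp add: D_def \<Delta>_def leibniz_def)
    also have "\<dots> = (\<Oplus>p\<in>?h ` {..n}. ?f p)"
    proof (rule A.add.finprod_mono_neutral_cong_right)
      show "?h ` {..n} \<subseteq> splits ?w"
        by (auto simp flip: repeat_mset_distrib)
      fix p assume p: "p \<in> splits ?w - ?h ` {..n}"
      obtain i \<beta> j \<gamma> where ij: "p = ((i, \<beta>), (j, \<gamma>))"
        by (cases p) auto
      \<comment> \<open>A splitting outside the image has a part off the ray, where the factor is
        zero. The index 0 counts as the ray point with i = 0, because the factor is the identity
        there.\<close>
      have "\<not> (\<beta> = repeat_mset i \<alpha> \<and> \<gamma> = repeat_mset j \<alpha>)"
        using p ij by auto
      then have "((i, \<beta>) \<noteq> 0 \<and> (i, \<beta>) \<notin> ray) \<or> ((j, \<gamma>) \<noteq> 0 \<and> (j, \<gamma>) \<notin> ray)"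
        by (auto simp: ray_def zero_prod_def)
      then show "?f p = \<zero>"
        using ij xy two.left_factor_off by auto
    qed (use xy in auto)
    also have "\<dots> = (\<Oplus>i\<in>{..n}. ?f (?h i))"
      using xy by (intro A.finsum_reindex) (auto simp: inj_on_def)
    finally show "D n (x \<otimes> y) = (\<Oplus>i\<in>{..n}. D i x \<otimes> D (n - i) y)"
      by (simp add: D_def)
  qed
  moreover have "D 1 x = E (1, \<alpha>) x" if x: "x \<in> carrier A" for x
  proof -
    have one: "(1, \<alpha>) \<in> ray" "(1, \<alpha>) \<noteq> (0 :: nat \<times> 'i multiset)" 
      by (auto simp: ray_def zero_prod_def)
    have "D 1 x = factor_seq A one.right_factor ray above (1, \<alpha>) x"
      using one by (simp add: D_def two.left_factor_def)
    \<comment> \<open>Two indices with positive first components add up to a first component of at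
      least 2, so neither recursion has a correction term at \<open>(1, \<alpha>)\<close>.\<close>
    also have "\<dots> = one.right_factor (1, \<alpha>) x"
      using x by (intro two.factor_seq_indecomposable) (auto simp: ray_def above_def)
    also have "\<dots> = factor_seq A E below (ray \<union> above) (1, \<alpha>) x"
      using one by (simp add: one.right_factor_def)
    also have "\<dots> = E (1, \<alpha>) x"
      using x by (intro one.factor_seq_indecomposable) (auto simp: ray_def above_def below_def)
    finally show ?thesis .
  qed
  ultimately show ?thesis
    by blast
qed

section \<open>Tensor products\<close>

definition balanced_map ::
  "('r, 'x) ring_scheme \<Rightarrow> ('r, 'm, 'y) module_scheme \<Rightarrow> ('r, 'n, 'z) module_scheme
    \<Rightarrow> ('p, 'w) ring_scheme \<Rightarrow> ('m \<Rightarrow> 'n \<Rightarrow> 'p) \<Rightarrow> bool" where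
  "balanced_map R M N Q f \<longleftrightarrow>
     (\<forall>a\<in>carrier M. \<forall>b\<in>carrier N. f a b \<in> carrier Q) \<and>
     (\<forall>a\<in>carrier M. \<forall>a'\<in>carrier M. \<forall>b\<in>carrier N. f (a \<oplus>\<^bsub>M\<^esub> a') b = f a b \<oplus>\<^bsub>Q\<^esub> f a' b) \<and>
     (\<forall>a\<in>carrier M. \<forall>b\<in>carrier N. \<forall>b'\<in>carrier N. f a (b \<oplus>\<^bsub>N\<^esub> b') = f a b \<oplus>\<^bsub>Q\<^esub> f a b') \<and>
     (\<forall>r\<in>carrier R. \<forall>a\<in>carrier M. \<forall>b\<in>carrier N. f (r \<odot>\<^bsub>M\<^esub> a) b = f a (r \<odot>\<^bsub>N\<^esub> b))"

text \<open>\<open>P\<close> is any record with the additive structure of the tensor group, so that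
  the same results serve the algebra \<open>base_change\<close> and the module
  \<open>base_change_module\<close>.\<close>

locale tensor_space =
  fixes R :: "('r, 'x) ring_scheme" and M :: "('r, 'm, 'y) module_scheme"
    and N :: "('r, 'n, 'z) module_scheme" and P :: "(('m \<times> 'n \<Rightarrow>\<^sub>0 int) set, 'w) ring_scheme"
  assumes module_M: "module R M" and module_N: "module R N"
    and carrier_P: "carrier P = carrier (tensor_group R M N)"
    and add_P: "add P = monoid.mult (tensor_group R M N)"
    and zero_P: "ring.zero P = \<one>\<^bsub>tensor_group R M N\<^esub>"

sublocale tensor_space \<subseteq> R: cring R
  using module_M by (rule module.axioms)

sublocale tensor_space \<subseteq> M: module R M
  by (rule module_M)

sublocale tensor_space \<subseteq> N: module R N
  by (rule module_N)

context tensor_space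
begin

abbreviation "pairs \<equiv> carrier M \<times> carrier N"
abbreviation "FG \<equiv> free_Abelian_group pairs"
abbreviation "Ker \<equiv> tensor_kernel R M N"
abbreviation "cls \<equiv> tensor_class R M N"
abbreviation "pure \<equiv> pure_tensor R M N"

lemma keys_add_pairs:
  "\<lbrakk>Poly_Mapping.keys x \<subseteq> pairs; Poly_Mapping.keys y \<subseteq> pairs\<rbrakk> \<Longrightarrow> Poly_Mapping.keys (x + y) \<subseteq> pairs"
  using Poly_Mapping.keys_add[of x y] by (meson Un_least order_trans)

lemma relators_keys: "r \<in> tensor_relators R M N \<Longrightarrow> Poly_Mapping.keys r \<subseteq> pairs"
  unfolding tensor_relators_def
  by (elim UnE CollectE exE conjE; hypsubst; intro order_trans[OF keys_diff] Un_least) simp_all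

lemma kernel_subgroup: "subgroup Ker FG"
  unfolding tensor_kernel_def
  by (rule group.generate_is_subgroup) (auto dest: relators_keys)

lemma kernel_normal: "Ker \<lhd> FG"
  by (rule comm_group.subgroup_imp_normal[OF abelian_free_Abelian_group kernel_subgroup])

lemma kernel_keys: "x \<in> Ker \<Longrightarrow> Poly_Mapping.keys x \<subseteq> pairs"
  using subgroup.mem_carrier[OF kernel_subgroup] by simp

lemma kernel_zero: "0 \<in> Ker"
  using subgroup.one_closed[OF kernel_subgroup] by simp

lemma kernel_add: "x \<in> Ker \<Longrightarrow> y \<in> Ker \<Longrightarrow> x + y \<in> Ker"
  using subgroup.m_closed[OF kernel_subgroup] by simp

lemma kernel_minus: "x \<in> Ker \<Longrightarrow> - x \<in> Ker"
  using subgroup.m_inv_closed[OF kernel_subgroup] kernel_keys by fastforce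

lemma kernel_diff: "x \<in> Ker \<Longrightarrow> y \<in> Ker \<Longrightarrow> x - y \<in> Ker"
  using kernel_add[of x "- y"] kernel_minus by simp

lemma kernel_induct:
  assumes "x \<in> Ker" and "\<And>r. r \<in> tensor_relators R M N \<Longrightarrow> Q r" and "Q 0"
    and "\<And>x y. Poly_Mapping.keys x \<subseteq> pairs \<Longrightarrow> Poly_Mapping.keys y \<subseteq> pairs \<Longrightarrow> Q x \<Longrightarrow> Q y \<Longrightarrow> Q (x - y)"
  shows "Q x"
proof -
  have "Q x \<and> Poly_Mapping.keys x \<subseteq> pairs"
    using assms(1) unfolding tensor_kernel_def
  proof (induction rule: generate.induct)
    case one
    then show ?case using assms by simp
  next
    case (incl h)
    then show ?case using assms relators_keys by simp
  next
    case (inv h)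
    then have "Q h" "Poly_Mapping.keys h \<subseteq> pairs"
      using assms relators_keys by auto
    then show ?case using assms(4)[of 0 h] assms(3) by simp
  next
    case (eng x y)
    then have "Q (x - (0 - y))" "Poly_Mapping.keys (x + y) \<subseteq> pairs"
      using assms(4)[of 0 y] assms(4)[of x "0 - y"] assms(3) Poly_Mapping.keys_add[of x y] by auto
    then show ?case by simp
  qed
  then show ?thesis by simp
qed

lemma mem_cls:
  assumes "Poly_Mapping.keys x \<subseteq> pairs"
  shows "y \<in> cls x \<longleftrightarrow> y - x \<in> Ker"
proof
  assume "y \<in> cls x"
  then show "y - x \<in> Ker"
    by (auto simp: tensor_class_def r_coset_def)
next
  assume "y - x \<in> Ker"
  then show "y \<in> cls x"
    unfolding tensor_class_def r_coset_def by (auto intro!: bexI[of _ "y - x"])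
qed

lemma cls_self: "Poly_Mapping.keys x \<subseteq> pairs \<Longrightarrow> x \<in> cls x"
  by (simp add: mem_cls kernel_zero)

lemma mem_cls_keys: "Poly_Mapping.keys x \<subseteq> pairs \<Longrightarrow> y \<in> cls x \<Longrightarrow> Poly_Mapping.keys y \<subseteq> pairs"
  using Poly_Mapping.keys_add[of "y - x" x] by (auto simp: mem_cls dest: kernel_keys)

lemma cls_eq:
  assumes "Poly_Mapping.keys x \<subseteq> pairs" "Poly_Mapping.keys y \<subseteq> pairs"
  shows "cls x = cls y \<longleftrightarrow> x - y \<in> Ker"
proof
  assume "cls x = cls y"
  then show "x - y \<in> Ker"
    using cls_self[OF assms(1)] mem_cls[OF assms(2)] by simp
next
  assume *: "x - y \<in> Ker"
  have "z - x \<in> Ker \<longleftrightarrow> z - y \<in> Ker" for z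
    using kernel_add[OF _ *, of "z - x"] kernel_diff[OF _ *, of "z - y"] by auto
  then show "cls x = cls y"
    using mem_cls assms by blast
qed

lemma carrier_P_iff: "U \<in> carrier P \<longleftrightarrow> (\<exists>x. Poly_Mapping.keys x \<subseteq> pairs \<and> U = cls x)"
  unfolding carrier_P tensor_group_def carrier_FactGroup tensor_class_def image_iff Bex_def
    carrier_free_Abelian_group_iff ..

lemma cls_closed [simp]: "Poly_Mapping.keys x \<subseteq> pairs \<Longrightarrow> cls x \<in> carrier P"
  by (auto simp: carrier_P_iff)

lemma cls_add:
  assumes "Poly_Mapping.keys x \<subseteq> pairs" "Poly_Mapping.keys y \<subseteq> pairs"
  shows "cls (x + y) = cls x \<oplus>\<^bsub>P\<^esub> cls y"
  using normal.rcos_sum[OF kernel_normal, of x y] assms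
  by (simp add: add_P tensor_group_def tensor_class_def)

lemma cls_zero: "cls 0 = \<zero>\<^bsub>P\<^esub>"
  using group.coset_join2[of FG "\<one>\<^bsub>FG\<^esub>" Ker] kernel_subgroup kernel_zero
  by (simp add: zero_P tensor_group_def tensor_class_def)

lemma abelian_group_P: "abelian_group P"
proof (rule abelian_groupI)
  show "\<zero>\<^bsub>P\<^esub> \<in> carrier P"
    using cls_closed[of 0] by (simp add: cls_zero)
  show "\<exists>y\<in>carrier P. y \<oplus>\<^bsub>P\<^esub> x = \<zero>\<^bsub>P\<^esub>" if "x \<in> carrier P" for x
  proof -
    from that obtain u where u: "Poly_Mapping.keys u \<subseteq> pairs" "x = cls u"
      by (auto simp: carrier_P_iff)
    then have "cls (- u) \<oplus>\<^bsub>P\<^esub> x = \<zero>\<^bsub>P\<^esub>"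
      using cls_add[of "- u" u] by (simp add: cls_zero)
    then show ?thesis
      using u by (intro bexI[of _ "cls (- u)"]) auto
  qed
  fix x y z assume "x \<in> carrier P" "y \<in> carrier P" "z \<in> carrier P"
  then obtain u v w where *: "Poly_Mapping.keys u \<subseteq> pairs" "x = cls u"
      "Poly_Mapping.keys v \<subseteq> pairs" "y = cls v" "Poly_Mapping.keys w \<subseteq> pairs" "z = cls w"
    by (auto simp: carrier_P_iff)
  have **: "Poly_Mapping.keys (u + v) \<subseteq> pairs" "Poly_Mapping.keys (v + w) \<subseteq> pairs"
    by (intro keys_add_pairs *)+
  show "x \<oplus>\<^bsub>P\<^esub> y \<oplus>\<^bsub>P\<^esub> z = x \<oplus>\<^bsub>P\<^esub> (y \<oplus>\<^bsub>P\<^esub> z)"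
    using * ** by (simp add: cls_add[symmetric] add.assoc)
next
  fix x y assume "x \<in> carrier P" "y \<in> carrier P"
  then obtain u v where *: "Poly_Mapping.keys u \<subseteq> pairs" "x = cls u"
      "Poly_Mapping.keys v \<subseteq> pairs" "y = cls v"
    by (auto simp: carrier_P_iff)
  have **: "Poly_Mapping.keys (u + v) \<subseteq> pairs"
    by (intro keys_add_pairs *)+
  show "x \<oplus>\<^bsub>P\<^esub> y \<in> carrier P" "x \<oplus>\<^bsub>P\<^esub> y = y \<oplus>\<^bsub>P\<^esub> x" "\<zero>\<^bsub>P\<^esub> \<oplus>\<^bsub>P\<^esub> x = x"
    using * ** by (simp_all add: cls_add[symmetric] cls_zero[symmetric] add.commute)
qed

end

sublocale tensor_space \<subseteq> P: abelian_group P
  by (rule abelian_group_P)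

context tensor_space
begin

lemma cls_minus:
  assumes "Poly_Mapping.keys x \<subseteq> pairs"
  shows "cls (- x) = \<ominus>\<^bsub>P\<^esub> cls x"
proof -
  have "cls (- x) \<oplus>\<^bsub>P\<^esub> cls x = \<zero>\<^bsub>P\<^esub>"
    using cls_add[of "- x" x] assms by (simp add: cls_zero)
  then show ?thesis
    using assms P.minus_equality[of "cls (- x)" "cls x"] by simp
qed

lemma cls_diff:
  assumes "Poly_Mapping.keys x \<subseteq> pairs" "Poly_Mapping.keys y \<subseteq> pairs"
  shows "cls (x - y) = cls x \<ominus>\<^bsub>P\<^esub> cls y"
  using cls_add[of x "- y"] cls_minus assms by (simp add: a_minus_def)

lemma pure_closed [simp]: "a \<in> carrier M \<Longrightarrow> b \<in> carrier N \<Longrightarrow> pure a b \<in> carrier P"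
  unfolding pure_tensor_def by simp

lemma relator_eq:
  assumes "frag_of p - x \<in> tensor_relators R M N" "p \<in> pairs" "Poly_Mapping.keys x \<subseteq> pairs"
  shows "cls (frag_of p) = cls x"
  using assms generate.incl[OF assms(1), of FG] by (subst cls_eq) (auto simp: tensor_kernel_def)

lemma pure_balanced: "balanced_map R M N P pure"
  unfolding balanced_map_def
proof (intro conjI ballI)
  fix a a' b assume *: "a \<in> carrier M" "a' \<in> carrier M" "b \<in> carrier N"
  have "cls (frag_of (a \<oplus>\<^bsub>M\<^esub> a', b)) = cls (frag_of (a, b) + frag_of (a', b))"
  proof (rule relator_eq)
    show "frag_of (a \<oplus>\<^bsub>M\<^esub> a', b) - (frag_of (a, b) + frag_of (a', b)) \<in> tensor_relators R M N"
      unfolding diff_diff_add[symmetric] tensor_relators_def using * by blast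
  qed (use * in \<open>auto intro!: order_trans[OF keys_add]\<close>)
  then show "pure (a \<oplus>\<^bsub>M\<^esub> a') b = pure a b \<oplus>\<^bsub>P\<^esub> pure a' b"
    using * by (simp add: pure_tensor_def cls_add)
next
  fix a b b' assume *: "a \<in> carrier M" "b \<in> carrier N" "b' \<in> carrier N"
  have "cls (frag_of (a, b \<oplus>\<^bsub>N\<^esub> b')) = cls (frag_of (a, b) + frag_of (a, b'))"
  proof (rule relator_eq)
    show "frag_of (a, b \<oplus>\<^bsub>N\<^esub> b') - (frag_of (a, b) + frag_of (a, b')) \<in> tensor_relators R M N"
      unfolding diff_diff_add[symmetric] tensor_relators_def using * by blast
  qed (use * in \<open>auto intro!: order_trans[OF keys_add]\<close>)
  then show "pure a (b \<oplus>\<^bsub>N\<^esub> b') = pure a b \<oplus>\<^bsub>P\<^esub> pure a b'"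
    using * by (simp add: pure_tensor_def cls_add)
next
  fix r a b assume *: "r \<in> carrier R" "a \<in> carrier M" "b \<in> carrier N"
  have "cls (frag_of (r \<odot>\<^bsub>M\<^esub> a, b)) = cls (frag_of (a, r \<odot>\<^bsub>N\<^esub> b))"
  proof (rule relator_eq)
    show "frag_of (r \<odot>\<^bsub>M\<^esub> a, b) - frag_of (a, r \<odot>\<^bsub>N\<^esub> b) \<in> tensor_relators R M N"
      unfolding tensor_relators_def using * by blast
  qed (use * in auto)
  then show "pure (r \<odot>\<^bsub>M\<^esub> a) b = pure a (r \<odot>\<^bsub>N\<^esub> b)"
    by (simp add: pure_tensor_def)
qed simp

lemma pure_add_left:
  "\<lbrakk>a \<in> carrier M; a' \<in> carrier M; b \<in> carrier N\<rbrakk> \<Longrightarrow> pure (a \<oplus>\<^bsub>M\<^esub> a') b = pure a b \<oplus>\<^bsub>P\<^esub> pure a' b"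
  using pure_balanced by (auto simp: balanced_map_def)

lemma pure_add_right:
  "\<lbrakk>a \<in> carrier M; b \<in> carrier N; b' \<in> carrier N\<rbrakk> \<Longrightarrow> pure a (b \<oplus>\<^bsub>N\<^esub> b') = pure a b \<oplus>\<^bsub>P\<^esub> pure a b'"
  using pure_balanced by (auto simp: balanced_map_def)

lemma pure_smult:
  "\<lbrakk>r \<in> carrier R; a \<in> carrier M; b \<in> carrier N\<rbrakk> \<Longrightarrow> pure (r \<odot>\<^bsub>M\<^esub> a) b = pure a (r \<odot>\<^bsub>N\<^esub> b)"
  using pure_balanced by (auto simp: balanced_map_def)

lemma pure_zero_right: "a \<in> carrier M \<Longrightarrow> pure a \<zero>\<^bsub>N\<^esub> = \<zero>\<^bsub>P\<^esub>"
  using pure_add_right[of a "\<zero>\<^bsub>N\<^esub>" "\<zero>\<^bsub>N\<^esub>"] by simp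

lemma pure_zero_left: "b \<in> carrier N \<Longrightarrow> pure \<zero>\<^bsub>M\<^esub> b = \<zero>\<^bsub>P\<^esub>"
  using pure_add_left[of "\<zero>\<^bsub>M\<^esub>" "\<zero>\<^bsub>M\<^esub>" b] by simp

lemma pure_minus_left:
  assumes "a \<in> carrier M" "b \<in> carrier N"
  shows "pure (\<ominus>\<^bsub>M\<^esub> a) b = \<ominus>\<^bsub>P\<^esub> pure a b"
proof -
  have "pure (\<ominus>\<^bsub>M\<^esub> a) b \<oplus>\<^bsub>P\<^esub> pure a b = \<zero>\<^bsub>P\<^esub>"
    using pure_add_left[of "\<ominus>\<^bsub>M\<^esub> a" a b] assms by (simp add: M.M.l_neg pure_zero_left)
  then show ?thesis
    using assms P.minus_equality[of "pure (\<ominus>\<^bsub>M\<^esub> a) b" "pure a b"] by simp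
qed

text \<open>Negatives of pure tensors are pure, by moving the sign into the first entry; hence sums
  of pure tensors exhaust the tensor product.\<close>

lemma tensor_induct [consumes 1, case_names pure add]:
  assumes U: "U \<in> carrier P"
    and pure: "\<And>a b. a \<in> carrier M \<Longrightarrow> b \<in> carrier N \<Longrightarrow> Q (pure a b)"
    and add: "\<And>U V. \<lbrakk>U \<in> carrier P; V \<in> carrier P; Q U; Q V\<rbrakk> \<Longrightarrow> Q (U \<oplus>\<^bsub>P\<^esub> V)"
  shows "Q U"
proof -
  obtain x where x: "Poly_Mapping.keys x \<subseteq> pairs" "U = cls x"
    using U by (auto simp: carrier_P_iff)
  \<comment> \<open>Induction over the free abelian group uses differences, while \<open>Q\<close>
    is only stable under sums; carrying the negative along bridges this.\<close>
  have "Q (cls x) \<and> Q (cls (- x))"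
  proof (rule free_Abelian_group_induct[OF x(1)])
    have "Q (pure \<zero>\<^bsub>M\<^esub> \<zero>\<^bsub>N\<^esub>)"
      by (rule pure) auto
    then show "Q (cls 0) \<and> Q (cls (- 0))"
      by (simp add: cls_zero pure_zero_left)
  next
    fix x y :: "'m \<times> 'n \<Rightarrow>\<^sub>0 int"
    assume *: "Poly_Mapping.keys x \<subseteq> pairs" "Poly_Mapping.keys y \<subseteq> pairs"
      "Q (cls x) \<and> Q (cls (- x))" "Q (cls y) \<and> Q (cls (- y))"
    have "cls (x - y) = cls x \<oplus>\<^bsub>P\<^esub> cls (- y)" "cls (- (x - y)) = cls y \<oplus>\<^bsub>P\<^esub> cls (- x)"
      using * cls_add[of x "- y"] cls_add[of y "- x"] by auto
    then show "Q (cls (x - y)) \<and> Q (cls (- (x - y)))"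
      using * add by simp
  next
    fix p assume p: "p \<in> pairs"
    then have "Q (pure (fst p) (snd p))" "Q (pure (\<ominus>\<^bsub>M\<^esub> fst p) (snd p))"
      by (auto intro!: pure)
    moreover have "pure (\<ominus>\<^bsub>M\<^esub> fst p) (snd p) = cls (- frag_of p)"
    proof -
      have "pure (\<ominus>\<^bsub>M\<^esub> fst p) (snd p) = \<ominus>\<^bsub>P\<^esub> pure (fst p) (snd p)"
        using p by (intro pure_minus_left) auto
      also have "\<dots> = cls (- frag_of p)"
        using p by (subst cls_minus) (simp_all add: pure_tensor_def)
      finally show ?thesis .
    qed
    ultimately show "Q (cls (frag_of p)) \<and> Q (cls (- frag_of p))"
      by (simp add: pure_tensor_def)
  qed
  then show ?thesis
    using x by simp
qed

end

lemma (in tensor_space) carrier_PE: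
  assumes "U \<in> carrier P"
  obtains x where "Poly_Mapping.keys x \<subseteq> pairs" "U = cls x"
  using assms unfolding carrier_P_iff by (elim exE conjE)

section \<open>The universal property of the tensor product\<close>

locale tensor_hom = tensor_space R M N P + Q: abelian_group Q
  for R :: "('r, 'x) ring_scheme" and M :: "('r, 'm, 'y) module_scheme"
    and N :: "('r, 'n, 'z) module_scheme" and P :: "(('m \<times> 'n \<Rightarrow>\<^sub>0 int) set, 'w) ring_scheme"
    and Q :: "('p, 'v) ring_scheme" +
  fixes f :: "'m \<Rightarrow> 'n \<Rightarrow> 'p"
  assumes balanced: "balanced_map R M N Q f"
begin

definition frag_lift :: "('m \<times> 'n \<Rightarrow>\<^sub>0 int) \<Rightarrow> 'p" where
  "frag_lift x = (\<Oplus>\<^bsub>Q\<^esub>p\<in>Poly_Mapping.keys x. add_pow Q (Poly_Mapping.lookup x p) (f (fst p) (snd p)))"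

lemma f_closed: "p \<in> pairs \<Longrightarrow> f (fst p) (snd p) \<in> carrier Q"
  using balanced by (auto simp: balanced_map_def)

lemma int_pow_closed [simp]: "p \<in> pairs \<Longrightarrow> add_pow Q (i::int) (f (fst p) (snd p)) \<in> carrier Q"
  using f_closed by (simp add: Q.add.int_pow_closed)

text \<open>Summing over any finite set containing the support lets two formal combinations be added
  over a common index set.\<close>

lemma frag_lift_superset:
  assumes "finite B" "Poly_Mapping.keys x \<subseteq> B" "B \<subseteq> pairs"
  shows "frag_lift x = (\<Oplus>\<^bsub>Q\<^esub>p\<in>B. add_pow Q (Poly_Mapping.lookup x p) (f (fst p) (snd p)))"
  unfolding frag_lift_def
proof (rule Q.add.finprod_mono_neutral_cong_left)
  show "(\<lambda>p. add_pow Q (Poly_Mapping.lookup x p) (f (fst p) (snd p))) \<in> B \<rightarrow> carrier Q"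
    using assms(3) int_pow_closed by blast
qed (use assms in \<open>auto simp: in_keys_iff add_pow_def\<close>)

lemma frag_lift_add:
  assumes "Poly_Mapping.keys x \<subseteq> pairs" "Poly_Mapping.keys y \<subseteq> pairs"
  shows "frag_lift (x + y) = frag_lift x \<oplus>\<^bsub>Q\<^esub> frag_lift y"
proof -
  let ?B = "Poly_Mapping.keys x \<union> Poly_Mapping.keys y"
  have B: "finite ?B" "?B \<subseteq> pairs"
    using assms by auto
  have cl: "(\<lambda>p. add_pow Q (Poly_Mapping.lookup z p) (f (fst p) (snd p))) \<in> ?B \<rightarrow> carrier Q"
    for z :: "'m \<times> 'n \<Rightarrow>\<^sub>0 int"
    by (intro funcsetI) (rule int_pow_closed[OF subsetD[OF B(2)]])
  have "frag_lift (x + y) = (\<Oplus>\<^bsub>Q\<^esub>p\<in>?B. add_pow Q (Poly_Mapping.lookup (x + y) p) (f (fst p) (snd p)))"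
    by (rule frag_lift_superset[OF B(1) Poly_Mapping.keys_add B(2)])
  also have "\<dots> = (\<Oplus>\<^bsub>Q\<^esub>p\<in>?B. add_pow Q (Poly_Mapping.lookup x p) (f (fst p) (snd p))
      \<oplus>\<^bsub>Q\<^esub> add_pow Q (Poly_Mapping.lookup y p) (f (fst p) (snd p)))"
    using B f_closed cl by (intro Q.finsum_cong') (auto simp: lookup_add Q.add.int_pow_mult Pi_def subset_iff)
  also have "\<dots> = frag_lift x \<oplus>\<^bsub>Q\<^esub> frag_lift y"
    using B cl by (subst Q.finsum_addf) (auto simp: frag_lift_superset[of ?B])
  finally show ?thesis .
qed

lemma frag_lift_closed [simp]: "Poly_Mapping.keys x \<subseteq> pairs \<Longrightarrow> frag_lift x \<in> carrier Q"
  unfolding frag_lift_def using int_pow_closed by (intro Q.finsum_closed) blast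

lemma frag_lift_of: "p \<in> pairs \<Longrightarrow> frag_lift (frag_of p) = f (fst p) (snd p)"
  using Q.finsum_insert[of "{}" p "\<lambda>p. f (fst p) (snd p)"] f_closed[of p]
  by (simp add: frag_lift_def Pi_def Q.add.int_pow_1 lookup_single)

lemma frag_lift_zero: "frag_lift 0 = \<zero>\<^bsub>Q\<^esub>"
  by (simp add: frag_lift_def)

lemma frag_lift_diff:
  assumes "Poly_Mapping.keys x \<subseteq> pairs" "Poly_Mapping.keys y \<subseteq> pairs"
  shows "frag_lift (x - y) = frag_lift x \<ominus>\<^bsub>Q\<^esub> frag_lift y"
proof -
  have "frag_lift (- y) \<oplus>\<^bsub>Q\<^esub> frag_lift y = \<zero>\<^bsub>Q\<^esub>"
    using frag_lift_add[of "- y" y] assms frag_lift_zero by simp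
  then have "frag_lift (- y) = \<ominus>\<^bsub>Q\<^esub> frag_lift y"
    using Q.minus_equality[of "frag_lift (- y)" "frag_lift y"] assms by simp
  then show ?thesis
    using frag_lift_add[of x "- y"] assms by (simp add: a_minus_def)
qed

lemma frag_lift_relator:
  assumes "r \<in> tensor_relators R M N"
  shows "frag_lift r = \<zero>\<^bsub>Q\<^esub>"
proof -
  note bal = balanced[unfolded balanced_map_def]
  consider (left) a a' b where "a \<in> carrier M" "a' \<in> carrier M" "b \<in> carrier N"
      "r = frag_of (a \<oplus>\<^bsub>M\<^esub> a', b) - frag_of (a, b) - frag_of (a', b)"
    | (right) a b b' where "a \<in> carrier M" "b \<in> carrier N" "b' \<in> carrier N"
      "r = frag_of (a, b \<oplus>\<^bsub>N\<^esub> b') - frag_of (a, b) - frag_of (a, b')"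
    | (smult) s a b where "s \<in> carrier R" "a \<in> carrier M" "b \<in> carrier N"
      "r = frag_of (s \<odot>\<^bsub>M\<^esub> a, b) - frag_of (a, s \<odot>\<^bsub>N\<^esub> b)"
    using assms unfolding tensor_relators_def by (elim UnE CollectE exE conjE) metis+
  then show ?thesis
  proof cases
    case left
    then have "frag_lift r = f (a \<oplus>\<^bsub>M\<^esub> a') b \<ominus>\<^bsub>Q\<^esub> (f a b \<oplus>\<^bsub>Q\<^esub> f a' b)"
      using keys_add_pairs[of "frag_of (a, b)" "frag_of (a', b)"]
      by (simp add: diff_diff_add frag_lift_diff frag_lift_add frag_lift_of)
    then show ?thesis
      using left bal by (simp add: a_minus_def Q.r_neg)
  next
    case right
    then have "frag_lift r = f a (b \<oplus>\<^bsub>N\<^esub> b') \<ominus>\<^bsub>Q\<^esub> (f a b \<oplus>\<^bsub>Q\<^esub> f a b')"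
      using keys_add_pairs[of "frag_of (a, b)" "frag_of (a, b')"]
      by (simp add: diff_diff_add frag_lift_diff frag_lift_add frag_lift_of)
    then show ?thesis
      using right bal by (simp add: a_minus_def Q.r_neg)
  next
    case smult
    then have "frag_lift r = f (s \<odot>\<^bsub>M\<^esub> a) b \<ominus>\<^bsub>Q\<^esub> f a (s \<odot>\<^bsub>N\<^esub> b)"
      by (simp add: frag_lift_diff frag_lift_of)
    then show ?thesis
      using smult bal by (simp add: a_minus_def Q.r_neg)
  qed
qed

lemma frag_lift_kernel: "x \<in> Ker \<Longrightarrow> frag_lift x = \<zero>\<^bsub>Q\<^esub>"
  by (rule kernel_induct[of x])
    (auto simp: frag_lift_relator frag_lift_zero frag_lift_diff a_minus_def)

text \<open>Representatives of a coset differ by an element of the kernel, which is sent to zero.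
  The image in \<open>tensor_lift\<close> is therefore a singleton and \<open>the_elem\<close> is
  meaningful.\<close>

lemma tensor_lift_cls:
  assumes x: "Poly_Mapping.keys x \<subseteq> pairs"
  shows "tensor_lift Q f (cls x) = frag_lift x"
proof -
  have "frag_lift y = frag_lift x" if "y \<in> cls x" for y
  proof -
    have "y - x \<in> Ker"
      using that x mem_cls by simp
    then show ?thesis
      using x frag_lift_add[of "y - x" x] frag_lift_kernel kernel_keys by simp
  qed
  then have "frag_lift ` cls x = {frag_lift x}"
    using cls_self[OF x] by blast
  then show ?thesis
    by (simp add: tensor_lift_def frag_lift_def[abs_def] cong: image_cong)
qed

lemma tensor_lift_closed [simp]: "U \<in> carrier P \<Longrightarrow> tensor_lift Q f U \<in> carrier Q"
  by (auto simp: carrier_P_iff tensor_lift_cls)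

lemma tensor_lift_pure: "a \<in> carrier M \<Longrightarrow> b \<in> carrier N \<Longrightarrow> tensor_lift Q f (pure a b) = f a b"
  unfolding pure_tensor_def by (subst tensor_lift_cls) (auto simp: frag_lift_of)

lemma tensor_lift_add:
  assumes "U \<in> carrier P" "V \<in> carrier P"
  shows "tensor_lift Q f (U \<oplus>\<^bsub>P\<^esub> V) = tensor_lift Q f U \<oplus>\<^bsub>Q\<^esub> tensor_lift Q f V"
proof -
  obtain x y where *: "Poly_Mapping.keys x \<subseteq> pairs" "U = cls x" "Poly_Mapping.keys y \<subseteq> pairs" "V = cls y"
    using assms unfolding carrier_P_iff by blast
  then show ?thesis
    using keys_add_pairs[of x y] by (simp add: cls_add[symmetric] tensor_lift_cls frag_lift_add)
qed

end

text \<open>Covers both the product of the base-changed algebra and its action on a base-changed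
  module. The operation \<open>u\<close> has values in pairs, where biadditivity makes no sense;
  balancedness is asked only after passing to pure tensors, in each argument separately.\<close>

locale tensor_bilinear = T1: tensor_space R M1 N1 P1 + tensor_space R M N P
  for R :: "('r, 'x) ring_scheme" and M1 :: "('r, 'm1, 'y1) module_scheme"
    and N1 :: "('r, 'n1, 'z1) module_scheme" and P1 :: "(('m1 \<times> 'n1 \<Rightarrow>\<^sub>0 int) set, 'w1) ring_scheme"
    and M :: "('r, 'm, 'y) module_scheme"
    and N :: "('r, 'n, 'z) module_scheme" and P :: "(('m \<times> 'n \<Rightarrow>\<^sub>0 int) set, 'w) ring_scheme" +
  fixes u :: "'m1 \<times> 'n1 \<Rightarrow> 'm \<times> 'n \<Rightarrow> 'm \<times> 'n"
  assumes u_closed: "p \<in> carrier M1 \<times> carrier N1 \<Longrightarrow> q \<in> carrier M \<times> carrier N \<Longrightarrow> u p q \<in> carrier M \<times> carrier N"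
    and left_balanced: "q \<in> carrier M \<times> carrier N \<Longrightarrow>
      balanced_map R M1 N1 P (\<lambda>a b. pure_tensor R M N (fst (u (a, b) q)) (snd (u (a, b) q)))"
    and right_balanced: "p \<in> carrier M1 \<times> carrier N1 \<Longrightarrow>
      balanced_map R M N P (\<lambda>a b. pure_tensor R M N (fst (u p (a, b))) (snd (u p (a, b))))"
begin

definition frag_bil :: "('m1 \<times> 'n1 \<Rightarrow>\<^sub>0 int) \<Rightarrow> ('m \<times> 'n \<Rightarrow>\<^sub>0 int) \<Rightarrow> ('m \<times> 'n \<Rightarrow>\<^sub>0 int)" where
  "frag_bil x y = frag_extend (\<lambda>p. frag_extend (\<lambda>q. frag_of (u p q)) y) x"

lemma frag_bil_diff_left: "frag_bil (x - x') y = frag_bil x y - frag_bil x' y"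
  by (simp add: frag_bil_def frag_extend_diff)

lemma frag_bil_zero_left: "frag_bil 0 y = 0"
  by (simp add: frag_bil_def)

lemma frag_bil_diff_right: "frag_bil x (y - y') = frag_bil x y - frag_bil x y'"
  unfolding frag_bil_def
  by (rule frag_induction[OF subset_UNIV, of _ x]) (simp_all add: frag_extend_diff algebra_simps)

lemma frag_bil_zero_right: "frag_bil x 0 = 0"
  using frag_bil_diff_right[of x 0 0] by simp

lemma keys_frag_bil:
  assumes "Poly_Mapping.keys x \<subseteq> T1.pairs" "Poly_Mapping.keys y \<subseteq> pairs"
  shows "Poly_Mapping.keys (frag_bil x y) \<subseteq> pairs"
proof -
  have *: "Poly_Mapping.keys (frag_extend (\<lambda>q. frag_of (u p q)) y) \<subseteq> pairs" if "p \<in> T1.pairs" for p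
    by (intro order_trans[OF keys_frag_extend] UN_least)
      (use u_closed[OF that subsetD[OF assms(2)]] in simp)
  then show ?thesis
    unfolding frag_bil_def
    by (intro order_trans[OF keys_frag_extend[of _ x]] UN_least[of "Poly_Mapping.keys x"])
      (rule *[OF subsetD[OF assms(1)]])
qed

text \<open>Induction on \<open>y\<close> reduces to a single pair \<open>q\<close>. With
  \<open>q\<close> fixed, the operation is the lift of a balanced map, and lifts vanish on the
  kernel.\<close>

lemma frag_bil_kernel_left:
  assumes x: "x \<in> T1.Ker" and y: "Poly_Mapping.keys y \<subseteq> pairs"
  shows "cls (frag_bil x y) = \<zero>\<^bsub>P\<^esub>"
  using y
proof (rule free_Abelian_group_induct)
  fix q assume q: "q \<in> pairs"
  interpret h: tensor_hom R M1 N1 P1 P "\<lambda>a b. pure (fst (u (a, b) q)) (snd (u (a, b) q))"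
    by unfold_locales (rule left_balanced[OF q])
  have "cls (frag_bil z (frag_of q)) = h.frag_lift z" if "Poly_Mapping.keys z \<subseteq> T1.pairs" for z
    using that
  proof (rule free_Abelian_group_induct)
    show "cls (frag_bil 0 (frag_of q)) = h.frag_lift 0"
      by (simp add: frag_bil_zero_left cls_zero h.frag_lift_zero)
    show "cls (frag_bil (z - z') (frag_of q)) = h.frag_lift (z - z')"
      if "Poly_Mapping.keys z \<subseteq> T1.pairs" "Poly_Mapping.keys z' \<subseteq> T1.pairs"
        "cls (frag_bil z (frag_of q)) = h.frag_lift z" "cls (frag_bil z' (frag_of q)) = h.frag_lift z'" for z z'
      using that q cls_diff[OF keys_frag_bil keys_frag_bil, of z "frag_of q" z' "frag_of q"]
      by (simp add: frag_bil_diff_left h.frag_lift_diff)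
    show "cls (frag_bil (frag_of p) (frag_of q)) = h.frag_lift (frag_of p)" if "p \<in> T1.pairs" for p
      using that by (simp add: h.frag_lift_of) (simp add: frag_bil_def pure_tensor_def)
  qed
  then show "cls (frag_bil x (frag_of q)) = \<zero>\<^bsub>P\<^esub>"
    using x T1.kernel_keys h.frag_lift_kernel by simp
next
  fix y y' assume *: "Poly_Mapping.keys y \<subseteq> pairs" "Poly_Mapping.keys y' \<subseteq> pairs"
    "cls (frag_bil x y) = \<zero>\<^bsub>P\<^esub>" "cls (frag_bil x y') = \<zero>\<^bsub>P\<^esub>"
  then show "cls (frag_bil x (y - y')) = \<zero>\<^bsub>P\<^esub>"
    using cls_diff[OF keys_frag_bil keys_frag_bil, of x y x y'] T1.kernel_keys[OF x]
    by (simp add: frag_bil_diff_right a_minus_def)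
qed (simp add: frag_bil_zero_right cls_zero)

lemma frag_bil_kernel_right:
  assumes x: "Poly_Mapping.keys x \<subseteq> T1.pairs" and y: "y \<in> Ker"
  shows "cls (frag_bil x y) = \<zero>\<^bsub>P\<^esub>"
  using x
proof (rule free_Abelian_group_induct)
  fix p assume p: "p \<in> T1.pairs"
  interpret h: tensor_hom R M N P P "\<lambda>a b. pure (fst (u p (a, b))) (snd (u p (a, b)))"
    by unfold_locales (rule right_balanced[OF p])
  have "cls (frag_bil (frag_of p) z) = h.frag_lift z" if "Poly_Mapping.keys z \<subseteq> pairs" for z
    using that
  proof (rule free_Abelian_group_induct)
    show "cls (frag_bil (frag_of p) 0) = h.frag_lift 0"
      by (simp add: frag_bil_zero_right cls_zero h.frag_lift_zero)
    show "cls (frag_bil (frag_of p) (z - z')) = h.frag_lift (z - z')"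
      if "Poly_Mapping.keys z \<subseteq> pairs" "Poly_Mapping.keys z' \<subseteq> pairs"
        "cls (frag_bil (frag_of p) z) = h.frag_lift z" "cls (frag_bil (frag_of p) z') = h.frag_lift z'" for z z'
      using that p cls_diff[OF keys_frag_bil keys_frag_bil, of "frag_of p" z "frag_of p" z']
      by (simp add: frag_bil_diff_right h.frag_lift_diff)
    show "cls (frag_bil (frag_of p) (frag_of q)) = h.frag_lift (frag_of q)" if "q \<in> pairs" for q
      using that by (simp add: h.frag_lift_of) (simp add: frag_bil_def pure_tensor_def)
  qed
  then show "cls (frag_bil (frag_of p) y) = \<zero>\<^bsub>P\<^esub>"
    using y kernel_keys h.frag_lift_kernel by simp
next
  fix x x' assume *: "Poly_Mapping.keys x \<subseteq> T1.pairs" "Poly_Mapping.keys x' \<subseteq> T1.pairs"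
    "cls (frag_bil x y) = \<zero>\<^bsub>P\<^esub>" "cls (frag_bil x' y) = \<zero>\<^bsub>P\<^esub>"
  then show "cls (frag_bil (x - x') y) = \<zero>\<^bsub>P\<^esub>"
    using cls_diff[OF keys_frag_bil keys_frag_bil, of x y x' y] kernel_keys[OF y]
    by (simp add: frag_bil_diff_left a_minus_def)
qed (simp add: frag_bil_zero_left cls_zero)

lemma frag_bil_add_left: "frag_bil (x + x') y = frag_bil x y + frag_bil x' y"
  by (simp add: frag_bil_def frag_extend_add)

lemma frag_bil_add_right: "frag_bil x (y + y') = frag_bil x y + frag_bil x y'"
  using frag_bil_diff_right[of x "y + y'" y'] by (simp add: algebra_simps)

lemma tensor_action_cls:
  assumes x: "Poly_Mapping.keys x \<subseteq> T1.pairs" and y: "Poly_Mapping.keys y \<subseteq> pairs"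
  shows "tensor_action R M N u (T1.cls x) (cls y) = cls (frag_bil x y)"
proof -
  have "cls (frag_bil x' y') = cls (frag_bil x y)" if "x' \<in> T1.cls x" "y' \<in> cls y" for x' y'
  proof -
    have *: "x' - x \<in> T1.Ker" "y' - y \<in> Ker" and x': "Poly_Mapping.keys x' \<subseteq> T1.pairs"
      using that x y T1.mem_cls mem_cls T1.mem_cls_keys by auto
    \<comment> \<open>Changing one argument at a time leaves two error terms, each with one argument
      in a kernel.\<close>
    have "frag_bil x' y' = frag_bil x' (y' - y) + (frag_bil (x' - x) y + frag_bil x y)"
      by (simp add: frag_bil_diff_left frag_bil_diff_right)
    also have "cls \<dots> = cls (frag_bil x' (y' - y)) \<oplus>\<^bsub>P\<^esub> (cls (frag_bil (x' - x) y) \<oplus>\<^bsub>P\<^esub> cls (frag_bil x y))"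
      using cls_add[OF keys_frag_bil[OF x' kernel_keys[OF *(2)]]
          keys_add_pairs[OF keys_frag_bil[OF T1.kernel_keys[OF *(1)] y] keys_frag_bil[OF x y]]]
        cls_add[OF keys_frag_bil[OF T1.kernel_keys[OF *(1)] y] keys_frag_bil[OF x y]]
      by simp
    also have "\<dots> = cls (frag_bil x y)"
      using frag_bil_kernel_left[OF *(1) y] frag_bil_kernel_right[OF x' *(2)] keys_frag_bil[OF x y] by simp
    finally show ?thesis .
  qed
  then have "(\<lambda>(x, y). cls (frag_bil x y)) ` (T1.cls x \<times> cls y)
      = (\<lambda>_. cls (frag_bil x y)) ` (T1.cls x \<times> cls y)"
    by (intro image_cong refl) (clarsimp simp only: mem_Times_iff fst_conv snd_conv split: prod.splits)
  also have "\<dots> = {cls (frag_bil x y)}"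
    using T1.cls_self[OF x] cls_self[OF y] by (intro image_constant[of "(x, y)"]) simp
  finally have "(\<lambda>(x, y). cls (frag_bil x y)) ` (T1.cls x \<times> cls y) = {cls (frag_bil x y)}" .
  then show ?thesis
    unfolding tensor_action_def frag_bil_def[abs_def] by simp
qed

abbreviation "act \<equiv> tensor_action R M N u"

lemma act_closed [simp]: "U \<in> carrier P1 \<Longrightarrow> V \<in> carrier P \<Longrightarrow> act U V \<in> carrier P"
  by (elim T1.carrier_PE carrier_PE) (simp add: tensor_action_cls keys_frag_bil)

lemma act_pure:
  assumes "a \<in> carrier M1" "b \<in> carrier N1" "c \<in> carrier M" "d \<in> carrier N"
  shows "act (T1.pure a b) (pure c d) = pure (fst (u (a, b) (c, d))) (snd (u (a, b) (c, d)))"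
  using tensor_action_cls[of "frag_of (a, b)" "frag_of (c, d)"] assms
  by (simp add: pure_tensor_def frag_bil_def)

lemma act_add_left:
  assumes "U \<in> carrier P1" "U' \<in> carrier P1" "V \<in> carrier P"
  shows "act (U \<oplus>\<^bsub>P1\<^esub> U') V = act U V \<oplus>\<^bsub>P\<^esub> act U' V"
proof -
  obtain x x' y where *: "Poly_Mapping.keys x \<subseteq> T1.pairs" "U = T1.cls x"
      "Poly_Mapping.keys x' \<subseteq> T1.pairs" "U' = T1.cls x'" "Poly_Mapping.keys y \<subseteq> pairs" "V = cls y"
    using T1.carrier_PE[OF assms(1)] T1.carrier_PE[OF assms(2)] carrier_PE[OF assms(3)] by metis
  then show ?thesis
    using T1.keys_add_pairs[of x x'] keys_frag_bil
    by (simp add: T1.cls_add[symmetric] tensor_action_cls frag_bil_add_left cls_add)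
qed

lemma act_add_right:
  assumes "U \<in> carrier P1" "V \<in> carrier P" "V' \<in> carrier P"
  shows "act U (V \<oplus>\<^bsub>P\<^esub> V') = act U V \<oplus>\<^bsub>P\<^esub> act U V'"
proof -
  obtain x y y' where *: "Poly_Mapping.keys x \<subseteq> T1.pairs" "U = T1.cls x"
      "Poly_Mapping.keys y \<subseteq> pairs" "V = cls y" "Poly_Mapping.keys y' \<subseteq> pairs" "V' = cls y'"
    using T1.carrier_PE[OF assms(1)] carrier_PE[OF assms(2)] carrier_PE[OF assms(3)] by metis
  have "act U (V \<oplus>\<^bsub>P\<^esub> V') = cls (frag_bil x (y + y'))"
    using * keys_add_pairs[of y y'] by (simp add: tensor_action_cls flip: cls_add)
  also have "\<dots> = act U V \<oplus>\<^bsub>P\<^esub> act U V'"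
    using * keys_frag_bil by (simp add: tensor_action_cls frag_bil_add_right cls_add)
  finally show ?thesis .
qed

end

section \<open>Polynomial rings\<close>

definition (in ring) indexed_monom :: "'a \<Rightarrow> 'i multiset \<Rightarrow> 'i multiset \<Rightarrow> 'a" where
  "indexed_monom c e = (\<lambda>m. if m = e then c else \<zero>)"

context ring
begin

lemma indexed_monom_pset:
  fixes e :: "'i multiset"
  assumes "c \<in> K" "set_mset e \<subseteq> I"
  shows "indexed_monom c e \<in> indexed_pset I K"
  using assms(2)
proof (induction e)
  case empty
  have "indexed_monom c ({#} :: 'i multiset) = indexed_const c"
    by (auto simp: indexed_monom_def indexed_const_def)
  then show ?case
    using assms(1) by (simp add: indexed_pset.indexed_const)
next
  case (add i e)
  have "indexed_monom c (add_mset i e) = indexed_pmult (indexed_monom c e) i"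
    by (auto simp: indexed_monom_def indexed_pmult_def fun_eq_iff dest: insert_DiffM)
  then show ?case
    using add by (simp add: indexed_pset.indexed_pmult)
qed

text \<open>The support is emptied one monomial at a time. Membership is proved along with
  \<open>Q\<close>, so that this serves both for the coefficientwise description of polynomials and
  for induction over them.\<close>

lemma finite_support_induct [consumes 3, case_names monom add]:
  assumes "finite {m. p m \<noteq> \<zero>}" "\<And>m. p m \<in> carrier R" "\<And>m. p m \<noteq> \<zero> \<Longrightarrow> set_mset m \<subseteq> I"
    and monom: "\<And>c e. c \<in> carrier R \<Longrightarrow> set_mset e \<subseteq> I \<Longrightarrow> Q (indexed_monom c e)"
    and add: "\<And>p c e. \<lbrakk>\<And>m. p m \<in> carrier R; p \<in> indexed_pset I (carrier R); Q p; c \<in> carrier R; set_mset e \<subseteq> I\<rbrakk> \<Longrightarrow>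
      Q (indexed_padd (indexed_monom c e) p)"
  shows "p \<in> indexed_pset I (carrier R) \<and> Q p"
proof -
  have "p \<in> indexed_pset I (carrier R) \<and> Q p"
    if "finite B" "{m. p m \<noteq> \<zero>} \<subseteq> B" "\<And>m. p m \<in> carrier R" "\<And>m. p m \<noteq> \<zero> \<Longrightarrow> set_mset m \<subseteq> I" for B p
    using that
  proof (induction B arbitrary: p rule: finite_induct)
    case empty
    then have "p = indexed_monom \<zero> {#}"
      by (auto simp: indexed_monom_def)
    then show ?case
      using monom[of \<zero> "{#}"] indexed_monom_pset[of \<zero> "carrier R" "{#}" I] by simp
  next
    case (insert b B)
    define q where "q = p(b := \<zero>)"
    have q: "q \<in> indexed_pset I (carrier R) \<and> Q q"
      using insert.prems by (intro insert.IH) (auto simp: q_def split: if_splits)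
    show ?case
    proof (cases "p b = \<zero>")
      case True
      then have "q = p"
        by (simp add: q_def fun_eq_iff)
      with q show ?thesis by simp
    next
      case False
      have "p = indexed_padd (indexed_monom (p b) b) q"
        using insert.prems by (auto simp: q_def indexed_padd_def indexed_monom_def)
      moreover have "q m \<in> carrier R" for m
        using insert.prems by (simp add: q_def)
      moreover have "p b \<in> carrier R" "set_mset b \<subseteq> I"
        using insert.prems False by auto
      ultimately show ?thesis
        using q add[of q "p b" b] indexed_monom_pset[of "p b" "carrier R" b I] indexed_pset.indexed_padd by metis
    qed
  qed
  from this[OF assms(1) subset_refl] show ?thesis
    using assms(2,3) by blast
qed

text \<open>Replaces the inductive generation of polynomials by finitely supported coefficient
  functions, on which the ring laws can be checked coefficient by coefficient.\<close>

lemma indexed_pset_iff: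
  "p \<in> indexed_pset I (carrier R) \<longleftrightarrow>
     finite {m. p m \<noteq> \<zero>} \<and> (\<forall>m. p m \<in> carrier R) \<and> (\<forall>m. p m \<noteq> \<zero> \<longrightarrow> set_mset m \<subseteq> I)"
proof
  assume "p \<in> indexed_pset I (carrier R)"
  then show "finite {m. p m \<noteq> \<zero>} \<and> (\<forall>m. p m \<in> carrier R) \<and> (\<forall>m. p m \<noteq> \<zero> \<longrightarrow> set_mset m \<subseteq> I)"
  proof (induction rule: indexed_pset.induct)
    case (indexed_const c)
    have "{m. indexed_const c m \<noteq> \<zero>} \<subseteq> {{#}}"
      by (auto simp: indexed_const_def)
    then show ?case
      using indexed_const by (auto simp: indexed_const_def dest: finite_subset)
  next
    case (indexed_padd p q)
    then have "{m. indexed_padd p q m \<noteq> \<zero>} \<subseteq> {m. p m \<noteq> \<zero>} \<union> {m. q m \<noteq> \<zero>}"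
      by (auto simp: indexed_padd_def)
    moreover have "finite ({m. p m \<noteq> \<zero>} \<union> {m. q m \<noteq> \<zero>})"
      using indexed_padd by simp
    ultimately have "finite {m. indexed_padd p q m \<noteq> \<zero>}"
      by (rule finite_subset)
    moreover have "set_mset m \<subseteq> I" if "indexed_padd p q m \<noteq> \<zero>" for m
      using that indexed_padd by (cases "p m = \<zero>"; cases "q m = \<zero>") (auto simp: indexed_padd_def)
    ultimately show ?case
      using indexed_padd by (simp add: indexed_padd_def)
  next
    case (indexed_pmult p i)
    have "{m. indexed_pmult p i m \<noteq> \<zero>} \<subseteq> add_mset i ` {m. p m \<noteq> \<zero>}"
      by (auto simp: indexed_pmult_def image_iff split: if_splits intro!: exI[of _ "_ - {#i#}"])
    moreover have "finite (add_mset i ` {m. p m \<noteq> \<zero>})"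
      using indexed_pmult by simp
    ultimately have "finite {m. indexed_pmult p i m \<noteq> \<zero>}"
      by (rule finite_subset)
    moreover have "set_mset m \<subseteq> I" if "indexed_pmult p i m \<noteq> \<zero>" for m
    proof -
      have m: "i \<in># m" "p (m - {#i#}) \<noteq> \<zero>"
        using that by (auto simp: indexed_pmult_def split: if_splits)
      then have "set_mset (m - {#i#}) \<subseteq> I"
        using indexed_pmult by blast
      moreover have "set_mset m = insert i (set_mset (m - {#i#}))"
        using m(1) by (metis insert_DiffM set_mset_add_mset_insert)
      ultimately show ?thesis
        using indexed_pmult by simp
    qed
    ultimately show ?case
      using indexed_pmult by (simp add: indexed_pmult_def)
  qed
next
  assume "finite {m. p m \<noteq> \<zero>} \<and> (\<forall>m. p m \<in> carrier R) \<and> (\<forall>m. p m \<noteq> \<zero> \<longrightarrow> set_mset m \<subseteq> I)"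
  then show "p \<in> indexed_pset I (carrier R)"
    using finite_support_induct[of p I "\<lambda>_. True"] by blast
qed

end

lemma finsum_submultisets:
  assumes "abelian_monoid G" "\<And>n. n \<subseteq># m \<Longrightarrow> f n (m - n) \<in> carrier G"
  shows "(\<Oplus>\<^bsub>G\<^esub>n\<in>{n. n \<subseteq># m}. f n (m - n)) = (\<Oplus>\<^bsub>G\<^esub>s\<in>splits m. f (fst s) (snd s))"
proof -
  interpret abelian_monoid G by fact
  have eq: "splits m = (\<lambda>n. (n, m - n)) ` {n. n \<subseteq># m}"
    by (force simp: image_iff)
  show ?thesis
    unfolding eq by (subst finsum_reindex) (use assms(2) in \<open>auto simp: inj_on_def\<close>)
qed

locale indexed_poly = cring R for R :: "('r, 'x) ring_scheme" (structure) +
  fixes I :: "'i set" and L :: "('r, 'i multiset \<Rightarrow> 'r) module"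
  assumes L_def: "L = indexed_poly_ring R I"
begin

lemma carrier_L: "p \<in> carrier L \<longleftrightarrow>
     finite {m. p m \<noteq> \<zero>} \<and> (\<forall>m. p m \<in> carrier R) \<and> (\<forall>m. p m \<noteq> \<zero> \<longrightarrow> set_mset m \<subseteq> I)"
  by (simp add: L_def indexed_poly_ring_def indexed_pset_iff)

lemma L_coeff [simp]: "p \<in> carrier L \<Longrightarrow> p m \<in> carrier R"
  by (simp add: carrier_L)

lemma add_L [simp]: "(p \<oplus>\<^bsub>L\<^esub> q) m = p m \<oplus> q m"
  by (simp add: L_def indexed_poly_ring_def indexed_padd_def)

lemma zero_L [simp]: "\<zero>\<^bsub>L\<^esub> m = \<zero>"
  by (simp add: L_def indexed_poly_ring_def indexed_zero_def)

lemma one_L: "\<one>\<^bsub>L\<^esub> m = (if m = {#} then \<one> else \<zero>)"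
  by (simp add: L_def indexed_poly_ring_def indexed_const_def)

lemma smult_L [simp]: "(c \<odot>\<^bsub>L\<^esub> p) m = c \<otimes> p m"
  by (simp add: L_def indexed_poly_ring_def)

lemma mult_L:
  "p \<in> carrier L \<Longrightarrow> q \<in> carrier L \<Longrightarrow> (p \<otimes>\<^bsub>L\<^esub> q) m = (\<Oplus>s\<in>splits m. p (fst s) \<otimes> q (snd s))"
  by (simp add: L_def[unfolded indexed_poly_ring_def] carrier_L[unfolded L_def indexed_poly_ring_def, simplified]
      finsum_submultisets[OF abelian_monoid_axioms, of m "\<lambda>a b. p a \<otimes> q b"])

lemma add_closed_L: "p \<in> carrier L \<Longrightarrow> q \<in> carrier L \<Longrightarrow> p \<oplus>\<^bsub>L\<^esub> q \<in> carrier L"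
  by (simp add: L_def indexed_poly_ring_def indexed_pset.indexed_padd)

lemma mult_closed_L:
  assumes p: "p \<in> carrier L" and q: "q \<in> carrier L"
  shows "p \<otimes>\<^bsub>L\<^esub> q \<in> carrier L"
proof -
  let ?S = "(\<lambda>(a, b). a + b) ` ({m. p m \<noteq> \<zero>} \<times> {m. q m \<noteq> \<zero>})"
  have supp: "m \<in> ?S" if "(p \<otimes>\<^bsub>L\<^esub> q) m \<noteq> \<zero>" for m
  proof -
    have "\<exists>s\<in>splits m. p (fst s) \<otimes> q (snd s) \<noteq> \<zero>"
      using that add.finprod_one_eqI[of "splits m" "\<lambda>s. p (fst s) \<otimes> q (snd s)"]
      unfolding mult_L[OF p q] by blast
    then obtain s where s: "fst s + snd s = m" "p (fst s) \<otimes> q (snd s) \<noteq> \<zero>"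
      by auto
    then have "p (fst s) \<noteq> \<zero>" "q (snd s) \<noteq> \<zero>"
      using p q by auto
    then show ?thesis
      using s(1) by (intro image_eqI[of _ _ s]) (auto simp: mem_Times_iff case_prod_unfold)
  qed
  have "finite ?S"
    using p q by (simp add: carrier_L)
  then have "finite {m. (p \<otimes>\<^bsub>L\<^esub> q) m \<noteq> \<zero>}"
    by (rule rev_finite_subset) (use supp in blast)
  moreover have "set_mset m \<subseteq> I" if "(p \<otimes>\<^bsub>L\<^esub> q) m \<noteq> \<zero>" for m
    using supp[OF that] p q unfolding carrier_L by fastforce
  moreover have "(p \<otimes>\<^bsub>L\<^esub> q) m \<in> carrier R" for m
    using p q by (auto simp: mult_L intro!: finsum_closed)
  ultimately show ?thesis
    by (simp add: carrier_L)
qed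

lemma smult_closed_L:
  assumes "c \<in> carrier R" "p \<in> carrier L"
  shows "c \<odot>\<^bsub>L\<^esub> p \<in> carrier L"
proof -
  have "{m. c \<otimes> p m \<noteq> \<zero>} \<subseteq> {m. p m \<noteq> \<zero>}"
    using assms by auto
  then have "finite {m. c \<otimes> p m \<noteq> \<zero>}"
    using assms finite_subset by (auto simp: carrier_L)
  moreover have "p m \<noteq> \<zero>" if "c \<otimes> p m \<noteq> \<zero>" for m
    using assms that by auto
  ultimately show ?thesis
    using assms unfolding carrier_L smult_L by auto
qed

lemma cring_L: "cring L"
proof (rule cringI)
  show "abelian_group L"
  proof (rule abelian_groupI)
    show "\<zero>\<^bsub>L\<^esub> \<in> carrier L"
      by (simp add: carrier_L)
    show "\<exists>q\<in>carrier L. q \<oplus>\<^bsub>L\<^esub> p = \<zero>\<^bsub>L\<^esub>" if p: "p \<in> carrier L" for p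
    proof
      have "\<ominus> x = \<zero> \<longleftrightarrow> x = \<zero>" if "x \<in> carrier R" for x
        using that by (metis minus_minus minus_zero)
      then show "(\<lambda>m. \<ominus> p m) \<in> carrier L"
        using p by (simp add: carrier_L)
      show "(\<lambda>m. \<ominus> p m) \<oplus>\<^bsub>L\<^esub> p = \<zero>\<^bsub>L\<^esub>"
        using p by (simp add: fun_eq_iff l_neg)
    qed
  qed (simp_all add: fun_eq_iff a_ac add_closed_L)
  show "comm_monoid L"
  proof (rule comm_monoidI)
    show "\<one>\<^bsub>L\<^esub> \<in> carrier L"
      by (simp add: carrier_L one_L)
    fix p q r assume pqr: "p \<in> carrier L" "q \<in> carrier L" "r \<in> carrier L"
    show "p \<otimes>\<^bsub>L\<^esub> q \<otimes>\<^bsub>L\<^esub> r = p \<otimes>\<^bsub>L\<^esub> (q \<otimes>\<^bsub>L\<^esub> r)"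
    proof
      fix m
      have "(p \<otimes>\<^bsub>L\<^esub> q \<otimes>\<^bsub>L\<^esub> r) m
          = (\<Oplus>s\<in>splits m. \<Oplus>t\<in>splits (fst s). p (fst t) \<otimes> q (snd t) \<otimes> r (snd s))"
        using pqr by (simp add: mult_L mult_closed_L finsum_ldistr Pi_def)
      also have "\<dots> = (\<Oplus>s\<in>splits m. \<Oplus>t\<in>splits (snd s). p (fst s) \<otimes> q (fst t) \<otimes> r (snd t))"
        using pqr by (intro finsum_splits_assoc) auto
      also have "\<dots> = (p \<otimes>\<^bsub>L\<^esub> (q \<otimes>\<^bsub>L\<^esub> r)) m"
        using pqr by (simp add: mult_L mult_closed_L finsum_rdistr Pi_def m_assoc)
      finally show "(p \<otimes>\<^bsub>L\<^esub> q \<otimes>\<^bsub>L\<^esub> r) m = (p \<otimes>\<^bsub>L\<^esub> (q \<otimes>\<^bsub>L\<^esub> r)) m" .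
    qed
  next
    fix p assume p: "p \<in> carrier L"
    have one: "\<one>\<^bsub>L\<^esub> \<in> carrier L"
      by (simp add: carrier_L one_L)
    show "\<one>\<^bsub>L\<^esub> \<otimes>\<^bsub>L\<^esub> p = p"
    proof
      fix m
      have "(\<one>\<^bsub>L\<^esub> \<otimes>\<^bsub>L\<^esub> p) m = \<one>\<^bsub>L\<^esub> 0 \<otimes> p m"
        unfolding mult_L[OF one p] using p by (intro finsum_splits_left) (auto simp: one_L)
      then show "(\<one>\<^bsub>L\<^esub> \<otimes>\<^bsub>L\<^esub> p) m = p m"
        using p by (simp add: one_L)
    qed
  next
    fix p q assume pq: "p \<in> carrier L" "q \<in> carrier L"
    then show "p \<otimes>\<^bsub>L\<^esub> q \<in> carrier L"
      by (rule mult_closed_L)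
    show "p \<otimes>\<^bsub>L\<^esub> q = q \<otimes>\<^bsub>L\<^esub> p"
    proof
      fix m
      have "(p \<otimes>\<^bsub>L\<^esub> q) m = (\<Oplus>s\<in>splits m. p (snd s) \<otimes> q (fst s))"
        unfolding mult_L[OF pq] using pq by (intro finsum_splits_swap) auto
      then show "(p \<otimes>\<^bsub>L\<^esub> q) m = (q \<otimes>\<^bsub>L\<^esub> p) m"
        using pq by (simp add: mult_L m_comm cong: finsum_cong)
    qed
  qed
  fix p q r assume pqr: "p \<in> carrier L" "q \<in> carrier L" "r \<in> carrier L"
  show "(p \<oplus>\<^bsub>L\<^esub> q) \<otimes>\<^bsub>L\<^esub> r = p \<otimes>\<^bsub>L\<^esub> r \<oplus>\<^bsub>L\<^esub> q \<otimes>\<^bsub>L\<^esub> r"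
    using pqr by (simp add: fun_eq_iff mult_L add_closed_L l_distr finsum_addf Pi_def)
qed

lemma algebra_L: "algebra R L"
proof (rule algebraI)
  fix c p q assume *: "c \<in> carrier R" "p \<in> carrier L" "q \<in> carrier L"
  have "c \<otimes> (\<Oplus>s\<in>splits m. p (fst s) \<otimes> q (snd s)) = (\<Oplus>s\<in>splits m. c \<otimes> p (fst s) \<otimes> q (snd s))" for m
    using * by (simp add: finsum_rdistr Pi_def m_assoc)
  then show "(c \<odot>\<^bsub>L\<^esub> p) \<otimes>\<^bsub>L\<^esub> q = c \<odot>\<^bsub>L\<^esub> (p \<otimes>\<^bsub>L\<^esub> q)"
    using * by (simp add: fun_eq_iff mult_L smult_closed_L)
qed (auto simp: fun_eq_iff cring_L smult_closed_L l_distr r_distr m_assoc is_cring)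

lemma monom_closed: "c \<in> carrier R \<Longrightarrow> set_mset e \<subseteq> I \<Longrightarrow> indexed_monom c e \<in> carrier L"
  by (simp add: L_def indexed_poly_ring_def indexed_monom_pset)

lemma monom_smult: "c \<in> carrier R \<Longrightarrow> indexed_monom c e = c \<odot>\<^bsub>L\<^esub> indexed_monom \<one> e"
  by (simp add: fun_eq_iff) (simp add: indexed_monom_def)

lemma poly_induct [consumes 1, case_names monom add]:
  assumes "p \<in> carrier L"
    and monom: "\<And>c e. c \<in> carrier R \<Longrightarrow> set_mset e \<subseteq> I \<Longrightarrow> Q (indexed_monom c e)"
    and add: "\<And>p q. \<lbrakk>p \<in> carrier L; q \<in> carrier L; Q p; Q q\<rbrakk> \<Longrightarrow> Q (p \<oplus>\<^bsub>L\<^esub> q)"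
  shows "Q p"
proof -
  have "p \<in> indexed_pset I (carrier R) \<and> Q p"
  proof (rule finite_support_induct)
    fix p c e assume "p \<in> indexed_pset I (carrier R)" "Q p" "c \<in> carrier R" "set_mset e \<subseteq> I"
    then show "Q (indexed_padd (indexed_monom c e) p)"
      using add[of "indexed_monom c e" p] monom[of c e] monom_closed[of c e]
      by (simp add: L_def indexed_poly_ring_def)
  qed (use assms(1) monom in \<open>auto simp: carrier_L\<close>)
  then show ?thesis ..
qed

end

section \<open>Base change of algebras and modules\<close>

locale base_change_algebras = L: calg k L + calg k A
  for k :: "('k, 'x) ring_scheme" and L :: "('k, 'l, 'u) module_scheme"
    and A :: "('k, 'a, 'y) module_scheme" (structure)
begin

abbreviation "AL \<equiv> base_change k L A"

lemma tensor_space_AL: "tensor_space k L A AL"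
  using L.A.module_axioms A.module_axioms
  by (intro tensor_space.intro) (simp_all add: base_change_def)

end

sublocale base_change_algebras \<subseteq> T: tensor_space k L A "base_change k L A"
  by (rule tensor_space_AL)

context base_change_algebras
begin

abbreviation "pt \<equiv> pure_tensor k L A"

lemma tensor_bilinear_mult:
  "tensor_bilinear k L A AL L A AL (\<lambda>(c, a) (d, b). (c \<otimes>\<^bsub>L\<^esub> d, a \<otimes> b))"
proof (intro tensor_bilinear.intro tensor_space_AL tensor_bilinear_axioms.intro)
  fix q assume "q \<in> carrier L \<times> carrier A"
  then obtain d b where q: "q = (d, b)" "d \<in> carrier L" "b \<in> carrier A"
    by auto
  show "balanced_map k L A AL (\<lambda>c a. pt (fst ((\<lambda>(c, a) (d, b). (c \<otimes>\<^bsub>L\<^esub> d, a \<otimes> b)) (c, a) q))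
      (snd ((\<lambda>(c, a) (d, b). (c \<otimes>\<^bsub>L\<^esub> d, a \<otimes> b)) (c, a) q)))"
    using q by (simp add: balanced_map_def L.A.l_distr A.l_distr T.pure_add_left T.pure_add_right
        L.smult_mult_left smult_mult_left T.pure_smult)
  show "balanced_map k L A AL (\<lambda>c a. pt (fst ((\<lambda>(c, a) (d, b). (c \<otimes>\<^bsub>L\<^esub> d, a \<otimes> b)) q (c, a)))
      (snd ((\<lambda>(c, a) (d, b). (c \<otimes>\<^bsub>L\<^esub> d, a \<otimes> b)) q (c, a))))"
    using q by (simp add: balanced_map_def L.A.r_distr A.r_distr T.pure_add_left T.pure_add_right
        L.smult_mult_right smult_mult_right T.pure_smult)
qed auto

end

sublocale base_change_algebras \<subseteq> B: tensor_bilinear k L A "base_change k L A" L A "base_change k L A"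
  "\<lambda>(c, a) (d, b). (c \<otimes>\<^bsub>L\<^esub> d, a \<otimes>\<^bsub>A\<^esub> b)"
  by (rule tensor_bilinear_mult)

context base_change_algebras
begin

lemma mult_AL: "monoid.mult AL = B.act"
  by (simp add: base_change_def base_change_mult_def)

lemma smult_AL: "c \<odot>\<^bsub>AL\<^esub> U = pt c \<one> \<otimes>\<^bsub>AL\<^esub> U"
  by (simp add: base_change_def)

lemma one_AL: "\<one>\<^bsub>AL\<^esub> = pt \<one>\<^bsub>L\<^esub> \<one>"
  by (simp add: base_change_def)

lemma mult_pure [simp]:
  "\<lbrakk>c \<in> carrier L; a \<in> carrier A; d \<in> carrier L; b \<in> carrier A\<rbrakk> \<Longrightarrow>
    pt c a \<otimes>\<^bsub>AL\<^esub> pt d b = pt (c \<otimes>\<^bsub>L\<^esub> d) (a \<otimes> b)"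
  using B.act_pure[of c a d b] by (simp add: mult_AL)

lemma mult_closed_AL [simp]: "U \<in> carrier AL \<Longrightarrow> V \<in> carrier AL \<Longrightarrow> U \<otimes>\<^bsub>AL\<^esub> V \<in> carrier AL"
  by (simp add: mult_AL)

lemma mult_add_left:
  "\<lbrakk>U \<in> carrier AL; U' \<in> carrier AL; V \<in> carrier AL\<rbrakk> \<Longrightarrow>
    (U \<oplus>\<^bsub>AL\<^esub> U') \<otimes>\<^bsub>AL\<^esub> V = U \<otimes>\<^bsub>AL\<^esub> V \<oplus>\<^bsub>AL\<^esub> U' \<otimes>\<^bsub>AL\<^esub> V"
  by (simp add: mult_AL B.act_add_left)

lemma mult_add_right:
  "\<lbrakk>U \<in> carrier AL; V \<in> carrier AL; V' \<in> carrier AL\<rbrakk> \<Longrightarrow>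
    U \<otimes>\<^bsub>AL\<^esub> (V \<oplus>\<^bsub>AL\<^esub> V') = U \<otimes>\<^bsub>AL\<^esub> V \<oplus>\<^bsub>AL\<^esub> U \<otimes>\<^bsub>AL\<^esub> V'"
  by (simp add: mult_AL B.act_add_right)

text \<open>As the product is additive in each argument, this identity, like associativity below,
  only needs to be checked on pure tensors, where it holds in both components.\<close>

lemma mult_comm_AL: "U \<in> carrier AL \<Longrightarrow> V \<in> carrier AL \<Longrightarrow> U \<otimes>\<^bsub>AL\<^esub> V = V \<otimes>\<^bsub>AL\<^esub> U"
proof (induction U rule: T.tensor_induct)
  case (pure c a)
  from pure(3) show ?case
    by (induction V rule: T.tensor_induct)
      (use pure in \<open>simp_all add: mult_add_left mult_add_right L.A.m_comm A.m_comm\<close>)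
qed (simp add: mult_add_left mult_add_right)

lemma mult_assoc_AL:
  assumes "U \<in> carrier AL" "V \<in> carrier AL" "W \<in> carrier AL"
  shows "U \<otimes>\<^bsub>AL\<^esub> V \<otimes>\<^bsub>AL\<^esub> W = U \<otimes>\<^bsub>AL\<^esub> (V \<otimes>\<^bsub>AL\<^esub> W)"
  using assms(1)
proof (induction U rule: T.tensor_induct)
  case (pure c a)
  note ca = pure
  from assms(2) show ?case
  proof (induction V rule: T.tensor_induct)
    case (pure d b)
    from assms(3) show ?case
      by (induction W rule: T.tensor_induct)
        (use pure ca in \<open>simp_all add: mult_add_right L.A.m_assoc A.m_assoc\<close>)
  qed (use assms ca in \<open>simp add: mult_add_left mult_add_right\<close>)
qed (use assms in \<open>simp add: mult_add_left\<close>)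

lemma mult_one_AL: "U \<in> carrier AL \<Longrightarrow> \<one>\<^bsub>AL\<^esub> \<otimes>\<^bsub>AL\<^esub> U = U"
  by (induction U rule: T.tensor_induct) (simp_all add: one_AL mult_add_right)

lemma cring_AL: "cring AL"
proof (rule cringI)
  show "comm_monoid AL"
    by (rule comm_monoidI, erule (1) mult_closed_AL, simp add: one_AL, erule (2) mult_assoc_AL,
        erule mult_one_AL, erule (1) mult_comm_AL)
qed (simp_all add: T.abelian_group_P mult_add_left)

lemma algebra_AL: "algebra L AL"
proof (rule algebraI)
  fix c d U V assume *: "c \<in> carrier L" "d \<in> carrier L" "U \<in> carrier AL" "V \<in> carrier AL"
  then show "c \<odot>\<^bsub>AL\<^esub> U \<in> carrier AL" "c \<odot>\<^bsub>AL\<^esub> (U \<oplus>\<^bsub>AL\<^esub> V) = c \<odot>\<^bsub>AL\<^esub> U \<oplus>\<^bsub>AL\<^esub> c \<odot>\<^bsub>AL\<^esub> V"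
    "(c \<odot>\<^bsub>AL\<^esub> U) \<otimes>\<^bsub>AL\<^esub> V = c \<odot>\<^bsub>AL\<^esub> (U \<otimes>\<^bsub>AL\<^esub> V)"
    "(c \<oplus>\<^bsub>L\<^esub> d) \<odot>\<^bsub>AL\<^esub> U = c \<odot>\<^bsub>AL\<^esub> U \<oplus>\<^bsub>AL\<^esub> d \<odot>\<^bsub>AL\<^esub> U"
    by (simp_all add: smult_AL mult_add_right mult_assoc_AL T.pure_add_left mult_add_left)
  have "pt (c \<otimes>\<^bsub>L\<^esub> d) \<one> = pt c \<one> \<otimes>\<^bsub>AL\<^esub> pt d \<one>"
    using * by simp
  then show "(c \<otimes>\<^bsub>L\<^esub> d) \<odot>\<^bsub>AL\<^esub> U = c \<odot>\<^bsub>AL\<^esub> (d \<odot>\<^bsub>AL\<^esub> U)"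
    using * by (simp add: smult_AL mult_assoc_AL del: mult_pure)
qed (simp_all add: cring_AL L.A.is_cring smult_AL mult_one_AL flip: one_AL)

lemma smult_pure [simp]:
  "\<lbrakk>c \<in> carrier L; d \<in> carrier L; a \<in> carrier A\<rbrakk> \<Longrightarrow> c \<odot>\<^bsub>AL\<^esub> pt d a = pt (c \<otimes>\<^bsub>L\<^esub> d) a"
  by (simp add: smult_AL)

end

sublocale base_change_algebras \<subseteq> AL: calg L "base_change k L A"
  by (rule calg.intro[OF algebra_AL])

section \<open>Base change of a module over \<open>A\<close>\<close>

locale base_change_mod = base_change_algebras k L A + M: module A M
  for k :: "('k, 'x) ring_scheme" and L :: "('k, 'l, 'u) module_scheme"
    and A :: "('k, 'a, 'y) module_scheme" (structure) and M :: "('a, 'm, 'z) module_scheme"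
begin

abbreviation "Mk \<equiv> restrict_scalars A M"
abbreviation "LM \<equiv> base_change_module k L A M"

lemma restrict_scalars_simps [simp]:
  "carrier Mk = carrier M" "add Mk = add M" "ring.zero Mk = ring.zero M"
  "r \<odot>\<^bsub>Mk\<^esub> x = (r \<odot> \<one>) \<odot>\<^bsub>M\<^esub> x"
  by (simp_all add: restrict_scalars_def)

lemma module_Mk: "module k Mk"
proof (rule moduleI)
  show "abelian_group Mk"
  proof (rule abelian_groupI)
    show "\<exists>y\<in>carrier Mk. y \<oplus>\<^bsub>Mk\<^esub> x = \<zero>\<^bsub>Mk\<^esub>" if "x \<in> carrier Mk" for x
      using that by (intro bexI[of _ "\<ominus>\<^bsub>M\<^esub> x"]) (simp_all add: M.M.l_neg)
  qed (simp_all add: M.M.a_ac)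
  fix a b x assume *: "a \<in> carrier k" "b \<in> carrier k" "x \<in> carrier Mk"
  show "(a \<otimes>\<^bsub>k\<^esub> b) \<odot>\<^bsub>Mk\<^esub> x = a \<odot>\<^bsub>Mk\<^esub> (b \<odot>\<^bsub>Mk\<^esub> x)"
    using * by (simp add: M.smult_assoc1[symmetric] smult_mult_left A.smult_assoc1)
qed (simp_all add: L.K.is_cring A.smult_l_distr M.smult_l_distr M.smult_r_distr)

lemma tensor_space_LM: "tensor_space k L Mk LM"
  using L.A.module_axioms module_Mk
  by (intro tensor_space.intro) (simp_all add: base_change_module_def)

end

sublocale base_change_mod \<subseteq> TM: tensor_space k L "restrict_scalars A M" "base_change_module k L A M"
  by (rule tensor_space_LM)

context base_change_mod
begin

abbreviation "pm \<equiv> pure_tensor k L Mk"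

lemma pm_smult: "\<lbrakk>r \<in> carrier k; c \<in> carrier L; x \<in> carrier M\<rbrakk> \<Longrightarrow> pm (r \<odot>\<^bsub>L\<^esub> c) x = pm c ((r \<odot> \<one>) \<odot>\<^bsub>M\<^esub> x)"
  using TM.pure_smult[of r c x] by simp

lemma pm_add_right: "\<lbrakk>c \<in> carrier L; x \<in> carrier M; y \<in> carrier M\<rbrakk> \<Longrightarrow> pm c (x \<oplus>\<^bsub>M\<^esub> y) = pm c x \<oplus>\<^bsub>LM\<^esub> pm c y"
  using TM.pure_add_right[of c x y] by simp

lemma pm_add_left: "\<lbrakk>c \<in> carrier L; d \<in> carrier L; x \<in> carrier M\<rbrakk> \<Longrightarrow> pm (c \<oplus>\<^bsub>L\<^esub> d) x = pm c x \<oplus>\<^bsub>LM\<^esub> pm d x"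
  using TM.pure_add_left[of c d x] by simp

lemma pm_closed [simp]: "c \<in> carrier L \<Longrightarrow> x \<in> carrier M \<Longrightarrow> pm c x \<in> carrier LM"
  using TM.pure_closed[of c x] by simp

lemma tensor_bilinear_smult:
  "tensor_bilinear k L A AL L Mk LM (\<lambda>(c, a) (d, x). (c \<otimes>\<^bsub>L\<^esub> d, a \<odot>\<^bsub>M\<^esub> x))"
proof (intro tensor_bilinear.intro tensor_space_AL tensor_space_LM tensor_bilinear_axioms.intro)
  fix q assume "q \<in> carrier L \<times> carrier Mk"
  then obtain d x where q: "q = (d, x)" "d \<in> carrier L" "x \<in> carrier M"
    by auto
  have "(r \<odot> a) \<odot>\<^bsub>M\<^esub> x = (r \<odot> \<one>) \<odot>\<^bsub>M\<^esub> (a \<odot>\<^bsub>M\<^esub> x)" if "r \<in> carrier k" "a \<in> carrier A" for r a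
    using that q by (simp add: M.smult_assoc1[symmetric] smult_mult_left)
  then show "balanced_map k L A LM (\<lambda>c a. pm (fst ((\<lambda>(c, a) (d, x). (c \<otimes>\<^bsub>L\<^esub> d, a \<odot>\<^bsub>M\<^esub> x)) (c, a) q))
      (snd ((\<lambda>(c, a) (d, x). (c \<otimes>\<^bsub>L\<^esub> d, a \<odot>\<^bsub>M\<^esub> x)) (c, a) q)))"
    using q by (simp add: balanced_map_def L.A.l_distr M.smult_l_distr pm_add_left pm_add_right
        L.smult_mult_left pm_smult)
next
  fix p assume "p \<in> carrier L \<times> carrier A"
  then obtain d a where p: "p = (d, a)" "d \<in> carrier L" "a \<in> carrier A"
    by auto
  have "a \<odot>\<^bsub>M\<^esub> ((r \<odot> \<one>) \<odot>\<^bsub>M\<^esub> x) = (r \<odot> \<one>) \<odot>\<^bsub>M\<^esub> (a \<odot>\<^bsub>M\<^esub> x)" if "r \<in> carrier k" "x \<in> carrier M" for r x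
    using that p by (simp add: M.smult_assoc1[symmetric] A.m_comm)
  then show "balanced_map k L Mk LM (\<lambda>c x. pm (fst ((\<lambda>(c, a) (d, x). (c \<otimes>\<^bsub>L\<^esub> d, a \<odot>\<^bsub>M\<^esub> x)) p (c, x)))
      (snd ((\<lambda>(c, a) (d, x). (c \<otimes>\<^bsub>L\<^esub> d, a \<odot>\<^bsub>M\<^esub> x)) p (c, x))))"
    using p by (simp add: balanced_map_def L.A.r_distr M.smult_r_distr pm_add_left pm_add_right
        L.smult_mult_right pm_smult)
qed auto

end

sublocale base_change_mod \<subseteq> BM: tensor_bilinear k L A "base_change k L A" L "restrict_scalars A M"
  "base_change_module k L A M" "\<lambda>(c, a) (d, x). (c \<otimes>\<^bsub>L\<^esub> d, a \<odot>\<^bsub>M\<^esub> x)"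
  by (rule tensor_bilinear_smult)

context base_change_mod
begin

lemma smult_LM: "smult LM = BM.act"
  by (simp add: base_change_module_def)

lemma smult_pm [simp]:
  "\<lbrakk>c \<in> carrier L; a \<in> carrier A; d \<in> carrier L; x \<in> carrier M\<rbrakk> \<Longrightarrow>
    pt c a \<odot>\<^bsub>LM\<^esub> pm d x = pm (c \<otimes>\<^bsub>L\<^esub> d) (a \<odot>\<^bsub>M\<^esub> x)"
  using BM.act_pure[of c a d x] by (simp add: smult_LM)

lemma smult_closed_LM [simp]: "U \<in> carrier AL \<Longrightarrow> Z \<in> carrier LM \<Longrightarrow> U \<odot>\<^bsub>LM\<^esub> Z \<in> carrier LM"
  by (simp add: smult_LM)

lemma smult_add_left:
  "\<lbrakk>U \<in> carrier AL; U' \<in> carrier AL; Z \<in> carrier LM\<rbrakk> \<Longrightarrow>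
    (U \<oplus>\<^bsub>AL\<^esub> U') \<odot>\<^bsub>LM\<^esub> Z = U \<odot>\<^bsub>LM\<^esub> Z \<oplus>\<^bsub>LM\<^esub> U' \<odot>\<^bsub>LM\<^esub> Z"
  by (simp add: smult_LM BM.act_add_left)

lemma smult_add_right:
  "\<lbrakk>U \<in> carrier AL; Z \<in> carrier LM; Z' \<in> carrier LM\<rbrakk> \<Longrightarrow>
    U \<odot>\<^bsub>LM\<^esub> (Z \<oplus>\<^bsub>LM\<^esub> Z') = U \<odot>\<^bsub>LM\<^esub> Z \<oplus>\<^bsub>LM\<^esub> U \<odot>\<^bsub>LM\<^esub> Z'"
  by (simp add: smult_LM BM.act_add_right)

lemma LM_induct [consumes 1, case_names pure add]:
  assumes "Z \<in> carrier LM" "\<And>c x. c \<in> carrier L \<Longrightarrow> x \<in> carrier M \<Longrightarrow> Q (pm c x)"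
    and "\<And>Z Z'. \<lbrakk>Z \<in> carrier LM; Z' \<in> carrier LM; Q Z; Q Z'\<rbrakk> \<Longrightarrow> Q (Z \<oplus>\<^bsub>LM\<^esub> Z')"
  shows "Q Z"
  using assms by (induction Z rule: TM.tensor_induct) simp_all

lemma smult_assoc_LM:
  assumes "U \<in> carrier AL" "V \<in> carrier AL" "Z \<in> carrier LM"
  shows "(U \<otimes>\<^bsub>AL\<^esub> V) \<odot>\<^bsub>LM\<^esub> Z = U \<odot>\<^bsub>LM\<^esub> (V \<odot>\<^bsub>LM\<^esub> Z)"
  using assms(1)
proof (induction U rule: T.tensor_induct)
  case (pure c a)
  note ca = pure
  from assms(2) show ?case
  proof (induction V rule: T.tensor_induct)
    case (pure d b)
    from assms(3) show ?case
      by (induction Z rule: LM_induct)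
        (use pure ca in \<open>simp_all add: smult_add_right L.A.m_assoc M.smult_assoc1\<close>)
  qed (use assms ca in \<open>simp add: mult_add_right smult_add_left smult_add_right\<close>)
qed (use assms in \<open>simp add: mult_add_left smult_add_left\<close>)

lemma smult_one_LM: "Z \<in> carrier LM \<Longrightarrow> \<one>\<^bsub>AL\<^esub> \<odot>\<^bsub>LM\<^esub> Z = Z"
  by (induction Z rule: LM_induct) (simp_all add: one_AL smult_add_right)

lemma module_LM: "module AL LM"
  by (rule moduleI)
    (simp_all add: cring_AL TM.abelian_group_P smult_add_left smult_add_right smult_assoc_LM smult_one_LM)

end

section \<open>The module of integrable derivations\<close>

lemma additive_finsum:
  assumes "abelian_group P" "abelian_group Q"
    and closed: "\<And>x. x \<in> carrier P \<Longrightarrow> h x \<in> carrier Q"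
    and add: "\<And>x y. x \<in> carrier P \<Longrightarrow> y \<in> carrier P \<Longrightarrow> h (x \<oplus>\<^bsub>P\<^esub> y) = h x \<oplus>\<^bsub>Q\<^esub> h y"
    and f: "f \<in> B \<rightarrow> carrier P"
  shows "h (\<Oplus>\<^bsub>P\<^esub>b\<in>B. f b) = (\<Oplus>\<^bsub>Q\<^esub>b\<in>B. h (f b))"
proof -
  interpret P: abelian_group P by fact
  interpret Q: abelian_group Q by fact
  have "h \<zero>\<^bsub>P\<^esub> \<oplus>\<^bsub>Q\<^esub> h \<zero>\<^bsub>P\<^esub> = h \<zero>\<^bsub>P\<^esub>"
    using add[of "\<zero>\<^bsub>P\<^esub>" "\<zero>\<^bsub>P\<^esub>"] by simp
  then have zero: "h \<zero>\<^bsub>P\<^esub> = \<zero>\<^bsub>Q\<^esub>"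
    using closed by simp
  show ?thesis
    using f
  proof (induction B rule: infinite_finite_induct)
    case (insert b B)
    have "(\<lambda>b. h (f b)) \<in> B \<rightarrow> carrier Q" "h (f b) \<in> carrier Q"
      using insert closed by auto
    then show ?case
      using insert by (simp add: add P.finsum_closed Pi_def)
  qed (simp_all add: zero)
qed

lemma splits_nat: "splits (n :: nat) = (\<lambda>i. (i, n - i)) ` {..n}"
proof -
  have "(a, b) \<in> (\<lambda>i. (i, n - i)) ` {..n}" if "a + b = n" for a b :: nat
    using that by (intro image_eqI[of _ _ a]) auto
  then show ?thesis
    by auto
qed

context calg
begin

lemma leibniz_nat:
  fixes n :: nat
  assumes "\<And>i. i \<le> n \<Longrightarrow> linear_endo k A (D i)"
  shows "leibniz D n \<longleftrightarrow> (\<forall>x\<in>carrier A. \<forall>y\<in>carrier A.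
     D n (x \<otimes> y) = (\<Oplus>i\<in>{..n}. D i x \<otimes> D (n - i) y))"
proof -
  have "(\<Oplus>p\<in>splits n. D (fst p) x \<otimes> D (snd p) y) = (\<Oplus>i\<in>{..n}. D i x \<otimes> D (n - i) y)"
    if "x \<in> carrier A" "y \<in> carrier A" for x y
    unfolding splits_nat
    by (subst A.finsum_reindex) (use that linear_endo_closed[OF assms] in \<open>auto simp: inj_on_def\<close>)
  then show ?thesis
    by (simp add: leibniz_def)
qed

lemma hasse_schmidt_iff:
  "hasse_schmidt k A m D \<longleftrightarrow> (\<forall>n\<le>m. linear_endo k A (D n)) \<and> (\<forall>x\<in>carrier A. D 0 x = x) \<and> (\<forall>n\<le>m. leibniz D n)"
proof (cases "\<forall>n\<le>m. linear_endo k A (D n)")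
  case True
  then have "leibniz D n \<longleftrightarrow> (\<forall>x\<in>carrier A. \<forall>y\<in>carrier A.
     D n (x \<otimes> y) = (\<Oplus>i\<in>{..n}. D i x \<otimes> D (n - i) y))" if "n \<le> m" for n
    using that by (intro leibniz_nat) auto
  with True show ?thesis
    unfolding hasse_schmidt_def by blast
next
  case False
  then show ?thesis
    unfolding hasse_schmidt_def by blast
qed

text \<open>A sequence of length m may be arbitrary beyond m, whereas convolution asks for linearity
  at all indices. Filling up with zero maps achieves this and keeps the Leibniz rule up to m, where
  only components up to m occur.\<close>

lemma hasse_schmidt_total:
  assumes "hasse_schmidt k A m D"
  obtains D' where "\<And>n. linear_endo k A (D' n)" "\<And>x. x \<in> carrier A \<Longrightarrow> D' 0 x = x"
    "\<And>n. n \<le> m \<Longrightarrow> leibniz D' n" "\<And>n. n \<le> m \<Longrightarrow> D' n = D n"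
proof
  let ?D' = "\<lambda>n. if n \<le> m then D n else (\<lambda>x. \<zero>)"
  show "linear_endo k A (?D' n)" for n
    using assms linear_endo_zero_map by (simp add: hasse_schmidt_iff)
  show "?D' 0 x = x" if "x \<in> carrier A" for x
    using assms that by (simp add: hasse_schmidt_iff)
  show "leibniz ?D' n" if "n \<le> m" for n
  proof -
    have "leibniz D n"
      using assms that by (simp add: hasse_schmidt_iff)
    moreover have "fst p \<le> m \<and> snd p \<le> m" if "p \<in> splits n" for p
      using that \<open>n \<le> m\<close> by simp
    ultimately show ?thesis
      using that linear_endo_closed assms
      by (auto simp: leibniz_def hasse_schmidt_iff intro!: A.finsum_cong')
  qed
qed simp

lemma hasse_schmidtI:
  assumes "\<And>n. linear_endo k A (D n)" "\<And>x. x \<in> carrier A \<Longrightarrow> D 0 x = x" "\<And>n. n \<le> m \<Longrightarrow> leibniz D n"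
  shows "hasse_schmidt k A m D"
  using assms by (simp add: hasse_schmidt_iff)

lemma Der_closed [simp]: "\<delta> \<in> Der k A \<Longrightarrow> x \<in> carrier A \<Longrightarrow> \<delta> x \<in> carrier A"
  by (auto simp: Der_def linear_endo_def)

lemma IDerI:
  assumes "hasse_schmidt k A m D" "1 \<le> m" "\<delta> \<in> extensional (carrier A)" "\<And>x. x \<in> carrier A \<Longrightarrow> \<delta> x = D 1 x"
  shows "\<delta> \<in> IDer k A m"
proof -
  have lin: "linear_endo k A (D 0)" "linear_endo k A (D 1)"
    using assms by (auto simp: hasse_schmidt_iff)
  then have "linear_endo k A \<delta>"
    using assms(4) linear_endo_cong by blast
  moreover have "\<delta> (x \<otimes> y) = x \<otimes> \<delta> y \<oplus> y \<otimes> \<delta> x" if "x \<in> carrier A" "y \<in> carrier A" for x y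
  proof -
    have "\<delta> (x \<otimes> y) = (\<Oplus>i\<in>{..1}. D i x \<otimes> D (1 - i) y)"
      using assms that by (simp add: hasse_schmidt_def)
    also have "\<dots> = D 1 x \<otimes> D 0 y \<oplus> D 0 x \<otimes> D 1 y"
    proof -
      have "D i z \<in> carrier A" if "i \<le> Suc 0" "z \<in> carrier A" for i z
        using that linear_endo_closed[OF lin(1)] linear_endo_closed[OF lin(2)] by (cases i) auto
      then show ?thesis
        using that by (simp add: A.finsum_Suc Pi_def)
    qed
    also have "\<dots> = x \<otimes> \<delta> y \<oplus> y \<otimes> \<delta> x"
      using that assms linear_endo_closed[OF lin(2)] by (simp add: hasse_schmidt_iff A.m_comm A.a_comm)
    finally show ?thesis .
  qed
  ultimately show ?thesis
    using assms by (auto simp: IDer_def Der_def)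
qed

lemma IDer_obtain:
  assumes "\<delta> \<in> IDer k A m" "1 \<le> m"
  obtains D where "\<And>n. linear_endo k A (D n)" "\<And>x. x \<in> carrier A \<Longrightarrow> D 0 x = x"
    "\<And>n. n \<le> m \<Longrightarrow> leibniz D n" "\<And>x. x \<in> carrier A \<Longrightarrow> D 1 x = \<delta> x"
proof -
  obtain D where D: "hasse_schmidt k A m D" "\<forall>x\<in>carrier A. D 1 x = \<delta> x"
    using assms by (auto simp: IDer_def)
  obtain D' where D': "\<And>n. linear_endo k A (D' n)" "\<And>x. x \<in> carrier A \<Longrightarrow> D' 0 x = x"
    "\<And>n. n \<le> m \<Longrightarrow> leibniz D' n" "\<And>n. n \<le> m \<Longrightarrow> D' n = D n"
    using hasse_schmidt_total[OF D(1)] by metis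
  show ?thesis
    by (rule that[of D']) (use D' D(2) assms(2) in auto)
qed

text \<open>Integrated by the trivial sequence Id, 0, 0, and so on.\<close>

lemma IDer_zero: "1 \<le> m \<Longrightarrow> (\<lambda>x\<in>carrier A. \<zero>) \<in> IDer k A m"
proof (rule IDerI[of m "\<lambda>n x. if n = 0 then x else \<zero>"])
  show "hasse_schmidt k A m (\<lambda>n x. if n = 0 then x else \<zero>)"
  proof (rule hasse_schmidtI)
    show lin: "linear_endo k A (\<lambda>x. if n = 0 then x else \<zero>)" for n :: nat
      by (cases "n = 0") (simp_all add: linear_endo_id linear_endo_zero_map)
    show "leibniz (\<lambda>n x. if n = 0 then x else \<zero>) n" for n :: nat
    proof (cases "n = 0")
      case True
      then show ?thesis by (simp add: leibniz_def)
    next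
      case False
      show ?thesis
        by (rule leibniz_off_support[where S="{}"])
          (use False lin in auto)
    qed
  qed simp
qed auto

text \<open>The composite of two Hasse-Schmidt derivations is again one, and its component at 1 is
  the sum of the two components at 1.\<close>

lemma IDer_add:
  assumes "\<delta> \<in> IDer k A m" "\<epsilon> \<in> IDer k A m" "1 \<le> m"
  shows "(\<lambda>x\<in>carrier A. \<delta> x \<oplus> \<epsilon> x) \<in> IDer k A m"
proof -
  obtain D where D: "\<And>n. linear_endo k A (D n)" "\<And>x. x \<in> carrier A \<Longrightarrow> D 0 x = x"
    "\<And>n. n \<le> m \<Longrightarrow> leibniz D n" "\<And>x. x \<in> carrier A \<Longrightarrow> D 1 x = \<delta> x"
    using IDer_obtain[OF assms(1,3)] by metis
  obtain E where E: "\<And>n. linear_endo k A (E n)" "\<And>x. x \<in> carrier A \<Longrightarrow> E 0 x = x"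
    "\<And>n. n \<le> m \<Longrightarrow> leibniz E n" "\<And>x. x \<in> carrier A \<Longrightarrow> E 1 x = \<epsilon> x"
    using IDer_obtain[OF assms(2,3)] by metis
  have cl [simp]: "D n x \<in> carrier A" "E n x \<in> carrier A" if "x \<in> carrier A" for n x
    using D(1) E(1) linear_endo_closed that by auto
  show ?thesis
  proof (rule IDerI[of m "convolve D E"])
    show "hasse_schmidt k A m (convolve D E)"
    proof (rule hasse_schmidtI)
      show "linear_endo k A (convolve D E n)" for n
        by (rule linear_endo_convolve[OF D(1) E(1)])
      show "leibniz (convolve D E) n" if "n \<le> m" for n
        using that by (intro leibniz_convolve[OF D(1) E(1)] D E) auto
      show "convolve D E 0 x = x" if "x \<in> carrier A" for x
        using that by (simp add: convolve_def D E)
    qed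
    have "splits (1 :: nat) = {(0, 1), (1, 0)}"
      by (auto simp: splits_nat atMost_Suc)
    then show "(\<lambda>x\<in>carrier A. \<delta> x \<oplus> \<epsilon> x) x = convolve D E 1 x" if "x \<in> carrier A" for x
      using that by (simp add: convolve_def flip: D(4) E(4)) (simp add: D(2) E(2) A.a_comm)
  qed (use assms in auto)
qed

text \<open>Scaling the n-th component by the n-th power of \<open>a\<close> amounts to substituting
  \<open>a T\<close> for the formal variable, which respects products.\<close>

lemma IDer_smult:
  assumes "\<delta> \<in> IDer k A m" "a \<in> carrier A" "1 \<le> m"
  shows "(\<lambda>x\<in>carrier A. a \<otimes> \<delta> x) \<in> IDer k A m"
proof -
  obtain D where D: "\<And>n. linear_endo k A (D n)" "\<And>x. x \<in> carrier A \<Longrightarrow> D 0 x = x"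
    "\<And>n. n \<le> m \<Longrightarrow> leibniz D n" "\<And>x. x \<in> carrier A \<Longrightarrow> D 1 x = \<delta> x"
    using IDer_obtain[OF assms(1,3)] by metis
  have cl [simp]: "D n x \<in> carrier A" if "x \<in> carrier A" for n x
    using D(1) linear_endo_closed that by auto
  show ?thesis
  proof (rule IDerI[of m "\<lambda>n x. a [^] n \<otimes> D n x"])
    show "hasse_schmidt k A m (\<lambda>n x. a [^] n \<otimes> D n x)"
    proof (rule hasse_schmidtI)
      show "linear_endo k A (\<lambda>x. a [^] n \<otimes> D n x)" for n
        using D(1) assms by (intro linear_endo_mult_map) auto
      show "leibniz (\<lambda>n x. a [^] n \<otimes> D n x) n" if n: "n \<le> m" for n
        unfolding leibniz_def
      proof (intro ballI)
        fix x y assume xy: "x \<in> carrier A" "y \<in> carrier A"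
        have "a [^] n \<otimes> D n (x \<otimes> y) = a [^] n \<otimes> (\<Oplus>p\<in>splits n. D (fst p) x \<otimes> D (snd p) y)"
          using D(3)[OF n] xy by (simp add: leibniz_def)
        also have "\<dots> = (\<Oplus>p\<in>splits n. a [^] n \<otimes> (D (fst p) x \<otimes> D (snd p) y))"
          using xy assms by (intro A.finsum_rdistr) auto
        also have "\<dots> = (\<Oplus>p\<in>splits n. a [^] fst p \<otimes> D (fst p) x \<otimes> (a [^] snd p \<otimes> D (snd p) y))"
        proof (rule A.finsum_cong')
          fix p assume "p \<in> splits n"
          then have "a [^] n = a [^] fst p \<otimes> a [^] snd p"
            using assms by (simp add: A.nat_pow_mult)
          then show "a [^] n \<otimes> (D (fst p) x \<otimes> D (snd p) y)
              = a [^] fst p \<otimes> D (fst p) x \<otimes> (a [^] snd p \<otimes> D (snd p) y)"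
            using xy assms by (simp add: A.m_ac)
        qed (use xy assms in auto)
        finally show "a [^] n \<otimes> D n (x \<otimes> y)
            = (\<Oplus>p\<in>splits n. a [^] fst p \<otimes> D (fst p) x \<otimes> (a [^] snd p \<otimes> D (snd p) y))" .
      qed
    qed (use D assms in auto)
  qed (use D assms in auto)
qed

lemma IDer_closed [simp]: "\<delta> \<in> IDer k A m \<Longrightarrow> x \<in> carrier A \<Longrightarrow> \<delta> x \<in> carrier A"
  by (simp add: IDer_def)

lemma IDer_extensional: "\<delta> \<in> IDer k A m \<Longrightarrow> \<delta> \<in> extensional (carrier A)"
  by (simp add: IDer_def Der_def)

lemma IDer_linear: "\<delta> \<in> IDer k A m \<Longrightarrow> linear_endo k A \<delta>"
  by (simp add: IDer_def Der_def)

lemma IDer_eqI: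
  "\<lbrakk>\<delta> \<in> IDer k A m; \<epsilon> \<in> IDer k A m; \<And>x. x \<in> carrier A \<Longrightarrow> \<delta> x = \<epsilon> x\<rbrakk> \<Longrightarrow> \<delta> = \<epsilon>"
  by (rule extensionalityI[OF IDer_extensional IDer_extensional])

lemma IDer_module_simps [simp]:
  "carrier (IDer_module k A m) = IDer k A m"
  "\<zero>\<^bsub>IDer_module k A m\<^esub> = (\<lambda>x\<in>carrier A. \<zero>)"
  "\<delta> \<oplus>\<^bsub>IDer_module k A m\<^esub> \<epsilon> = (\<lambda>x\<in>carrier A. \<delta> x \<oplus> \<epsilon> x)"
  "a \<odot>\<^bsub>IDer_module k A m\<^esub> \<delta> = (\<lambda>x\<in>carrier A. a \<otimes> \<delta> x)"
  by (simp_all add: IDer_module_def)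

lemma module_IDer:
  assumes m: "1 \<le> m"
  shows "module A (IDer_module k A m)"
proof (rule moduleI)
  show "abelian_group (IDer_module k A m)"
  proof (rule abelian_groupI)
    fix \<delta> assume \<delta>: "\<delta> \<in> carrier (IDer_module k A m)"
    \<comment> \<open>The additive inverse is obtained as the multiple by -1, so its integrability
      is a case of \<open>IDer_smult\<close>.\<close>
    have "(\<lambda>x\<in>carrier A. \<ominus> \<one> \<otimes> \<delta> x) \<in> IDer k A m"
      using \<delta> m by (intro IDer_smult) auto
    moreover have "(\<ominus> \<one> \<otimes> \<delta> x) \<oplus> \<delta> x = \<zero>" if "x \<in> carrier A" for x
      using that \<delta> by (simp add: A.l_minus A.l_neg)
    ultimately show "\<exists>\<epsilon>\<in>carrier (IDer_module k A m). \<epsilon> \<oplus>\<^bsub>IDer_module k A m\<^esub> \<delta> = \<zero>\<^bsub>IDer_module k A m\<^esub>"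
      by (intro bexI[of _ "\<lambda>x\<in>carrier A. \<ominus> \<one> \<otimes> \<delta> x"]) (auto simp: fun_eq_iff)
  next
    fix \<delta> assume \<delta>: "\<delta> \<in> carrier (IDer_module k A m)"
    then show "\<zero>\<^bsub>IDer_module k A m\<^esub> \<oplus>\<^bsub>IDer_module k A m\<^esub> \<delta> = \<delta>"
      using IDer_extensional[of \<delta> m] by (auto simp: fun_eq_iff extensional_def)
  qed (use IDer_zero IDer_add m in \<open>auto simp: fun_eq_iff A.a_assoc A.a_comm A.a_lcomm\<close>)
next
  fix \<delta> assume \<delta>: "\<delta> \<in> carrier (IDer_module k A m)"
  then show "\<one> \<odot>\<^bsub>IDer_module k A m\<^esub> \<delta> = \<delta>"
    using IDer_extensional[of \<delta> m] by (auto simp: fun_eq_iff extensional_def)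
qed (use IDer_smult m in \<open>auto simp: fun_eq_iff A.is_cring A.l_distr A.r_distr A.m_assoc\<close>)

end

section \<open>Coefficients\<close>

locale poly_tensor = indexed_poly k I L + tensor_space k L N P
  for k :: "('k, 'x) ring_scheme" and I :: "'i set" and L :: "('k, 'i multiset \<Rightarrow> 'k) module"
    and N :: "('k, 'n, 'z) module_scheme" and P :: "((('i multiset \<Rightarrow> 'k) \<times> 'n \<Rightarrow>\<^sub>0 int) set, 'w) ring_scheme"
begin

text \<open>The projection to the e-th summand when \<open>L \<otimes> N\<close> is decomposed into
  copies of \<open>N\<close> indexed by the monomials.\<close>

definition coef :: "'i multiset \<Rightarrow> (('i multiset \<Rightarrow> 'k) \<times> 'n \<Rightarrow>\<^sub>0 int) set \<Rightarrow> 'n" where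
  "coef e = tensor_lift N (\<lambda>c n. c e \<odot>\<^bsub>N\<^esub> n)"

lemma coef_tensor_hom: "tensor_hom k L N P N (\<lambda>c n. c e \<odot>\<^bsub>N\<^esub> n)"
proof (intro tensor_hom.intro tensor_hom_axioms.intro tensor_space_axioms N.M.abelian_group_axioms)
  show "balanced_map k L N N (\<lambda>c n. c e \<odot>\<^bsub>N\<^esub> n)"
    by (simp add: balanced_map_def N.smult_l_distr N.smult_r_distr N.smult_assoc1[symmetric] m_comm)
qed

lemma coef_closed [simp]: "U \<in> carrier P \<Longrightarrow> coef e U \<in> carrier N"
  unfolding coef_def by (rule tensor_hom.tensor_lift_closed[OF coef_tensor_hom])

lemma coef_add [simp]:
  "U \<in> carrier P \<Longrightarrow> V \<in> carrier P \<Longrightarrow> coef e (U \<oplus>\<^bsub>P\<^esub> V) = coef e U \<oplus>\<^bsub>N\<^esub> coef e V"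
  unfolding coef_def by (rule tensor_hom.tensor_lift_add[OF coef_tensor_hom])

lemma coef_pure [simp]: "c \<in> carrier L \<Longrightarrow> n \<in> carrier N \<Longrightarrow> coef e (pure c n) = c e \<odot>\<^bsub>N\<^esub> n"
  unfolding coef_def by (rule tensor_hom.tensor_lift_pure[OF coef_tensor_hom])

lemma coef_finsum:
  "f \<in> B \<rightarrow> carrier P \<Longrightarrow> coef e (\<Oplus>\<^bsub>P\<^esub>b\<in>B. f b) = (\<Oplus>\<^bsub>N\<^esub>b\<in>B. coef e (f b))"
  by (rule additive_finsum) (auto simp: P.abelian_group_axioms N.M.abelian_group_axioms)

abbreviation "tmon e \<equiv> indexed_monom \<one>\<^bsub>k\<^esub> e"

lemma tmon_closed [simp]: "set_mset e \<subseteq> I \<Longrightarrow> tmon e \<in> carrier L"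
  by (simp add: monom_closed)

text \<open>\<open>B\<close> may be larger than the support, so that two elements can be expanded
  over one common set.\<close>

definition expands :: "'i multiset set \<Rightarrow> (('i multiset \<Rightarrow> 'k) \<times> 'n \<Rightarrow>\<^sub>0 int) set \<Rightarrow> bool" where
  "expands B U \<longleftrightarrow> finite B \<and> (\<forall>e\<in>B. set_mset e \<subseteq> I) \<and> (\<forall>e. e \<notin> B \<longrightarrow> coef e U = \<zero>\<^bsub>N\<^esub>) \<and>
     U = (\<Oplus>\<^bsub>P\<^esub>e\<in>B. pure (tmon e) (coef e U))"

lemma expansion_closed: "\<forall>e\<in>B. set_mset e \<subseteq> I \<Longrightarrow> U \<in> carrier P \<Longrightarrow> (\<lambda>e. pure (tmon e) (coef e U)) \<in> B \<rightarrow> carrier P"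
  by (intro funcsetI) simp

lemma expansion_superset:
  assumes U: "U \<in> carrier P" and B: "expands B U" and C: "finite C" "\<forall>e\<in>C. set_mset e \<subseteq> I"
    "\<forall>e. e \<notin> C \<longrightarrow> coef e U = \<zero>\<^bsub>N\<^esub>"
  shows "expands C U"
proof -
  let ?f = "\<lambda>e. pure (tmon e) (coef e U)"
  have good: "\<forall>e\<in>B. set_mset e \<subseteq> I" "finite B" "\<forall>e. e \<notin> B \<longrightarrow> coef e U = \<zero>\<^bsub>N\<^esub>"
    using B by (auto simp: expands_def)
  have "U = finsum P ?f B"
    using B by (simp add: expands_def)
  also have "\<dots> = finsum P ?f C"
    using C good pure_zero_right U
    by (intro P.add.finprod_mono_neutral_cong expansion_closed) auto
  finally show ?thesis
    using C unfolding expands_def by blast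
qed

lemma expands_add:
  assumes "U \<in> carrier P" "V \<in> carrier P" "expands B U" "expands C V"
  shows "expands (B \<union> C) (U \<oplus>\<^bsub>P\<^esub> V)"
proof -
  let ?B = "B \<union> C"
  have good: "\<forall>e\<in>?B. set_mset e \<subseteq> I" "finite ?B"
    "\<forall>e. e \<notin> ?B \<longrightarrow> coef e U = \<zero>\<^bsub>N\<^esub>" "\<forall>e. e \<notin> ?B \<longrightarrow> coef e V = \<zero>\<^bsub>N\<^esub>"
    using assms by (auto simp: expands_def)
  then have "expands ?B U" "expands ?B V"
    using expansion_superset[OF assms(1,3)] expansion_superset[OF assms(2,4)] by simp_all
  then have "U \<oplus>\<^bsub>P\<^esub> V = (\<Oplus>\<^bsub>P\<^esub>e\<in>?B. pure (tmon e) (coef e U)) \<oplus>\<^bsub>P\<^esub> (\<Oplus>\<^bsub>P\<^esub>e\<in>?B. pure (tmon e) (coef e V))"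
    by (simp add: expands_def)
  also have "\<dots> = (\<Oplus>\<^bsub>P\<^esub>e\<in>?B. pure (tmon e) (coef e U) \<oplus>\<^bsub>P\<^esub> pure (tmon e) (coef e V))"
    using good assms expansion_closed by (intro P.finsum_addf[symmetric]) blast+
  also have "\<dots> = (\<Oplus>\<^bsub>P\<^esub>e\<in>?B. pure (tmon e) (coef e (U \<oplus>\<^bsub>P\<^esub> V)))"
    using good assms by (intro P.finsum_cong' refl expansion_closed) (auto simp: pure_add_right)
  finally have eq: "U \<oplus>\<^bsub>P\<^esub> V = \<dots>" .
  have "coef e (U \<oplus>\<^bsub>P\<^esub> V) = \<zero>\<^bsub>N\<^esub>" if "e \<notin> ?B" for e
    using that good assms by simp
  then show ?thesis
    unfolding expands_def using good eq by blast
qed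

text \<open>Induction on the tensor and then on its polynomial entry reduces to one monomial, whose
  scalar is moved to the right-hand entry.\<close>

lemma expands_exists:
  assumes "U \<in> carrier P"
  shows "\<exists>B. expands B U"
  using assms
proof (induction U rule: tensor_induct)
  case (pure c n)
  from pure(1) show ?case
  proof (induction c rule: poly_induct)
    case (monom r e)
    have "indexed_monom r e = r \<odot>\<^bsub>L\<^esub> tmon e"
      by (rule monom_smult[OF monom(1)])
    then have *: "pure (indexed_monom r e) n = pure (tmon e) (r \<odot>\<^bsub>N\<^esub> n)"
      using monom pure pure_smult[of r "tmon e" n] by simp
    have co: "coef f (pure (indexed_monom r e) n) = (if f = e then r \<odot>\<^bsub>N\<^esub> n else \<zero>\<^bsub>N\<^esub>)" for f
      using monom pure monom_closed by (simp add: indexed_monom_def)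
    have "expands {e} (pure (indexed_monom r e) n)"
      unfolding expands_def co
      using monom pure by (simp add: P.finsum_insert[of "{}", simplified] *)
    then show ?case ..
  next
    case (add p q)
    then obtain B C where "expands B (pure p n)" "expands C (pure q n)"
      by blast
    then have "expands (B \<union> C) (pure p n \<oplus>\<^bsub>P\<^esub> pure q n)"
      using add pure by (intro expands_add) auto
    then have "expands (B \<union> C) (pure (p \<oplus>\<^bsub>L\<^esub> q) n)"
      using add pure by (simp only: pure_add_left)
    then show ?case ..
  qed
next
  case (add U V)
  then show ?case
    using expands_add by blast
qed

lemma coef_expansion:
  assumes "U \<in> carrier P" "finite B" "\<And>e. e \<in> B \<Longrightarrow> set_mset e \<subseteq> I" "\<And>e. e \<notin> B \<Longrightarrow> coef e U = \<zero>\<^bsub>N\<^esub>"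
  shows "(\<Oplus>\<^bsub>P\<^esub>e\<in>B. pure (tmon e) (coef e U)) = U"
proof -
  obtain C where "expands C U"
    using expands_exists[OF assms(1)] ..
  then have "expands B U"
    by (rule expansion_superset[OF assms(1)]) (use assms in simp_all)
  then show ?thesis
    by (simp add: expands_def)
qed

lemma coef_support:
  assumes "U \<in> carrier P"
  obtains B where "finite B" "\<And>e. e \<in> B \<Longrightarrow> set_mset e \<subseteq> I" "\<And>e. e \<notin> B \<Longrightarrow> coef e U = \<zero>\<^bsub>N\<^esub>"
proof -
  obtain C where "expands C U"
    using expands_exists[OF assms] ..
  then show ?thesis
    by (intro that[of C]) (auto simp: expands_def)
qed

lemma coef_eqI:
  assumes "U \<in> carrier P" "V \<in> carrier P" "\<And>e. coef e U = coef e V"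
  shows "U = V"
proof -
  obtain B where B: "finite B" "\<And>e. e \<in> B \<Longrightarrow> set_mset e \<subseteq> I" "\<And>e. e \<notin> B \<Longrightarrow> coef e U = \<zero>\<^bsub>N\<^esub>"
    using coef_support[OF assms(1)] by metis
  have "U = (\<Oplus>\<^bsub>P\<^esub>e\<in>B. pure (tmon e) (coef e U))"
    using coef_expansion[OF assms(1) B] by simp
  also have "\<dots> = V"
    using coef_expansion[OF assms(2) B(1,2)] B(3) by (simp add: assms(3))
  finally show ?thesis .
qed

end

section \<open>Extending operators from \<open>A\<close> to the base-changed algebra\<close>

context base_change_algebras
begin

text \<open>Formed for any linear map, since all components of a Hasse-Schmidt derivation have to be
  extended, not only derivations.\<close>

definition extend :: "('a \<Rightarrow> 'a) \<Rightarrow> ('l \<times> 'a \<Rightarrow>\<^sub>0 int) set \<Rightarrow> ('l \<times> 'a \<Rightarrow>\<^sub>0 int) set" where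
  "extend f = tensor_lift AL (\<lambda>c a. pt c (f a))"

context
  fixes f :: "'a \<Rightarrow> 'a"
  assumes f: "linear_endo k A f"
begin

lemma extend_tensor_hom: "tensor_hom k L A AL AL (\<lambda>c a. pt c (f a))"
proof (intro tensor_hom.intro tensor_hom_axioms.intro tensor_space_AL T.abelian_group_P)
  show "balanced_map k L A AL (\<lambda>c a. pt c (f a))"
    using linear_endo_closed[OF f]
    by (simp add: balanced_map_def linear_endo_add[OF f] linear_endo_smult[OF f]
        T.pure_add_left T.pure_add_right T.pure_smult)
qed

lemma extend_closed [simp]: "U \<in> carrier AL \<Longrightarrow> extend f U \<in> carrier AL"
  unfolding extend_def by (rule tensor_hom.tensor_lift_closed[OF extend_tensor_hom])

lemma extend_add:
  "U \<in> carrier AL \<Longrightarrow> V \<in> carrier AL \<Longrightarrow> extend f (U \<oplus>\<^bsub>AL\<^esub> V) = extend f U \<oplus>\<^bsub>AL\<^esub> extend f V"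
  unfolding extend_def by (rule tensor_hom.tensor_lift_add[OF extend_tensor_hom])

lemma extend_pure: "c \<in> carrier L \<Longrightarrow> a \<in> carrier A \<Longrightarrow> extend f (pt c a) = pt c (f a)"
  unfolding extend_def by (rule tensor_hom.tensor_lift_pure[OF extend_tensor_hom])

lemma linear_endo_extend: "linear_endo L AL (extend f)"
proof -
  have "extend f (c \<odot>\<^bsub>AL\<^esub> U) = c \<odot>\<^bsub>AL\<^esub> extend f U" if c: "c \<in> carrier L" and "U \<in> carrier AL" for c U
    using that(2)
    by (induction U rule: T.tensor_induct)
      (use c linear_endo_closed[OF f] in \<open>simp_all add: extend_pure extend_add AL.A.smult_r_distr\<close>)
  then show ?thesis
    by (simp add: linear_endo_def extend_add)
qed

end

lemma leibniz_extend:
  assumes D: "\<And>n. linear_endo k A (D n)" and "leibniz D n"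
  shows "AL.leibniz (\<lambda>n. extend (D n)) n"
proof -
  have cl [simp]: "D n x \<in> carrier A" if "x \<in> carrier A" for n x
    by (rule linear_endo_closed[OF D that])
  have ecl [simp]: "extend (D n) U \<in> carrier AL" if "U \<in> carrier AL" for n U
    by (rule extend_closed[OF D that])
  note [simp] = extend_pure[OF D] extend_add[OF D]
  have "extend (D n) (U \<otimes>\<^bsub>AL\<^esub> V) = (\<Oplus>\<^bsub>AL\<^esub>p\<in>splits n. extend (D (fst p)) U \<otimes>\<^bsub>AL\<^esub> extend (D (snd p)) V)"
    if U: "U \<in> carrier AL" and V: "V \<in> carrier AL" for U V
    using U
  proof (induction U rule: T.tensor_induct)
    case (pure c a)
    note ca = pure
    from V show ?case
    proof (induction V rule: T.tensor_induct)
      case (pure d b)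
      have "extend (D n) (pt c a \<otimes>\<^bsub>AL\<^esub> pt d b)
          = pt (c \<otimes>\<^bsub>L\<^esub> d) (\<Oplus>\<^bsub>A\<^esub>p\<in>splits n. D (fst p) a \<otimes> D (snd p) b)"
        using assms(2) ca pure by (simp add: leibniz_def)
      also have "\<dots> = (\<Oplus>\<^bsub>AL\<^esub>p\<in>splits n. pt (c \<otimes>\<^bsub>L\<^esub> d) (D (fst p) a \<otimes> D (snd p) b))"
        using ca pure
        by (intro additive_finsum[of A AL "pt (c \<otimes>\<^bsub>L\<^esub> d)"])
          (auto simp: A.abelian_group_axioms T.abelian_group_P T.pure_add_right)
      finally show ?case
        using ca pure by simp
    next
      case (add V V')
      then show ?case
        using ca by (simp add: mult_add_right T.P.finsum_addf Pi_def)
    qed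
  next
    case (add U U')
    then show ?case
      using V by (simp add: mult_add_left T.P.finsum_addf Pi_def)
  qed
  then show ?thesis
    unfolding AL.leibniz_def by blast
qed

text \<open>Extending an integral of \<delta> component by component integrates the extension of
  \<delta>.\<close>

lemma extend_derivation_IDer:
  assumes "\<delta> \<in> IDer k A m" "1 \<le> m"
  shows "extend_derivation k L A \<delta> \<in> IDer L AL m"
proof -
  obtain D where D: "\<And>n. linear_endo k A (D n)" "\<And>x. x \<in> carrier A \<Longrightarrow> D 0 x = x"
    "\<And>n. n \<le> m \<Longrightarrow> leibniz D n" "\<And>x. x \<in> carrier A \<Longrightarrow> D 1 x = \<delta> x"
    using IDer_obtain[OF assms] by metis
  show ?thesis
  proof (rule AL.IDerI[of m "\<lambda>n. extend (D n)"])
    show "hasse_schmidt L AL m (\<lambda>n. extend (D n))"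
    proof (rule AL.hasse_schmidtI)
      show "extend (D 0) U = U" if "U \<in> carrier AL" for U
        using that by (induction U rule: T.tensor_induct)
          (simp_all add: extend_pure[OF D(1)] extend_add[OF D(1)] D(2))
    qed (use D in \<open>auto intro: leibniz_extend linear_endo_extend\<close>)
    show "extend_derivation k L A \<delta> U = extend (D 1) U" if "U \<in> carrier AL" for U
    proof -
      have "extend \<delta> U = extend (D 1) U"
        using that by (induction U rule: T.tensor_induct)
          (simp_all only: extend_pure[OF D(1)] extend_add[OF D(1)] extend_pure[OF IDer_linear[OF assms(1)]]
            extend_add[OF IDer_linear[OF assms(1)]] D(4))
      then show ?thesis
        using that by (simp add: extend_derivation_def extend_def)
    qed
  qed (use assms in \<open>auto simp: extend_derivation_def\<close>)
qed

lemma scaled_extension_IDer: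
  assumes "c \<in> carrier L" "\<delta> \<in> IDer k A m" "1 \<le> m"
  shows "scaled_extension k L A c \<delta> \<in> IDer L AL m"
  using AL.IDer_smult[OF extend_derivation_IDer[OF assms(2,3)], of "pt c \<one>"] assms
  by (simp add: scaled_extension_def smult_AL)

lemma scaled_extension_pure:
  assumes "c \<in> carrier L" "\<delta> \<in> IDer k A m" "a \<in> carrier A"
  shows "scaled_extension k L A c \<delta> (pt \<one>\<^bsub>L\<^esub> a) = pt c (\<delta> a)"
  using assms extend_pure[OF IDer_linear[OF assms(2)], of "\<one>\<^bsub>L\<^esub>" a]
  by (simp add: scaled_extension_def extend_derivation_def extend_def)

text \<open>A pure tensor is an \<open>L\<close>-multiple of one with first entry 1, so
  \<open>L\<close>-linear maps are determined by their values on the latter.\<close>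

lemma IDer_AL_eqI:
  assumes "\<Delta> \<in> IDer L AL m" "\<Delta>' \<in> IDer L AL m" "\<And>a. a \<in> carrier A \<Longrightarrow> \<Delta> (pt \<one>\<^bsub>L\<^esub> a) = \<Delta>' (pt \<one>\<^bsub>L\<^esub> a)"
  shows "\<Delta> = \<Delta>'"
proof (rule AL.IDer_eqI[OF assms(1,2)])
  fix U assume "U \<in> carrier AL"
  then show "\<Delta> U = \<Delta>' U"
  proof (induction U rule: T.tensor_induct)
    case (pure c a)
    have "pt c a = c \<odot>\<^bsub>AL\<^esub> pt \<one>\<^bsub>L\<^esub> a"
      using pure by simp
    then show ?case
      using AL.linear_endo_smult[OF AL.IDer_linear] assms pure by (metis L.A.one_closed T.pure_closed)
  next
    case (add U V)
    then show ?case
      using AL.linear_endo_add[OF AL.IDer_linear] assms by metis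
  qed
qed

end

section \<open>The base change map\<close>

lemma IDer_antimono:
  assumes "n \<le> m"
  shows "IDer k A m \<subseteq> IDer k A n"
proof -
  have "hasse_schmidt k A n D" if "hasse_schmidt k A m D" for D
    using that assms unfolding hasse_schmidt_def by (meson le_trans)
  then show ?thesis
    unfolding IDer_def by blast
qed

section \<open>Coefficients of integrable derivations\<close>

locale poly_base_change = indexed_poly k I L + base_change_algebras k L A
  for k :: "('k, 'x) ring_scheme" and I :: "'i set" and L :: "('k, 'i multiset \<Rightarrow> 'k) module"
    and A :: "('k, 'a, 'y) module_scheme" (structure)

sublocale poly_base_change \<subseteq> C: poly_tensor k I L A "base_change k L A"
  by (intro poly_tensor.intro indexed_poly_axioms tensor_space_AL)

context poly_base_change
begin

lemma smult_mult_smult: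
  assumes "r \<in> carrier k" "s \<in> carrier k" "a \<in> carrier A" "b \<in> carrier A"
  shows "(r \<odot>\<^bsub>A\<^esub> a) \<otimes>\<^bsub>A\<^esub> (s \<odot>\<^bsub>A\<^esub> b) = (r \<otimes>\<^bsub>k\<^esub> s) \<odot>\<^bsub>A\<^esub> (a \<otimes>\<^bsub>A\<^esub> b)"
  using assms smult_mult_right[of s a b] by (simp add: smult_mult_left A.smult_assoc1)

text \<open>The base-changed algebra behaves as the polynomial ring with coefficients in
  \<open>A\<close>.\<close>

lemma coef_mult:
  assumes "U \<in> carrier AL" "V \<in> carrier AL"
  shows "C.coef e (U \<otimes>\<^bsub>AL\<^esub> V) = (\<Oplus>\<^bsub>A\<^esub>s\<in>splits e. C.coef (fst s) U \<otimes>\<^bsub>A\<^esub> C.coef (snd s) V)"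
  using assms(1)
proof (induction U rule: T.tensor_induct)
  case (pure c a)
  note ca = pure
  from assms(2) show ?case
  proof (induction V rule: T.tensor_induct)
    case (pure d b)
    have "C.coef e (pt c a \<otimes>\<^bsub>AL\<^esub> pt d b)
        = (\<Oplus>\<^bsub>k\<^esub>s\<in>splits e. c (fst s) \<otimes>\<^bsub>k\<^esub> d (snd s)) \<odot>\<^bsub>A\<^esub> (a \<otimes>\<^bsub>A\<^esub> b)"
      using ca pure by (simp add: mult_L)
    also have "\<dots> = (\<Oplus>\<^bsub>A\<^esub>s\<in>splits e. (c (fst s) \<otimes>\<^bsub>k\<^esub> d (snd s)) \<odot>\<^bsub>A\<^esub> (a \<otimes>\<^bsub>A\<^esub> b))"
      using ca pure
      by (intro additive_finsum[of k A "\<lambda>r. r \<odot>\<^bsub>A\<^esub> (a \<otimes>\<^bsub>A\<^esub> b)"])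
        (auto simp: abelian_group_axioms A.abelian_group_axioms A.smult_l_distr)
    also have "\<dots> = (\<Oplus>\<^bsub>A\<^esub>s\<in>splits e. (c (fst s) \<odot>\<^bsub>A\<^esub> a) \<otimes>\<^bsub>A\<^esub> (d (snd s) \<odot>\<^bsub>A\<^esub> b))"
      using ca pure
      by (intro A.finsum_cong' refl) (auto simp: smult_mult_smult)
    finally show ?case
      using ca pure by simp
  next
    case (add V V')
    then show ?case
      using ca by (simp add: mult_add_right A.r_distr A.finsum_addf Pi_def)
  qed
next
  case (add U U')
  then show ?case
    using assms(2) by (simp add: mult_add_left A.l_distr A.finsum_addf Pi_def)
qed

text \<open>The base-changed algebra is only given as an algebra over \<open>L\<close>, so a scalar
  of \<open>k\<close> acts on it as a constant polynomial.\<close>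

lemma coef_smult:
  assumes "r \<in> carrier k" "U \<in> carrier AL"
  shows "C.coef e ((r \<odot>\<^bsub>L\<^esub> \<one>\<^bsub>L\<^esub>) \<odot>\<^bsub>AL\<^esub> U) = r \<odot>\<^bsub>A\<^esub> C.coef e U"
  using assms(2)
proof (induction U rule: T.tensor_induct)
  case (pure c a)
  have "(r \<odot>\<^bsub>L\<^esub> \<one>\<^bsub>L\<^esub>) \<otimes>\<^bsub>L\<^esub> c = r \<odot>\<^bsub>L\<^esub> c"
    using assms pure by (simp add: L.smult_mult_left)
  then have "C.coef e ((r \<odot>\<^bsub>L\<^esub> \<one>\<^bsub>L\<^esub>) \<odot>\<^bsub>AL\<^esub> pt c a) = (r \<odot>\<^bsub>L\<^esub> c) e \<odot>\<^bsub>A\<^esub> a"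
    using assms pure by (simp del: smult_L)
  also have "\<dots> = r \<odot>\<^bsub>A\<^esub> C.coef e (pt c a)"
    using assms pure by (simp add: A.smult_assoc1)
  finally show ?case .
next
  case (add U V)
  then show ?case
    using assms by (simp add: AL.A.smult_r_distr A.smult_r_distr del: smult_L)
qed

text \<open>The coefficients of an integral of \<Delta> form a Hasse-Schmidt derivation of
  \<open>A\<close> indexed by pairs, to which \<open>hs_coefficient_integrable\<close>
  applies.\<close>

lemma coefficient_IDer:
  assumes \<Delta>: "\<Delta> \<in> IDer L AL m" and m: "1 \<le> m"
  shows "(\<lambda>a\<in>carrier A. C.coef e (\<Delta> (pt \<one>\<^bsub>L\<^esub> a))) \<in> IDer k A m"
proof -
  obtain D where D: "\<And>n. linear_endo L AL (D n)" "\<And>U. U \<in> carrier AL \<Longrightarrow> D 0 U = U"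
    "\<And>n. n \<le> m \<Longrightarrow> AL.leibniz D n" "\<And>U. U \<in> carrier AL \<Longrightarrow> D 1 U = \<Delta> U"
    using AL.IDer_obtain[OF assms] by metis
  have cl [simp]: "D n U \<in> carrier AL" if "U \<in> carrier AL" for n U
    by (rule AL.linear_endo_closed[OF D(1) that])
  define E where "E w a = C.coef (snd w) (D (fst w) (pt \<one>\<^bsub>L\<^esub> a))" for w :: "nat \<times> 'i multiset" and a
  have E_closed [simp]: "E w a \<in> carrier A" if "a \<in> carrier A" for w a
    using that by (simp add: E_def)
  have lin: "linear_endo k A (E w)" for w
  proof -
    have "E w (r \<odot>\<^bsub>A\<^esub> a) = r \<odot>\<^bsub>A\<^esub> E w a" if "r \<in> carrier k" "a \<in> carrier A" for r a
    proof -
      have "pt \<one>\<^bsub>L\<^esub> (r \<odot>\<^bsub>A\<^esub> a) = (r \<odot>\<^bsub>L\<^esub> \<one>\<^bsub>L\<^esub>) \<odot>\<^bsub>AL\<^esub> pt \<one>\<^bsub>L\<^esub> a"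
        using that by (simp add: T.pure_smult)
      then show ?thesis
        using that by (simp add: E_def AL.linear_endo_smult[OF D(1)] coef_smult del: smult_pure)
    qed
    moreover have "E w (a \<oplus>\<^bsub>A\<^esub> b) = E w a \<oplus>\<^bsub>A\<^esub> E w b" if "a \<in> carrier A" "b \<in> carrier A" for a b
      using that by (simp add: E_def T.pure_add_right AL.linear_endo_add[OF D(1)])
    ultimately show ?thesis
      unfolding linear_endo_def Pi_iff using E_closed by blast
  qed
  \<comment> \<open>As \<open>D 0\<close> is the identity, its value at the image of
    \<open>a\<close> is a constant polynomial: \<open>a\<close> in degree zero and nothing
    elsewhere.\<close>
  have E0: "E (0, {#}) a = a" if "a \<in> carrier A" for a
    using that by (simp add: E_def D(2) one_L)
  have E_supp: "E (0, \<beta>) a = \<zero>\<^bsub>A\<^esub>" if "\<beta> \<noteq> {#}" "a \<in> carrier A" for \<beta> a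
    using that by (simp add: E_def D(2) one_L)
  have "leibniz E (i, \<beta>)" if i: "i \<le> m" for i \<beta>
    unfolding leibniz_def
  proof (intro ballI)
    fix x y assume xy: "x \<in> carrier A" "y \<in> carrier A"
    \<comment> \<open>A splitting of the pair \<open>(i, \<beta>)\<close> is a splitting of
      \<open>i\<close> together with one of \<beta>; \<open>?h\<close> rearranges the four
      entries.\<close>
    let ?h = "\<lambda>((i, j), (\<beta>, \<gamma>)). ((i, \<beta>), (j, \<gamma>))"
    have "pt \<one>\<^bsub>L\<^esub> (x \<otimes>\<^bsub>A\<^esub> y) = pt \<one>\<^bsub>L\<^esub> x \<otimes>\<^bsub>AL\<^esub> pt \<one>\<^bsub>L\<^esub> y"
      using xy by simp
    then have "E (i, \<beta>) (x \<otimes>\<^bsub>A\<^esub> y)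
        = C.coef \<beta> (\<Oplus>\<^bsub>AL\<^esub>s\<in>splits i. D (fst s) (pt \<one>\<^bsub>L\<^esub> x) \<otimes>\<^bsub>AL\<^esub> D (snd s) (pt \<one>\<^bsub>L\<^esub> y))"
      using D(3)[OF i] xy by (simp add: E_def AL.leibniz_def del: mult_pure)
    also have "\<dots> = (\<Oplus>\<^bsub>A\<^esub>s\<in>splits i. C.coef \<beta> (D (fst s) (pt \<one>\<^bsub>L\<^esub> x) \<otimes>\<^bsub>AL\<^esub> D (snd s) (pt \<one>\<^bsub>L\<^esub> y)))"
      using xy by (intro C.coef_finsum) auto
    also have "\<dots> = (\<Oplus>\<^bsub>A\<^esub>s\<in>splits i. \<Oplus>\<^bsub>A\<^esub>t\<in>splits \<beta>. E (fst s, fst t) x \<otimes>\<^bsub>A\<^esub> E (snd s, snd t) y)"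
      using xy by (intro A.finsum_cong' refl) (auto simp: coef_mult E_def intro!: A.finsum_closed)
    also have "\<dots> = (\<Oplus>\<^bsub>A\<^esub>p\<in>splits i \<times> splits \<beta>. E (fst (?h p)) x \<otimes>\<^bsub>A\<^esub> E (snd (?h p)) y)"
      using xy by (subst A.finsum_Sigma) (auto simp: case_prod_unfold)
    also have "\<dots> = (\<Oplus>\<^bsub>A\<^esub>p\<in>?h ` (splits i \<times> splits \<beta>). E (fst p) x \<otimes>\<^bsub>A\<^esub> E (snd p) y)"
      using xy by (intro A.finsum_reindex[symmetric]) (auto simp: inj_on_def)
    also have "?h ` (splits i \<times> splits \<beta>) = splits (i, \<beta>)"
    proof -
      have "((a, b), (c, d)) \<in> ?h ` (splits i \<times> splits \<beta>)" if "a + c = i" "b + d = \<beta>" for a b c d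
        using that by (intro image_eqI[of _ _ "((a, c), (b, d))"]) auto
      then show ?thesis
        by auto
    qed
    finally show "E (i, \<beta>) (x \<otimes>\<^bsub>A\<^esub> y) = (\<Oplus>\<^bsub>A\<^esub>p\<in>splits (i, \<beta>). E (fst p) x \<otimes>\<^bsub>A\<^esub> E (snd p) y)" .
  qed
  from hs_coefficient_integrable[OF lin E0 E_supp this, of m e]
  obtain D' where "hasse_schmidt k A m D'" "\<forall>x\<in>carrier A. D' 1 x = E (1, e) x"
    by blast
  then show ?thesis
    using m D(4) by (intro IDerI[of m D']) (auto simp: E_def)
qed

text \<open>The zero set of a derivation is a subring containing the constants, since applying the
  product rule to 1 = 1 * 1 forces the value 0 at 1.\<close>

lemma Der_generators:
  assumes "\<delta> \<in> Der k A" "S \<subseteq> carrier A" "\<And>s. s \<in> S \<Longrightarrow> \<delta> s = \<zero>\<^bsub>A\<^esub>"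
    and "x \<in> generate_ring A (S \<union> (\<lambda>r. r \<odot>\<^bsub>A\<^esub> \<one>\<^bsub>A\<^esub>) ` carrier k)"
  shows "\<delta> x = \<zero>\<^bsub>A\<^esub>"
proof -
  let ?H = "S \<union> (\<lambda>r. r \<odot>\<^bsub>A\<^esub> \<one>\<^bsub>A\<^esub>) ` carrier k"
  have lin: "linear_endo k A \<delta>" and mult: "\<And>x y. x \<in> carrier A \<Longrightarrow> y \<in> carrier A \<Longrightarrow>
      \<delta> (x \<otimes>\<^bsub>A\<^esub> y) = x \<otimes>\<^bsub>A\<^esub> \<delta> y \<oplus>\<^bsub>A\<^esub> y \<otimes>\<^bsub>A\<^esub> \<delta> x"
    using assms(1) by (auto simp: Der_def)
  have H: "?H \<subseteq> carrier A"
    using assms(2) by auto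
  have one: "\<delta> \<one>\<^bsub>A\<^esub> = \<zero>\<^bsub>A\<^esub>"
    using mult[of "\<one>\<^bsub>A\<^esub>" "\<one>\<^bsub>A\<^esub>"] Der_closed[OF assms(1), of "\<one>\<^bsub>A\<^esub>"] by simp
  from assms(4) show ?thesis
  proof (induction x rule: generate_ring.induct)
    case (incl h)
    then show ?case
      using assms(3) one linear_endo_smult[OF lin] by auto
  next
    case (a_inv h)
    then show ?case
      using linear_endo_minus[OF lin] A.generate_ring_in_carrier[OF H] by simp
  next
    case (eng_add x y)
    then show ?case
      using linear_endo_add[OF lin] A.generate_ring_in_carrier[OF H] by simp
  next
    case (eng_mult x y)
    then show ?case
      using mult A.generate_ring_in_carrier[OF H] by simp
  qed (rule one)
qed

text \<open>Here finite generation enters. The values of \<Delta> on finitely many generators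
  involve finitely many monomials; at any other monomial the coefficient is a derivation of
  \<open>A\<close> that kills all generators, hence zero.\<close>

lemma coefficients_finite:
  assumes fg: "finitely_generated_algebra k A" and \<Delta>: "\<Delta> \<in> IDer L AL m" and m: "1 \<le> m"
  obtains B where "finite B" "\<And>e. e \<in> B \<Longrightarrow> set_mset e \<subseteq> I"
    "\<And>e a. e \<notin> B \<Longrightarrow> a \<in> carrier A \<Longrightarrow> C.coef e (\<Delta> (pt \<one>\<^bsub>L\<^esub> a)) = \<zero>\<^bsub>A\<^esub>"
proof -
  obtain S where S: "finite S" "S \<subseteq> carrier A"
    "generate_ring A (S \<union> (\<lambda>r. r \<odot>\<^bsub>A\<^esub> \<one>\<^bsub>A\<^esub>) ` carrier k) = carrier A"
    using fg by (auto simp: finitely_generated_algebra_def)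
  have "\<exists>B. finite B \<and> (\<forall>e\<in>B. set_mset e \<subseteq> I) \<and> (\<forall>e. e \<notin> B \<longrightarrow> C.coef e (\<Delta> (pt \<one>\<^bsub>L\<^esub> s)) = \<zero>\<^bsub>A\<^esub>)"
    if "s \<in> S" for s
  proof -
    have "\<Delta> (pt \<one>\<^bsub>L\<^esub> s) \<in> carrier AL"
      using that S(2) \<Delta> by auto
    then show ?thesis
      by (rule C.coef_support) blast
  qed
  then obtain B where B: "finite (B s)" "\<forall>e\<in>B s. set_mset e \<subseteq> I"
    "\<forall>e. e \<notin> B s \<longrightarrow> C.coef e (\<Delta> (pt \<one>\<^bsub>L\<^esub> s)) = \<zero>\<^bsub>A\<^esub>" if "s \<in> S" for s
    by metis
  show ?thesis
  proof (rule that[of "\<Union>(B ` S)"])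
    show "finite (\<Union>(B ` S))"
      using S(1) B(1) by blast
    show "set_mset e \<subseteq> I" if "e \<in> \<Union>(B ` S)" for e
      using that B(2) by blast
    show "C.coef e (\<Delta> (pt \<one>\<^bsub>L\<^esub> a)) = \<zero>\<^bsub>A\<^esub>" if "e \<notin> \<Union>(B ` S)" "a \<in> carrier A" for e a
    proof -
      let ?\<delta> = "\<lambda>a\<in>carrier A. C.coef e (\<Delta> (pt \<one>\<^bsub>L\<^esub> a))"
      have "?\<delta> \<in> Der k A"
        using coefficient_IDer[OF \<Delta> m, of e] by (simp add: IDer_def)
      moreover have "?\<delta> s = \<zero>\<^bsub>A\<^esub>" if "s \<in> S" for s
        using that \<open>e \<notin> _\<close> B(3)[OF that] S(2) by auto
      moreover have "a \<in> generate_ring A (S \<union> (\<lambda>r. r \<odot>\<^bsub>A\<^esub> \<one>\<^bsub>A\<^esub>) ` carrier k)"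
        using S(3) that(2) by simp
      ultimately have "?\<delta> a = \<zero>\<^bsub>A\<^esub>"
        using S(2) Der_generators by blast
      then show ?thesis
        using that(2) by simp
    qed
  qed
qed

end

section \<open>The isomorphism \<Phi>\<close>

locale poly_IDer = poly_base_change k I L A
  for k :: "('k, 'x) ring_scheme" and I :: "'i set" and L :: "('k, 'i multiset \<Rightarrow> 'k) module"
    and A :: "('k, 'a, 'y) module_scheme" (structure) +
  fixes m :: nat
  assumes m: "1 \<le> m"

sublocale poly_IDer \<subseteq> M: base_change_mod k L A "IDer_module k A m"
  by (intro base_change_mod.intro base_change_algebras_axioms module_IDer[OF m])

sublocale poly_IDer \<subseteq> CM: poly_tensor k I L "restrict_scalars A (IDer_module k A m)"
    "base_change_module k L A (IDer_module k A m)"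
  by (intro poly_tensor.intro indexed_poly_axioms M.tensor_space_LM)

context poly_IDer
begin

abbreviation "Q \<equiv> IDer_module L AL m"
abbreviation "\<Phi> \<equiv> base_change_map k L A m"

lemma abelian_group_Q: "abelian_group Q"
  using AL.module_IDer[OF m] by (rule module.axioms)

text \<open>This makes \<Phi> well defined. Each required identity is between integrable derivations
  over \<open>L\<close> and is tested on tensors with first entry 1.\<close>

lemma phi_tensor_hom: "tensor_hom k L M.Mk M.LM Q (scaled_extension k L A)"
proof (intro tensor_hom.intro tensor_hom_axioms.intro M.tensor_space_LM abelian_group_Q)
  note [simp] = scaled_extension_pure scaled_extension_IDer[OF _ _ m]
  note eqI = IDer_AL_eqI[of _ m]
  have IDer_k: "(\<lambda>x\<in>carrier A. (r \<odot>\<^bsub>A\<^esub> \<one>\<^bsub>A\<^esub>) \<otimes>\<^bsub>A\<^esub> \<delta> x) \<in> IDer k A m"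
    if "r \<in> carrier k" "\<delta> \<in> IDer k A m" for r \<delta>
    using that m by (intro IDer_smult) auto
  show "balanced_map k L M.Mk Q (scaled_extension k L A)"
    unfolding balanced_map_def
  proof (intro conjI ballI)
    fix c d \<delta> assume *: "c \<in> carrier L" "d \<in> carrier L" "\<delta> \<in> carrier M.Mk"
    show "scaled_extension k L A (c \<oplus>\<^bsub>L\<^esub> d) \<delta> = scaled_extension k L A c \<delta> \<oplus>\<^bsub>Q\<^esub> scaled_extension k L A d \<delta>"
      using * m by (intro eqI) (auto simp: T.pure_add_left intro!: AL.IDer_add)
  next
    fix c \<delta> \<epsilon> assume *: "c \<in> carrier L" "\<delta> \<in> carrier M.Mk" "\<epsilon> \<in> carrier M.Mk"
    show "scaled_extension k L A c (\<delta> \<oplus>\<^bsub>M.Mk\<^esub> \<epsilon>) = scaled_extension k L A c \<delta> \<oplus>\<^bsub>Q\<^esub> scaled_extension k L A c \<epsilon>"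
      using * m IDer_add[of \<delta> m \<epsilon>] by (intro eqI) (auto simp: T.pure_add_right intro!: AL.IDer_add)
  next
    fix r c \<delta> assume *: "r \<in> carrier k" "c \<in> carrier L" "\<delta> \<in> carrier M.Mk"
    show "scaled_extension k L A (r \<odot>\<^bsub>L\<^esub> c) \<delta> = scaled_extension k L A c (r \<odot>\<^bsub>M.Mk\<^esub> \<delta>)"
      using * m IDer_k[of r \<delta>] by (intro eqI) (auto simp: T.pure_smult smult_mult_left)
  qed simp
qed

lemma phi_closed [simp]: "Z \<in> carrier M.LM \<Longrightarrow> \<Phi> Z \<in> IDer L AL m"
  using tensor_hom.tensor_lift_closed[OF phi_tensor_hom] by (simp add: base_change_map_def)

lemma phi_add:
  "\<lbrakk>Z \<in> carrier M.LM; Z' \<in> carrier M.LM\<rbrakk> \<Longrightarrow> \<Phi> (Z \<oplus>\<^bsub>M.LM\<^esub> Z') = \<Phi> Z \<oplus>\<^bsub>Q\<^esub> \<Phi> Z'"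
  using tensor_hom.tensor_lift_add[OF phi_tensor_hom] by (simp add: base_change_map_def)

lemma phi_pure: "c \<in> carrier L \<Longrightarrow> \<delta> \<in> IDer k A m \<Longrightarrow> \<Phi> (M.pm c \<delta>) = scaled_extension k L A c \<delta>"
  using tensor_hom.tensor_lift_pure[OF phi_tensor_hom, of c \<delta>] by (simp add: base_change_map_def)

lemma phi_smult:
  assumes "W \<in> carrier AL" "Z \<in> carrier M.LM"
  shows "\<Phi> (W \<odot>\<^bsub>M.LM\<^esub> Z) = W \<odot>\<^bsub>Q\<^esub> \<Phi> Z"
proof -
  interpret Q: module AL Q
    by (rule AL.module_IDer[OF m])
  show ?thesis
    using assms(1)
  proof (induction W rule: T.tensor_induct)
    case (pure c a)
    note ca = pure
    from assms(2) show ?case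
    proof (induction Z rule: M.LM_induct)
      case (pure d \<delta>)
      have a\<delta>: "(\<lambda>x\<in>carrier A. a \<otimes>\<^bsub>A\<^esub> \<delta> x) \<in> IDer k A m"
        using ca pure m by (intro IDer_smult) auto
      have "\<Phi> (pt c a \<odot>\<^bsub>M.LM\<^esub> M.pm d \<delta>) = scaled_extension k L A (c \<otimes>\<^bsub>L\<^esub> d) (\<lambda>x\<in>carrier A. a \<otimes>\<^bsub>A\<^esub> \<delta> x)"
        using ca pure a\<delta> M.smult_pm[of c a d \<delta>] by (simp add: phi_pure)
      also have "\<dots> = pt c a \<odot>\<^bsub>Q\<^esub> scaled_extension k L A d \<delta>"
      proof (rule IDer_AL_eqI[of _ m])
        show "scaled_extension k L A (c \<otimes>\<^bsub>L\<^esub> d) (\<lambda>x\<in>carrier A. a \<otimes>\<^bsub>A\<^esub> \<delta> x) \<in> IDer L AL m"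
          using ca pure a\<delta> m by (intro scaled_extension_IDer) auto
        show "pt c a \<odot>\<^bsub>Q\<^esub> scaled_extension k L A d \<delta> \<in> IDer L AL m"
          using ca pure scaled_extension_IDer[of d \<delta> m] m
          by (simp add: AL.IDer_smult)
        fix b assume b: "b \<in> carrier A"
        show "scaled_extension k L A (c \<otimes>\<^bsub>L\<^esub> d) (\<lambda>x\<in>carrier A. a \<otimes>\<^bsub>A\<^esub> \<delta> x) (pt \<one>\<^bsub>L\<^esub> b)
            = (pt c a \<odot>\<^bsub>Q\<^esub> scaled_extension k L A d \<delta>) (pt \<one>\<^bsub>L\<^esub> b)"
          using ca pure b scaled_extension_pure[of "c \<otimes>\<^bsub>L\<^esub> d" _ m b, OF _ a\<delta>] scaled_extension_pure[of d \<delta> m b]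
          by simp
      qed
      finally show ?case
        using pure by (simp add: phi_pure)
    next
      case (add Z Z')
      then show ?case
        using ca by (simp add: M.smult_add_right phi_add Q.smult_r_distr del: AL.IDer_module_simps(3,4))
    qed
  next
    case (add W W')
    then show ?case
      using assms(2) by (simp add: M.smult_add_left phi_add Q.smult_l_distr del: AL.IDer_module_simps(3,4))
  qed
qed

text \<open>Under \<Phi>, the coefficients of a tensor are the coefficient derivations of its image,
  so both can be compared monomial by monomial; injectivity follows at once.\<close>

lemma phi_coef:
  assumes "Z \<in> carrier M.LM" "a \<in> carrier A"
  shows "C.coef e (\<Phi> Z (pt \<one>\<^bsub>L\<^esub> a)) = CM.coef e Z a"
  using assms(1)
proof (induction Z rule: M.LM_induct)
  case (pure c \<delta>)
  then show ?case
    using assms(2) CM.coef_pure[of c \<delta> e]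
    by (simp add: phi_pure scaled_extension_pure[of c \<delta> m] smult_mult_left)
next
  case (add Z Z')
  have "CM.coef e (Z \<oplus>\<^bsub>M.LM\<^esub> Z') a = CM.coef e Z a \<oplus>\<^bsub>A\<^esub> CM.coef e Z' a"
    using add assms(2) by simp
  moreover have "\<Phi> (Z \<oplus>\<^bsub>M.LM\<^esub> Z') (pt \<one>\<^bsub>L\<^esub> a) = \<Phi> Z (pt \<one>\<^bsub>L\<^esub> a) \<oplus>\<^bsub>AL\<^esub> \<Phi> Z' (pt \<one>\<^bsub>L\<^esub> a)"
    using add assms(2) by (simp add: phi_add)
  ultimately show ?case
    using add assms(2) AL.IDer_closed[OF phi_closed] by simp
qed

lemma phi_inj: "inj_on \<Phi> (carrier M.LM)"
proof (rule inj_onI)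
  fix Z Z' assume *: "Z \<in> carrier M.LM" "Z' \<in> carrier M.LM" "\<Phi> Z = \<Phi> Z'"
  have IDer: "CM.coef e Z'' \<in> IDer k A m" if "Z'' \<in> carrier M.LM" for e Z''
    using CM.coef_closed[OF that, of e] by simp
  have "CM.coef e Z = CM.coef e Z'" for e
    by (rule IDer_eqI[OF IDer[OF *(1)] IDer[OF *(2)]]) (use * phi_coef in metis)
  then show "Z = Z'"
    using * by (intro CM.coef_eqI)
qed

text \<open>The preimage is the sum of monomials tensored with the coefficient derivations of
  \<Delta>. These are integrable by \<open>coefficient_IDer\<close>, and the sum is finite by
  \<open>coefficients_finite\<close>.\<close>

lemma phi_surj:
  assumes fg: "finitely_generated_algebra k A" and \<Delta>: "\<Delta> \<in> IDer L AL m"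
  shows "\<exists>Z\<in>carrier M.LM. \<Phi> Z = \<Delta>"
proof -
  obtain B where B: "finite B" "\<And>e. e \<in> B \<Longrightarrow> set_mset e \<subseteq> I"
    "\<And>e a. e \<notin> B \<Longrightarrow> a \<in> carrier A \<Longrightarrow> C.coef e (\<Delta> (pt \<one>\<^bsub>L\<^esub> a)) = \<zero>\<^bsub>A\<^esub>"
    using coefficients_finite[OF fg \<Delta> m] by blast
  define \<delta> where "\<delta> e = (\<lambda>a\<in>carrier A. C.coef e (\<Delta> (pt \<one>\<^bsub>L\<^esub> a)))" for e
  have \<delta>: "\<delta> e \<in> IDer k A m" for e
    unfolding \<delta>_def by (rule coefficient_IDer[OF \<Delta> m])
  define Z where "Z = (\<Oplus>\<^bsub>M.LM\<^esub>e\<in>B. M.pm (C.tmon e) (\<delta> e))"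
  have cl: "(\<lambda>e. M.pm (C.tmon e) (\<delta> e)) \<in> B \<rightarrow> carrier M.LM"
    using B(2) \<delta> by (intro funcsetI M.pm_closed) auto
  have Z: "Z \<in> carrier M.LM"
    unfolding Z_def by (rule M.TM.P.finsum_closed[OF cl])
  have "\<Phi> Z = \<Delta>"
  proof (rule IDer_AL_eqI[OF phi_closed[OF Z] \<Delta>])
    fix a assume a: "a \<in> carrier A"
    have "\<Phi> Z (pt \<one>\<^bsub>L\<^esub> a) = (\<Oplus>\<^bsub>AL\<^esub>e\<in>B. \<Phi> (M.pm (C.tmon e) (\<delta> e)) (pt \<one>\<^bsub>L\<^esub> a))"
      unfolding Z_def
      by (rule additive_finsum[OF M.TM.abelian_group_P T.abelian_group_P _ _ cl, of "\<lambda>Z. \<Phi> Z (pt \<one>\<^bsub>L\<^esub> a)"])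
        (use a AL.IDer_closed[OF phi_closed] in \<open>auto simp: phi_add\<close>)
    also have "\<dots> = (\<Oplus>\<^bsub>AL\<^esub>e\<in>B. pt (C.tmon e) (C.coef e (\<Delta> (pt \<one>\<^bsub>L\<^esub> a))))"
    proof (intro T.P.finsum_cong' refl)
      show "\<Phi> (M.pm (C.tmon e) (\<delta> e)) (pt \<one>\<^bsub>L\<^esub> a) = pt (C.tmon e) (C.coef e (\<Delta> (pt \<one>\<^bsub>L\<^esub> a)))"
        if "e \<in> B" for e
      proof -
        have "\<Phi> (M.pm (C.tmon e) (\<delta> e)) (pt \<one>\<^bsub>L\<^esub> a) = pt (C.tmon e) (\<delta> e a)"
          using B(2)[OF that] phi_pure[OF _ \<delta>] scaled_extension_pure[OF _ \<delta> a] by simp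
        then show ?thesis
          using a by (simp add: \<delta>_def)
      qed
    qed (use B(2) a \<Delta> in auto)
    also have "\<dots> = \<Delta> (pt \<one>\<^bsub>L\<^esub> a)"
      using B a \<Delta> by (intro C.coef_expansion) auto
    finally show "\<Phi> Z (pt \<one>\<^bsub>L\<^esub> a) = \<Delta> (pt \<one>\<^bsub>L\<^esub> a)" .
  qed
  with Z show ?thesis by blast
qed

lemma phi_module_iso:
  assumes "finitely_generated_algebra k A"
  shows "module_iso AL M.LM Q \<Phi>"
  unfolding module_iso_def bij_betw_def
proof (intro conjI ballI)
  show "module AL M.LM"
    by (rule M.module_LM)
  show "module AL Q"
    by (rule AL.module_IDer[OF m])
  show "inj_on \<Phi> (carrier M.LM)"
    by (rule phi_inj)
  show "\<Phi> ` carrier M.LM = carrier Q"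
    using phi_surj[OF assms] phi_closed by (auto simp: image_iff)
qed (simp_all add: phi_add phi_smult del: AL.IDer_module_simps(3,4))

end

section \<open>Transfer of leaps\<close>

context poly_base_change
begin

text \<open>Downwards, \<delta> is recovered as the constant coefficient of its extension. Upwards,
  surjectivity at level \<open>n\<close> writes a derivation as a sum of scaled extensions, each of
  which is integrable to level \<open>m\<close>.\<close>

lemma IDer_base_change_subset:
  assumes fg: "finitely_generated_algebra k A" and mn: "1 \<le> m" "1 \<le> n"
  shows "IDer k A n \<subseteq> IDer k A m \<longleftrightarrow> IDer L AL n \<subseteq> IDer L AL m"
proof
  assume sub: "IDer L AL n \<subseteq> IDer L AL m"
  show "IDer k A n \<subseteq> IDer k A m"
  proof
    fix \<delta> assume \<delta>: "\<delta> \<in> IDer k A n"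
    let ?\<Delta> = "scaled_extension k L A \<one>\<^bsub>L\<^esub> \<delta>"
    have "?\<Delta> \<in> IDer L AL m"
      using scaled_extension_IDer[OF _ \<delta> mn(2), of "\<one>\<^bsub>L\<^esub>"] sub by auto
    then have "(\<lambda>a\<in>carrier A. C.coef {#} (?\<Delta> (pt \<one>\<^bsub>L\<^esub> a))) \<in> IDer k A m"
      using mn(1) by (rule coefficient_IDer)
    also have "(\<lambda>a\<in>carrier A. C.coef {#} (?\<Delta> (pt \<one>\<^bsub>L\<^esub> a))) = \<delta>"
      using IDer_extensional[OF \<delta>] IDer_closed[OF \<delta>]
      by (auto simp: fun_eq_iff scaled_extension_pure[OF _ \<delta>] one_L extensional_def)
    finally show "\<delta> \<in> IDer k A m" .
  qed
next
  assume sub: "IDer k A n \<subseteq> IDer k A m"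
  interpret m: poly_IDer k I L A m
    by (intro poly_IDer.intro poly_IDer_axioms.intro poly_base_change_axioms mn(1))
  interpret n: poly_IDer k I L A n
    by (intro poly_IDer.intro poly_IDer_axioms.intro poly_base_change_axioms mn(2))
  have "n.\<Phi> Z \<in> IDer L AL m" if "Z \<in> carrier n.M.LM" for Z
    using that
  proof (induction Z rule: n.M.LM_induct)
    case (pure c \<delta>)
    then show ?case
      using sub mn scaled_extension_IDer[of c \<delta> m] by (auto simp: n.phi_pure)
  next
    case (add Z Z')
    \<comment> \<open>Addition is pointwise at every level, so the sum formed at level
      \<open>n\<close> is also the sum at level \<open>m\<close>.\<close>
    then have "n.\<Phi> Z \<oplus>\<^bsub>n.Q\<^esub> n.\<Phi> Z' \<in> IDer L AL m"
      using AL.IDer_add[of "n.\<Phi> Z" m "n.\<Phi> Z'"] mn(1) by (simp only: AL.IDer_module_simps)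
    then show ?case
      using add by (simp only: n.phi_add)
  qed
  then show "IDer L AL n \<subseteq> IDer L AL m"
    using n.phi_surj[OF fg] by blast
qed

text \<open>Truncation always gives the inclusion of level s in level s - 1, so a leap is the
  failure of the reverse inclusion, and that is preserved in both directions.\<close>

lemma Leaps_base_change:
  assumes fg: "finitely_generated_algebra k A"
  shows "Leaps k A = Leaps L AL"
proof -
  have "IDer k A s \<subset> IDer k A (s - 1) \<longleftrightarrow> IDer L AL s \<subset> IDer L AL (s - 1)" if s: "s > 1" for s
  proof -
    have "IDer k A (s - 1) \<subseteq> IDer k A s \<longleftrightarrow> IDer L AL (s - 1) \<subseteq> IDer L AL s"
      by (rule IDer_base_change_subset[OF fg]) (use s in simp_all)
    moreover have "IDer k A s \<subseteq> IDer k A (s - 1)" "IDer L AL s \<subseteq> IDer L AL (s - 1)"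
      by (simp_all add: IDer_antimono)
    ultimately show ?thesis
      unfolding less_le_not_le by (simp only: simp_thms)
  qed
  then show ?thesis
    unfolding Leaps_def by blast
qed

end

theorem corollary3p19:
  fixes k :: "('k, 'x) ring_scheme" and A :: "('k, 'a, 'y) module_scheme" and I :: "'i set"
    and L :: "('k, 'i multiset \<Rightarrow> 'k) module"
    and AL :: "('i multiset \<Rightarrow> 'k, (('i multiset \<Rightarrow> 'k) \<times> 'a \<Rightarrow>\<^sub>0 int) set) module"
  assumes "cring k"
    and "algebra k A"
    and "finitely_generated_algebra k A"
    and L: "L = indexed_poly_ring k I"
    and AL: "AL = base_change k L A"
  shows "(\<forall>m\<ge>1.
            module_iso AL (base_change_module k L A (IDer_module k A m)) (IDer_module L AL m)
              (base_change_map k L A m) \<and>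
            (\<forall>c\<in>carrier L. \<forall>\<delta>\<in>IDer k A m.
              base_change_map k L A m
                (pure_tensor k L (restrict_scalars A (IDer_module k A m)) c \<delta>)
              = scaled_extension k L A c \<delta>)) \<and>
         Leaps k A = Leaps L AL"
proof -
  interpret P: indexed_poly k I L
    by (intro indexed_poly.intro indexed_poly_axioms.intro assms)
  interpret poly_base_change k I L A
    by (intro poly_base_change.intro base_change_algebras.intro calg.intro P.indexed_poly_axioms
        P.algebra_L assms)
  have "module_iso AL (base_change_module k L A (IDer_module k A m)) (IDer_module L AL m)
      (base_change_map k L A m) \<and> (\<forall>c\<in>carrier L. \<forall>\<delta>\<in>IDer k A m.
        base_change_map k L A m (pure_tensor k L (restrict_scalars A (IDer_module k A m)) c \<delta>)
        = scaled_extension k L A c \<delta>)" if "m \<ge> 1" for m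
  proof -
    interpret m: poly_IDer k I L A m
      by (intro poly_IDer.intro poly_IDer_axioms.intro poly_base_change_axioms that)
    show ?thesis
      using m.phi_module_iso m.phi_pure assms by simp
  qed
  then show ?thesis
    using Leaps_base_change assms by blast
qed

end
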